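(* In Bishop's constructive mathematics, the statement "the unit ball of every finite-dimensional q-normed space is totally bounded" implies the omniscience principle WLPO: for each binary sequence $(a_n)_{n\ge1}$, either $a_n=0$ for all $n$ or it is not the case that $a_n=0$ for all $n$.
   Context: Setting: Bishop-style constructive mathematics (BISH: intuitionistic logic with dependent choice); the implication is to be derived there, without the law of excluded middle. All linear spaces are real. A q-normed space is a pair $(X,(\|\cdot\|_i)_{i\in I})$ where $X$ is a real linear space and $(\|\cdot\|_i)_{i\in I}$ (the q-norm) is a family of seminorms on $X$ such that for each $x\in X$ the set $\{\|x\|_i:i\in I\}$ is bounded in $\mathbf{R}$. Equality and inequality: $x=y$ iff $\|x-y\|_i=0$ for all $i\in I$; $x\neq y$ iff $\|x-y\|_i>0$ for some $i\in I$. The unit ball of $X$ is $\{x\in X:\|x\|_i\le1\text{ for all }i\in I\}$. A set $A\subset S$ is an $\varepsilon$-approximation to $S\subset X$ if for each $x\in S$ there exists $x'\in A$ such that $\|x-x'\|_i<\varepsilon$ for all $i\in I$. $S$ is totally bounded if for each $\varepsilon>0$ there exists a finitely enumerable $\varepsilon$-approximation to $S$, where finitely enumerable means of the form $\{x_1,\dots,x_N\}$ (the image of $\{1,\dots,N\}$) for some $N$. $X$ is finite-dimensional if for some $n$ it has a basis $\{b_1,\dots,b_n\}$: every element of $X$ is of the form $\sum_{k=1}^n\lambda_kb_k$ with $\lambda_k\in\mathbf{R}$, and $\sum_{k=1}^n\lambda_kb_k\neq0$ whenever $\sum_{k=1}^n|\lambda_k|>0$. A binary sequence is a sequence with values in $\{0,1\}$.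 *)

theory Defs
  imports Main
begin

text \<open>
  Bishop-style constructive mathematics is rendered by the formal system CZF + DC: Aczel's
  constructive Zermelo-Fraenkel set theory with dependent choice, over intuitionistic first-order
  logic with equality. The implication is stated as the derivability of one sentence in this system.
\<close>

section \<open>Intuitionistic first-order logic\<close>

text \<open>De Bruijn indices; the only terms are variables.\<close>

datatype fm =
    Mem nat nat
  | Eq nat nat
  | Bot
  | And fm fm
  | Or fm fm
  | Imp fm fm
  | All fm
  | Ex fm

primrec ren :: "(nat \<Rightarrow> nat) \<Rightarrow> fm \<Rightarrow> fm" where
  "ren r (Mem x y) = Mem (r x) (r y)"
| "ren r (Eq x y) = Eq (r x) (r y)"
| "ren r Bot = Bot"
| "ren r (And A B) = And (ren r A) (ren r B)"
| "ren r (Or A B) = Or (ren r A) (ren r B)"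
| "ren r (Imp A B) = Imp (ren r A) (ren r B)"
| "ren r (All A) = All (ren (case_nat 0 (\<lambda>i. Suc (r i))) A)"
| "ren r (Ex A) = Ex (ren (case_nat 0 (\<lambda>i. Suc (r i))) A)"

abbreviation shift :: "fm \<Rightarrow> fm" where
  "shift \<equiv> ren Suc"

definition inst :: "nat \<Rightarrow> fm \<Rightarrow> fm" where
  "inst t = ren (case_nat t (\<lambda>i. i))"

text \<open>
  Natural deduction from a set of axioms \<open>T\<close> and local hypotheses \<open>G\<close>. Free variables of axioms are
  read universally: the eigenvariable rules shift \<open>G\<close> but not \<open>T\<close>.
\<close>

inductive deriv :: "fm set \<Rightarrow> fm set \<Rightarrow> fm \<Rightarrow> bool" for T :: "fm set" where
  Axiom: "A \<in> T \<Longrightarrow> deriv T G A"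
| Hyp: "A \<in> G \<Longrightarrow> deriv T G A"
| BotE: "deriv T G Bot \<Longrightarrow> deriv T G A"
| AndI: "deriv T G A \<Longrightarrow> deriv T G B \<Longrightarrow> deriv T G (And A B)"
| AndE1: "deriv T G (And A B) \<Longrightarrow> deriv T G A"
| AndE2: "deriv T G (And A B) \<Longrightarrow> deriv T G B"
| OrI1: "deriv T G A \<Longrightarrow> deriv T G (Or A B)"
| OrI2: "deriv T G B \<Longrightarrow> deriv T G (Or A B)"
| OrE: "deriv T G (Or A B) \<Longrightarrow> deriv T (insert A G) C \<Longrightarrow> deriv T (insert B G) C \<Longrightarrow> deriv T G C"
| ImpI: "deriv T (insert A G) B \<Longrightarrow> deriv T G (Imp A B)"
| ImpE: "deriv T G (Imp A B) \<Longrightarrow> deriv T G A \<Longrightarrow> deriv T G B"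
| AllI: "deriv T (shift ` G) A \<Longrightarrow> deriv T G (All A)"
| AllE: "deriv T G (All A) \<Longrightarrow> deriv T G (inst t A)"
| ExI: "deriv T G (inst t A) \<Longrightarrow> deriv T G (Ex A)"
| ExE: "deriv T G (Ex A) \<Longrightarrow> deriv T (insert A (shift ` G)) (shift C) \<Longrightarrow> deriv T G C"
| EqI: "deriv T G (Eq t t)"
| EqE: "deriv T G (Eq s t) \<Longrightarrow> deriv T G (inst s A) \<Longrightarrow> deriv T G (inst t A)"

section \<open>Formulas with HOL-bound variables\<close>

text \<open>
  A \<open>form\<close> is a formula as a function of its quantifier depth. A variable is represented by its
  de Bruijn level (the depth at which it is bound), so level \<open>l\<close> at depth \<open>d\<close> is index \<open>d - Suc l\<close>.

  A \<open>trm\<close> is a term in continuation-passing style: \<open>t K\<close> says that the value of \<open>t\<close> satisfies \<open>K\<close>.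
  This gives function application and other definite descriptions, eliminated as usual in favour of
  existential quantifiers at each atomic formula; descriptions are only used where existence and
  uniqueness are provable from the accompanying hypotheses.
\<close>

type_synonym form = "nat \<Rightarrow> fm"
type_synonym trm = "(nat \<Rightarrow> form) \<Rightarrow> form"

definition f_mem :: "trm \<Rightarrow> trm \<Rightarrow> form" (infix "\<^bold>\<in>" 50) where
  "(s \<^bold>\<in> t) = s (\<lambda>x. t (\<lambda>y d. Mem (d - Suc x) (d - Suc y)))"

definition f_eq :: "trm \<Rightarrow> trm \<Rightarrow> form" (infix "\<^bold>=" 50) where
  "(s \<^bold>= t) = s (\<lambda>x. t (\<lambda>y d. Eq (d - Suc x) (d - Suc y)))"

definition f_not :: "form \<Rightarrow> form" ("\<^bold>\<not> _" [40] 40) where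
  "(\<^bold>\<not> A) = (\<lambda>d. Imp (A d) Bot)"

definition f_and :: "form \<Rightarrow> form \<Rightarrow> form" (infixr "\<^bold>\<and>" 35) where
  "(A \<^bold>\<and> B) = (\<lambda>d. And (A d) (B d))"

definition f_or :: "form \<Rightarrow> form \<Rightarrow> form" (infixr "\<^bold>\<or>" 30) where
  "(A \<^bold>\<or> B) = (\<lambda>d. Or (A d) (B d))"

definition f_imp :: "form \<Rightarrow> form \<Rightarrow> form" (infixr "\<^bold>\<longrightarrow>" 25) where
  "(A \<^bold>\<longrightarrow> B) = (\<lambda>d. Imp (A d) (B d))"

definition f_iff :: "form \<Rightarrow> form \<Rightarrow> form" (infix "\<^bold>\<longleftrightarrow>" 25) where
  "(A \<^bold>\<longleftrightarrow> B) = ((A \<^bold>\<longrightarrow> B) \<^bold>\<and> (B \<^bold>\<longrightarrow> A))"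

definition var :: "nat \<Rightarrow> trm" where
  "var l = (\<lambda>K. K l)"

definition f_all :: "(trm \<Rightarrow> form) \<Rightarrow> form" (binder "\<^bold>\<forall>" 10) where
  "f_all F = (\<lambda>d. All (F (var d) (Suc d)))"

definition f_ex :: "(trm \<Rightarrow> form) \<Rightarrow> form" (binder "\<^bold>\<exists>" 10) where
  "f_ex F = (\<lambda>d. Ex (F (var d) (Suc d)))"

definition f_ball :: "trm \<Rightarrow> (trm \<Rightarrow> form) \<Rightarrow> form" where
  "f_ball a F = (\<^bold>\<forall>x. x \<^bold>\<in> a \<^bold>\<longrightarrow> F x)"

definition f_bex :: "trm \<Rightarrow> (trm \<Rightarrow> form) \<Rightarrow> form" where
  "f_bex a F = (\<^bold>\<exists>x. x \<^bold>\<in> a \<^bold>\<and> F x)"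

syntax
  "_f_ball" :: "pttrn \<Rightarrow> trm \<Rightarrow> form \<Rightarrow> form" ("(3\<^bold>\<forall>_\<^bold>\<in>_./ _)" [0, 51, 10] 10)
  "_f_bex" :: "pttrn \<Rightarrow> trm \<Rightarrow> form \<Rightarrow> form" ("(3\<^bold>\<exists>_\<^bold>\<in>_./ _)" [0, 51, 10] 10)
translations
  "\<^bold>\<forall>x\<^bold>\<in>a. A" \<rightleftharpoons> "CONST f_ball a (\<lambda>x. A)"
  "\<^bold>\<exists>x\<^bold>\<in>a. A" \<rightleftharpoons> "CONST f_bex a (\<lambda>x. A)"

definition desc :: "(trm \<Rightarrow> form) \<Rightarrow> trm" where
  "desc P = (\<lambda>K d. Ex ((P (var d) \<^bold>\<and> K d) (Suc d)))"

definition closed :: "form \<Rightarrow> fm" where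
  "closed A = A 0"

text \<open>Evaluating an argument once, before it is used in a term or a formula.\<close>

definition eval_in :: "trm \<Rightarrow> (trm \<Rightarrow> trm) \<Rightarrow> trm" where
  "eval_in t F = (\<lambda>K. t (\<lambda>l. F (var l) K))"

definition f_eval_in :: "trm \<Rightarrow> (trm \<Rightarrow> form) \<Rightarrow> form" where
  "f_eval_in t F = t (\<lambda>l. F (var l))"

text \<open>
  In a schema, \<open>A\<lbrakk>[t\<^sub>0, \<dots>, t\<^sub>m]\<rbrakk>\<close> substitutes \<open>t\<^sub>i\<close> for index \<open>i \<le> m\<close> of \<open>A\<close>; the higher indices of \<open>A\<close> are
  parameters, left free in the axiom.
\<close>

primrec eval_list :: "trm list \<Rightarrow> (nat list \<Rightarrow> form) \<Rightarrow> form" where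
  "eval_list [] K = K []"
| "eval_list (t # ts) K = t (\<lambda>x. eval_list ts (\<lambda>xs. K (x # xs)))"

definition plug :: "fm \<Rightarrow> trm list \<Rightarrow> form" ("_\<lbrakk>_\<rbrakk>" [100, 0] 100) where
  "A\<lbrakk>ts\<rbrakk> = eval_list ts (\<lambda>xs d.
     ren (\<lambda>i. if i < length xs then d - Suc (xs ! i) else d + (i - length xs)) A)"

section \<open>Basic notions of set theory\<close>

definition emp :: trm where
  "emp = desc (\<lambda>e. \<^bold>\<forall>x. \<^bold>\<not> x \<^bold>\<in> e)"

definition succ :: "trm \<Rightarrow> trm" where
  "succ t = eval_in t (\<lambda>x. desc (\<lambda>s. \<^bold>\<forall>z. z \<^bold>\<in> s \<^bold>\<longleftrightarrow> z \<^bold>\<in> x \<^bold>\<or> z \<^bold>= x))"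

definition successor_closed :: "trm \<Rightarrow> form" where
  "successor_closed b = (emp \<^bold>\<in> b \<^bold>\<and> (\<^bold>\<forall>x\<^bold>\<in>b. succ x \<^bold>\<in> b))"

definition is_omega :: "trm \<Rightarrow> form" where
  "is_omega w = (successor_closed w \<^bold>\<and> (\<^bold>\<forall>b. successor_closed b \<^bold>\<longrightarrow> (\<^bold>\<forall>x\<^bold>\<in>w. x \<^bold>\<in> b)))"

text \<open>The natural numbers are the von Neumann numerals; \<open>n = {0, \<dots>, n - 1}\<close>.\<close>

definition omega :: trm where
  "omega = desc is_omega"

definition upair :: "trm \<Rightarrow> trm \<Rightarrow> trm" where
  "upair s t = eval_in s (\<lambda>x. eval_in t (\<lambda>y.
     desc (\<lambda>p. \<^bold>\<forall>z. z \<^bold>\<in> p \<^bold>\<longleftrightarrow> z \<^bold>= x \<^bold>\<or> z \<^bold>= y)))"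

definition pair :: "trm \<Rightarrow> trm \<Rightarrow> trm" where
  "pair s t = eval_in s (\<lambda>x. eval_in t (\<lambda>y. upair (upair x x) (upair x y)))"

definition times :: "trm \<Rightarrow> trm \<Rightarrow> trm" where
  "times s t = eval_in s (\<lambda>a. eval_in t (\<lambda>b.
     desc (\<lambda>c. \<^bold>\<forall>p. p \<^bold>\<in> c \<^bold>\<longleftrightarrow> (\<^bold>\<exists>x\<^bold>\<in>a. \<^bold>\<exists>y\<^bold>\<in>b. p \<^bold>= pair x y))))"

definition is_fun :: "trm \<Rightarrow> trm \<Rightarrow> trm \<Rightarrow> form" where
  "is_fun f s t = f_eval_in s (\<lambda>a. f_eval_in t (\<lambda>b.
      (\<^bold>\<forall>p\<^bold>\<in>f. \<^bold>\<exists>x\<^bold>\<in>a. \<^bold>\<exists>y\<^bold>\<in>b. p \<^bold>= pair x y) \<^bold>\<and>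
      (\<^bold>\<forall>x\<^bold>\<in>a. \<^bold>\<exists>y. pair x y \<^bold>\<in> f \<^bold>\<and> (\<^bold>\<forall>z. pair x z \<^bold>\<in> f \<^bold>\<longrightarrow> z \<^bold>= y))))"

definition app :: "trm \<Rightarrow> trm \<Rightarrow> trm" where
  "app f t = eval_in t (\<lambda>x. desc (\<lambda>y. pair x y \<^bold>\<in> f))"

definition finitely_enumerable :: "trm \<Rightarrow> form" where
  "finitely_enumerable a =
     (\<^bold>\<exists>n\<^bold>\<in>omega. \<^bold>\<exists>f. is_fun f n a \<^bold>\<and> (\<^bold>\<forall>y\<^bold>\<in>a. \<^bold>\<exists>k\<^bold>\<in>n. app f k \<^bold>= y))"

text \<open>
  \<open>t 0 + \<dots> + t (n - 1)\<close> in the set \<open>c\<close> with addition \<open>add\<close> and zero \<open>o\<close>: the last value of the function of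
  partial sums on \<open>{0, \<dots>, n}\<close>.
\<close>

definition fsum :: "trm \<Rightarrow> trm \<Rightarrow> trm \<Rightarrow> trm \<Rightarrow> (trm \<Rightarrow> trm) \<Rightarrow> trm" where
  "fsum c add z n t = desc (\<lambda>s. \<^bold>\<exists>g. is_fun g (succ n) c \<^bold>\<and> app g emp \<^bold>= z \<^bold>\<and>
     (\<^bold>\<forall>k\<^bold>\<in>n. app g (succ k) \<^bold>= app add (pair (app g k) (t k))) \<^bold>\<and> app g n \<^bold>= s)"

section \<open>The axioms of CZF and dependent choice\<close>

text \<open>In the bounded quantifiers the bounding variable lies outside the scope of the quantifier.\<close>

inductive bounded_fm :: "fm \<Rightarrow> bool" where
  "bounded_fm (Mem x y)"
| "bounded_fm (Eq x y)"
| "bounded_fm Bot"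
| "bounded_fm A \<Longrightarrow> bounded_fm B \<Longrightarrow> bounded_fm (And A B)"
| "bounded_fm A \<Longrightarrow> bounded_fm B \<Longrightarrow> bounded_fm (Or A B)"
| "bounded_fm A \<Longrightarrow> bounded_fm B \<Longrightarrow> bounded_fm (Imp A B)"
| "bounded_fm A \<Longrightarrow> bounded_fm (All (Imp (Mem 0 (Suc y)) A))"
| "bounded_fm A \<Longrightarrow> bounded_fm (Ex (And (Mem 0 (Suc y)) A))"

definition ax_extensionality :: fm where
  "ax_extensionality = closed (\<^bold>\<forall>a b. (\<^bold>\<forall>x. x \<^bold>\<in> a \<^bold>\<longleftrightarrow> x \<^bold>\<in> b) \<^bold>\<longrightarrow> a \<^bold>= b)"

definition ax_pairing :: fm where
  "ax_pairing = closed (\<^bold>\<forall>a b. \<^bold>\<exists>c. \<^bold>\<forall>x. x \<^bold>\<in> c \<^bold>\<longleftrightarrow> x \<^bold>= a \<^bold>\<or> x \<^bold>= b)"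

definition ax_union :: fm where
  "ax_union = closed (\<^bold>\<forall>a. \<^bold>\<exists>b. \<^bold>\<forall>x. x \<^bold>\<in> b \<^bold>\<longleftrightarrow> (\<^bold>\<exists>y\<^bold>\<in>a. x \<^bold>\<in> y))"

definition ax_infinity :: fm where
  "ax_infinity = closed (\<^bold>\<exists>w. is_omega w)"

definition ax_set_induction :: "fm \<Rightarrow> fm" where
  "ax_set_induction A = closed ((\<^bold>\<forall>a. (\<^bold>\<forall>x\<^bold>\<in>a. A\<lbrakk>[x]\<rbrakk>) \<^bold>\<longrightarrow> A\<lbrakk>[a]\<rbrakk>) \<^bold>\<longrightarrow> (\<^bold>\<forall>a. A\<lbrakk>[a]\<rbrakk>))"

definition ax_separation :: "fm \<Rightarrow> fm" where
  "ax_separation A = closed (\<^bold>\<forall>a. \<^bold>\<exists>b. \<^bold>\<forall>x. x \<^bold>\<in> b \<^bold>\<longleftrightarrow> x \<^bold>\<in> a \<^bold>\<and> A\<lbrakk>[x]\<rbrakk>)"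

definition ax_strong_collection :: "fm \<Rightarrow> fm" where
  "ax_strong_collection A = closed (\<^bold>\<forall>a. (\<^bold>\<forall>x\<^bold>\<in>a. \<^bold>\<exists>y. A\<lbrakk>[x, y]\<rbrakk>) \<^bold>\<longrightarrow>
     (\<^bold>\<exists>b. (\<^bold>\<forall>x\<^bold>\<in>a. \<^bold>\<exists>y\<^bold>\<in>b. A\<lbrakk>[x, y]\<rbrakk>) \<^bold>\<and> (\<^bold>\<forall>y\<^bold>\<in>b. \<^bold>\<exists>x\<^bold>\<in>a. A\<lbrakk>[x, y]\<rbrakk>)))"

definition ax_subset_collection :: "fm \<Rightarrow> fm" where
  "ax_subset_collection A = closed (\<^bold>\<forall>a b. \<^bold>\<exists>c. \<^bold>\<forall>u. (\<^bold>\<forall>x\<^bold>\<in>a. \<^bold>\<exists>y\<^bold>\<in>b. A\<lbrakk>[x, y, u]\<rbrakk>) \<^bold>\<longrightarrow>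
     (\<^bold>\<exists>d\<^bold>\<in>c. (\<^bold>\<forall>x\<^bold>\<in>a. \<^bold>\<exists>y\<^bold>\<in>d. A\<lbrakk>[x, y, u]\<rbrakk>) \<^bold>\<and> (\<^bold>\<forall>y\<^bold>\<in>d. \<^bold>\<exists>x\<^bold>\<in>a. A\<lbrakk>[x, y, u]\<rbrakk>)))"

definition ax_dependent_choice :: "fm \<Rightarrow> fm" where
  "ax_dependent_choice A = closed (\<^bold>\<forall>a. \<^bold>\<forall>x0\<^bold>\<in>a. (\<^bold>\<forall>x\<^bold>\<in>a. \<^bold>\<exists>y\<^bold>\<in>a. A\<lbrakk>[x, y]\<rbrakk>) \<^bold>\<longrightarrow>
     (\<^bold>\<exists>f. is_fun f omega a \<^bold>\<and> app f emp \<^bold>= x0 \<^bold>\<and>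
        (\<^bold>\<forall>n\<^bold>\<in>omega. A\<lbrakk>[app f n, app f (succ n)]\<rbrakk>)))"

definition CZF :: "fm set" where
  "CZF = {ax_extensionality, ax_pairing, ax_union, ax_infinity} \<union>
     range ax_set_induction \<union> ax_separation ` Collect bounded_fm \<union>
     range ax_strong_collection \<union> range ax_subset_collection"

definition DC :: "fm set" where
  "DC = range ax_dependent_choice"

definition BISH_proves :: "form \<Rightarrow> bool" ("BISH \<turnstile> _" [10] 10) where
  "(BISH \<turnstile> A) \<longleftrightarrow> deriv (CZF \<union> DC) {} (closed A)"

section \<open>The real numbers\<close>

text \<open>
  The real line is taken to be any structure satisfying Bridges' axioms for the constructive reals
  (Heyting field, order, Archimedes, constructive least-upper-bound principle). In CZF + DC such a
  structure exists and is unique up to isomorphism.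
\<close>

datatype reals =
  Reals (rset: trm) (radd_op: trm) (rmul_op: trm) (rless_rel: trm) (rzero: trm) (rone: trm)

definition radd :: "trm \<Rightarrow> reals \<Rightarrow> trm \<Rightarrow> trm" ("(_ +\<^bsub>_\<^esub> _)" [65, 0, 66] 65) where
  "x +\<^bsub>F\<^esub> y = app (radd_op F) (pair x y)"

definition rmul :: "trm \<Rightarrow> reals \<Rightarrow> trm \<Rightarrow> trm" ("(_ *\<^bsub>_\<^esub> _)" [70, 0, 71] 70) where
  "x *\<^bsub>F\<^esub> y = app (rmul_op F) (pair x y)"

definition rless :: "trm \<Rightarrow> reals \<Rightarrow> trm \<Rightarrow> form" ("(_ <\<^bsub>_\<^esub> _)" [51, 0, 51] 50) where
  "(x <\<^bsub>F\<^esub> y) = (pair x y \<^bold>\<in> rless_rel F)"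

definition rle :: "trm \<Rightarrow> reals \<Rightarrow> trm \<Rightarrow> form" ("(_ \<le>\<^bsub>_\<^esub> _)" [51, 0, 51] 50) where
  "(x \<le>\<^bsub>F\<^esub> y) = (\<^bold>\<not> y <\<^bsub>F\<^esub> x)"

definition rapart :: "trm \<Rightarrow> reals \<Rightarrow> trm \<Rightarrow> form" ("(_ \<noteq>\<^bsub>_\<^esub> _)" [51, 0, 51] 50) where
  "(x \<noteq>\<^bsub>F\<^esub> y) = (x <\<^bsub>F\<^esub> y \<^bold>\<or> y <\<^bsub>F\<^esub> x)"

definition rneg :: "reals \<Rightarrow> trm \<Rightarrow> trm" where
  "rneg F t = eval_in t (\<lambda>x. desc (\<lambda>y. y \<^bold>\<in> rset F \<^bold>\<and> x +\<^bsub>F\<^esub> y \<^bold>= rzero F))"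

definition rabs :: "reals \<Rightarrow> trm \<Rightarrow> trm" where
  "rabs F t = eval_in t (\<lambda>x. eval_in (rneg F x) (\<lambda>y.
     desc (\<lambda>m. m \<^bold>\<in> rset F \<^bold>\<and> x \<le>\<^bsub>F\<^esub> m \<^bold>\<and> y \<le>\<^bsub>F\<^esub> m \<^bold>\<and>
       (\<^bold>\<forall>b\<^bold>\<in>rset F. x \<le>\<^bsub>F\<^esub> b \<^bold>\<and> y \<le>\<^bsub>F\<^esub> b \<^bold>\<longrightarrow> m \<le>\<^bsub>F\<^esub> b))))"

definition rsum :: "reals \<Rightarrow> trm \<Rightarrow> (trm \<Rightarrow> trm) \<Rightarrow> trm" where
  "rsum F n t = fsum (rset F) (radd_op F) (rzero F) n t"

definition heyting_field :: "reals \<Rightarrow> form" where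
  "heyting_field F =
     (is_fun (radd_op F) (times (rset F) (rset F)) (rset F) \<^bold>\<and>
      is_fun (rmul_op F) (times (rset F) (rset F)) (rset F) \<^bold>\<and>
      rzero F \<^bold>\<in> rset F \<^bold>\<and> rone F \<^bold>\<in> rset F \<^bold>\<and>
      (\<^bold>\<forall>x\<^bold>\<in>rset F. \<^bold>\<forall>y\<^bold>\<in>rset F. \<^bold>\<forall>z\<^bold>\<in>rset F.
         x +\<^bsub>F\<^esub> y \<^bold>= y +\<^bsub>F\<^esub> x \<^bold>\<and>
         (x +\<^bsub>F\<^esub> y) +\<^bsub>F\<^esub> z \<^bold>= x +\<^bsub>F\<^esub> (y +\<^bsub>F\<^esub> z) \<^bold>\<and>
         x *\<^bsub>F\<^esub> y \<^bold>= y *\<^bsub>F\<^esub> x \<^bold>\<and>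
         (x *\<^bsub>F\<^esub> y) *\<^bsub>F\<^esub> z \<^bold>= x *\<^bsub>F\<^esub> (y *\<^bsub>F\<^esub> z) \<^bold>\<and>
         x *\<^bsub>F\<^esub> (y +\<^bsub>F\<^esub> z) \<^bold>= (x *\<^bsub>F\<^esub> y) +\<^bsub>F\<^esub> (x *\<^bsub>F\<^esub> z)) \<^bold>\<and>
      (\<^bold>\<forall>x\<^bold>\<in>rset F. x +\<^bsub>F\<^esub> rzero F \<^bold>= x) \<^bold>\<and>
      (\<^bold>\<forall>x\<^bold>\<in>rset F. x *\<^bsub>F\<^esub> rone F \<^bold>= x) \<^bold>\<and>
      (\<^bold>\<forall>x\<^bold>\<in>rset F. \<^bold>\<exists>y\<^bold>\<in>rset F. x +\<^bsub>F\<^esub> y \<^bold>= rzero F) \<^bold>\<and>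
      rzero F \<noteq>\<^bsub>F\<^esub> rone F \<^bold>\<and>
      (\<^bold>\<forall>x\<^bold>\<in>rset F. x \<noteq>\<^bsub>F\<^esub> rzero F \<^bold>\<longrightarrow> (\<^bold>\<exists>y\<^bold>\<in>rset F. x *\<^bsub>F\<^esub> y \<^bold>= rone F)))"

definition order_axioms :: "reals \<Rightarrow> form" where
  "order_axioms F =
     (\<^bold>\<forall>x\<^bold>\<in>rset F. \<^bold>\<forall>y\<^bold>\<in>rset F.
         \<^bold>\<not> (x <\<^bsub>F\<^esub> y \<^bold>\<and> y <\<^bsub>F\<^esub> x) \<^bold>\<and>
         (x <\<^bsub>F\<^esub> y \<^bold>\<longrightarrow> (\<^bold>\<forall>z\<^bold>\<in>rset F. x <\<^bsub>F\<^esub> z \<^bold>\<or> z <\<^bsub>F\<^esub> y)) \<^bold>\<and>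
         (\<^bold>\<not> x \<noteq>\<^bsub>F\<^esub> y \<^bold>\<longrightarrow> x \<^bold>= y) \<^bold>\<and>
         (x <\<^bsub>F\<^esub> y \<^bold>\<longrightarrow> (\<^bold>\<forall>z\<^bold>\<in>rset F. x +\<^bsub>F\<^esub> z <\<^bsub>F\<^esub> y +\<^bsub>F\<^esub> z)) \<^bold>\<and>
         (rzero F <\<^bsub>F\<^esub> x \<^bold>\<and> rzero F <\<^bsub>F\<^esub> y \<^bold>\<longrightarrow> rzero F <\<^bsub>F\<^esub> x *\<^bsub>F\<^esub> y))"

definition archimedean :: "reals \<Rightarrow> form" where
  "archimedean F = (\<^bold>\<forall>x\<^bold>\<in>rset F. \<^bold>\<exists>n\<^bold>\<in>omega. x <\<^bsub>F\<^esub> rsum F n (\<lambda>k. rone F))"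

definition least_upper_bound_principle :: "reals \<Rightarrow> form" where
  "least_upper_bound_principle F =
     (\<^bold>\<forall>S. (\<^bold>\<forall>s\<^bold>\<in>S. s \<^bold>\<in> rset F) \<^bold>\<and> (\<^bold>\<exists>s. s \<^bold>\<in> S) \<^bold>\<and>
        (\<^bold>\<exists>b\<^bold>\<in>rset F. \<^bold>\<forall>s\<^bold>\<in>S. s \<le>\<^bsub>F\<^esub> b) \<^bold>\<and>
        (\<^bold>\<forall>x\<^bold>\<in>rset F. \<^bold>\<forall>y\<^bold>\<in>rset F. x <\<^bsub>F\<^esub> y \<^bold>\<longrightarrow>
           (\<^bold>\<forall>s\<^bold>\<in>S. s \<le>\<^bsub>F\<^esub> y) \<^bold>\<or> (\<^bold>\<exists>s\<^bold>\<in>S. x <\<^bsub>F\<^esub> s)) \<^bold>\<longrightarrow>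
        (\<^bold>\<exists>b\<^bold>\<in>rset F. (\<^bold>\<forall>s\<^bold>\<in>S. s \<le>\<^bsub>F\<^esub> b) \<^bold>\<and>
           (\<^bold>\<forall>x\<^bold>\<in>rset F. x <\<^bsub>F\<^esub> b \<^bold>\<longrightarrow> (\<^bold>\<exists>s\<^bold>\<in>S. x <\<^bsub>F\<^esub> s))))"

definition real_numbers :: "reals \<Rightarrow> form" where
  "real_numbers F = (heyting_field F \<^bold>\<and> order_axioms F \<^bold>\<and> archimedean F \<^bold>\<and>
     least_upper_bound_principle F)"

section \<open>q-normed spaces\<close>

text \<open>The last two components are the index set \<open>I\<close> and the q-norm as a function on \<open>I \<times> X\<close>.\<close>

datatype qspace =
  QSpace (vset: trm) (vadd_op: trm) (vzero: trm) (smul_op: trm) (vindex: trm) (vnorm_op: trm)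

definition vadd :: "trm \<Rightarrow> qspace \<Rightarrow> trm \<Rightarrow> trm" ("(_ \<oplus>\<^bsub>_\<^esub> _)" [65, 0, 66] 65) where
  "x \<oplus>\<^bsub>V\<^esub> y = app (vadd_op V) (pair x y)"

definition smul :: "trm \<Rightarrow> qspace \<Rightarrow> trm \<Rightarrow> trm" ("(_ \<odot>\<^bsub>_\<^esub> _)" [71, 0, 70] 70) where
  "c \<odot>\<^bsub>V\<^esub> x = app (smul_op V) (pair c x)"

definition vminus :: "trm \<Rightarrow> qspace \<Rightarrow> trm \<Rightarrow> trm" ("(_ \<ominus>\<^bsub>_\<^esub> _)" [65, 0, 66] 65) where
  "s \<ominus>\<^bsub>V\<^esub> t = eval_in s (\<lambda>x. eval_in t (\<lambda>y.
     desc (\<lambda>z. z \<^bold>\<in> vset V \<^bold>\<and> z \<oplus>\<^bsub>V\<^esub> y \<^bold>= x)))"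

definition vnorm :: "qspace \<Rightarrow> trm \<Rightarrow> trm \<Rightarrow> trm" where
  "vnorm V i x = app (vnorm_op V) (pair i x)"

definition vsum :: "qspace \<Rightarrow> trm \<Rightarrow> (trm \<Rightarrow> trm) \<Rightarrow> trm" where
  "vsum V n t = fsum (vset V) (vadd_op V) (vzero V) n t"

definition linear_space :: "reals \<Rightarrow> qspace \<Rightarrow> form" where
  "linear_space F V =
     (is_fun (vadd_op V) (times (vset V) (vset V)) (vset V) \<^bold>\<and>
      is_fun (smul_op V) (times (rset F) (vset V)) (vset V) \<^bold>\<and>
      vzero V \<^bold>\<in> vset V \<^bold>\<and>
      (\<^bold>\<forall>x\<^bold>\<in>vset V. \<^bold>\<forall>y\<^bold>\<in>vset V. \<^bold>\<forall>z\<^bold>\<in>vset V.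
         x \<oplus>\<^bsub>V\<^esub> y \<^bold>= y \<oplus>\<^bsub>V\<^esub> x \<^bold>\<and> (x \<oplus>\<^bsub>V\<^esub> y) \<oplus>\<^bsub>V\<^esub> z \<^bold>= x \<oplus>\<^bsub>V\<^esub> (y \<oplus>\<^bsub>V\<^esub> z)) \<^bold>\<and>
      (\<^bold>\<forall>x\<^bold>\<in>vset V. x \<oplus>\<^bsub>V\<^esub> vzero V \<^bold>= x) \<^bold>\<and>
      (\<^bold>\<forall>x\<^bold>\<in>vset V. \<^bold>\<exists>y\<^bold>\<in>vset V. x \<oplus>\<^bsub>V\<^esub> y \<^bold>= vzero V) \<^bold>\<and>
      (\<^bold>\<forall>a\<^bold>\<in>rset F. \<^bold>\<forall>b\<^bold>\<in>rset F. \<^bold>\<forall>x\<^bold>\<in>vset V. \<^bold>\<forall>y\<^bold>\<in>vset V.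
         a \<odot>\<^bsub>V\<^esub> (x \<oplus>\<^bsub>V\<^esub> y) \<^bold>= (a \<odot>\<^bsub>V\<^esub> x) \<oplus>\<^bsub>V\<^esub> (a \<odot>\<^bsub>V\<^esub> y) \<^bold>\<and>
         (a +\<^bsub>F\<^esub> b) \<odot>\<^bsub>V\<^esub> x \<^bold>= (a \<odot>\<^bsub>V\<^esub> x) \<oplus>\<^bsub>V\<^esub> (b \<odot>\<^bsub>V\<^esub> x) \<^bold>\<and>
         (a *\<^bsub>F\<^esub> b) \<odot>\<^bsub>V\<^esub> x \<^bold>= a \<odot>\<^bsub>V\<^esub> (b \<odot>\<^bsub>V\<^esub> x)) \<^bold>\<and>
      (\<^bold>\<forall>x\<^bold>\<in>vset V. rone F \<odot>\<^bsub>V\<^esub> x \<^bold>= x))"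

definition seminorm :: "reals \<Rightarrow> qspace \<Rightarrow> trm \<Rightarrow> form" where
  "seminorm F V i =
     ((\<^bold>\<forall>x\<^bold>\<in>vset V. rzero F \<le>\<^bsub>F\<^esub> vnorm V i x) \<^bold>\<and>
      (\<^bold>\<forall>a\<^bold>\<in>rset F. \<^bold>\<forall>x\<^bold>\<in>vset V. vnorm V i (a \<odot>\<^bsub>V\<^esub> x) \<^bold>= rabs F a *\<^bsub>F\<^esub> vnorm V i x) \<^bold>\<and>
      (\<^bold>\<forall>x\<^bold>\<in>vset V. \<^bold>\<forall>y\<^bold>\<in>vset V. vnorm V i (x \<oplus>\<^bsub>V\<^esub> y) \<le>\<^bsub>F\<^esub> vnorm V i x +\<^bsub>F\<^esub> vnorm V i y))"

text \<open>
  The last conjunct says that the equality of the space, here equality of sets, is the equality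
  given by the q-norm.
\<close>

definition q_normed_space :: "reals \<Rightarrow> qspace \<Rightarrow> form" where
  "q_normed_space F V =
     (linear_space F V \<^bold>\<and>
      is_fun (vnorm_op V) (times (vindex V) (vset V)) (rset F) \<^bold>\<and>
      (\<^bold>\<forall>i\<^bold>\<in>vindex V. seminorm F V i) \<^bold>\<and>
      (\<^bold>\<forall>x\<^bold>\<in>vset V. \<^bold>\<exists>M\<^bold>\<in>rset F. \<^bold>\<forall>i\<^bold>\<in>vindex V. rabs F (vnorm V i x) \<le>\<^bsub>F\<^esub> M) \<^bold>\<and>
      (\<^bold>\<forall>x\<^bold>\<in>vset V. \<^bold>\<forall>y\<^bold>\<in>vset V.
         x \<^bold>= y \<^bold>\<longleftrightarrow> (\<^bold>\<forall>i\<^bold>\<in>vindex V. vnorm V i (x \<ominus>\<^bsub>V\<^esub> y) \<^bold>= rzero F)))"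

definition vapart :: "reals \<Rightarrow> qspace \<Rightarrow> trm \<Rightarrow> trm \<Rightarrow> form" where
  "vapart F V x y = (\<^bold>\<exists>i\<^bold>\<in>vindex V. rzero F <\<^bsub>F\<^esub> vnorm V i (x \<ominus>\<^bsub>V\<^esub> y))"

text \<open>Subsets of the space are given by their membership predicate.\<close>

definition unit_ball :: "reals \<Rightarrow> qspace \<Rightarrow> trm \<Rightarrow> form" where
  "unit_ball F V x = (x \<^bold>\<in> vset V \<^bold>\<and> (\<^bold>\<forall>i\<^bold>\<in>vindex V. vnorm V i x \<le>\<^bsub>F\<^esub> rone F))"

definition approximation :: "reals \<Rightarrow> qspace \<Rightarrow> trm \<Rightarrow> trm \<Rightarrow> (trm \<Rightarrow> form) \<Rightarrow> form" where
  "approximation F V e A S =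
     ((\<^bold>\<forall>x\<^bold>\<in>A. S x) \<^bold>\<and>
      (\<^bold>\<forall>x. S x \<^bold>\<longrightarrow> (\<^bold>\<exists>x'\<^bold>\<in>A. \<^bold>\<forall>i\<^bold>\<in>vindex V. vnorm V i (x \<ominus>\<^bsub>V\<^esub> x') <\<^bsub>F\<^esub> e)))"

definition totally_bounded :: "reals \<Rightarrow> qspace \<Rightarrow> (trm \<Rightarrow> form) \<Rightarrow> form" where
  "totally_bounded F V S =
     (\<^bold>\<forall>e\<^bold>\<in>rset F. rzero F <\<^bsub>F\<^esub> e \<^bold>\<longrightarrow>
        (\<^bold>\<exists>A. finitely_enumerable A \<^bold>\<and> approximation F V e A S))"

definition is_basis :: "reals \<Rightarrow> qspace \<Rightarrow> trm \<Rightarrow> trm \<Rightarrow> form" where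
  "is_basis F V n b =
     (is_fun b n (vset V) \<^bold>\<and>
      (\<^bold>\<forall>x\<^bold>\<in>vset V. \<^bold>\<exists>l. is_fun l n (rset F) \<^bold>\<and>
         x \<^bold>= vsum V n (\<lambda>k. app l k \<odot>\<^bsub>V\<^esub> app b k)) \<^bold>\<and>
      (\<^bold>\<forall>l. is_fun l n (rset F) \<^bold>\<longrightarrow>
         rzero F <\<^bsub>F\<^esub> rsum F n (\<lambda>k. rabs F (app l k)) \<^bold>\<longrightarrow>
         vapart F V (vsum V n (\<lambda>k. app l k \<odot>\<^bsub>V\<^esub> app b k)) (vzero V)))"

definition finite_dimensional :: "reals \<Rightarrow> qspace \<Rightarrow> form" where
  "finite_dimensional F V = (\<^bold>\<exists>n\<^bold>\<in>omega. \<^bold>\<exists>b. is_basis F V n b)"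

section \<open>WLPO\<close>

definition binary_sequence :: "trm \<Rightarrow> form" where
  "binary_sequence a = is_fun a omega (succ (succ emp))"

definition WLPO :: form where
  "WLPO = (\<^bold>\<forall>a. binary_sequence a \<^bold>\<longrightarrow>
     (\<^bold>\<forall>n\<^bold>\<in>omega. app a n \<^bold>= emp) \<^bold>\<or> \<^bold>\<not> (\<^bold>\<forall>n\<^bold>\<in>omega. app a n \<^bold>= emp))"

end

theory Submission
  imports Defs "HOL-Library.Countable"
begin

text \<open>
  Given a binary sequence \<open>a\<close>, norm the real line by \<open>\<bar>x\<bar>\<close> and, if some \<open>a n = 1\<close>, also by \<open>\<bar>3 x\<bar>\<close>. Both
  seminorms are bounded at each point, but it is not decided whether the unit ball is \<open>[-1, 1]\<close> or
  \<open>[-1/3, 1/3]\<close>. Take a \<open>1/3\<close>-approximation \<open>{x\<^sub>1, \<dots>, x\<^sub>N}\<close> to it. Either \<open>1 < \<bar>3 x\<^sub>k\<bar>\<close> for some \<open>k\<close>, and then no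
  \<open>a n\<close> is \<open>1\<close>; or \<open>\<bar>3 x\<^sub>k\<bar> < 2\<close> for all \<open>k\<close>, and then \<open>1\<close> is not in the ball, since otherwise
  \<open>3 \<le> \<bar>3 x\<^sub>k\<bar> + 3 \<bar>1 - x\<^sub>k\<bar> < 2 + 1\<close> for some \<open>k\<close>, so that not all \<open>a n\<close> are \<open>0\<close>.

  To derive this in CZF + DC, the deduction system is shown to be complete for Kripke models, and the
  argument is carried out in an arbitrary Kripke model of CZF + DC. There \<open>\<and>\<close>, \<open>\<or>\<close> and \<open>\<exists>\<close> have their
  ordinary meaning at each world, and only \<open>\<longrightarrow>\<close> and \<open>\<forall>\<close> refer to later worlds.
\<close>

section \<open>Kripke completeness of the deduction system\<close>

subsection \<open>Renaming\<close>

text \<open>HOL is classical, so reasoning in it does not by itself respect the absence of excluded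
  middle; forcing keeps the levels apart. Excluded middle may be used about what is forced, but a
  disjunction is proved only when one side is forced at the world in question. This shapes three
  places. The number of points of an approximation is an element of the model's
  \<open>omega\<close>, possibly nonstandard, so the choice between the two cases is made by
  induction inside the model. Signs of reals are undecided, so absolute values are suprema of
  \<open>x\<close> and \<open>-x\<close> taken from the least-upper-bound principle, and their
  multiplicativity rests on stability of equality. Separation is limited to bounded formulas, so the
  index set is cut out by an atomic condition, membership of 1 in the range of the sequence, and
  functions are produced by strong collection. The factor 3 splits as 2 + 1: since 1 < 2,
  cotransitivity decides between the thresholds 1 and 2 for each point, and the remaining 1 is three
  times the tolerance. What makes the space admissible is that a q-norm has to be bounded at each
  point, but its supremum need not exist.\<close>

primrec fv :: "fm \<Rightarrow> nat set" where
  "fv (Mem x y) = {x, y}"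
| "fv (Eq x y) = {x, y}"
| "fv Bot = {}"
| "fv (And A B) = fv A \<union> fv B"
| "fv (Or A B) = fv A \<union> fv B"
| "fv (Imp A B) = fv A \<union> fv B"
| "fv (All A) = {i. Suc i \<in> fv A}"
| "fv (Ex A) = {i. Suc i \<in> fv A}"

text \<open>Countability lets the saturation below treat all formulas one after another through
  \<open>from_nat\<close>.\<close>

instance fm :: countable
  by countable_datatype

lemma finite_fv [simp]: "finite (fv A)"
  by (induction A) (simp_all add: finite_vimageI[of _ Suc, unfolded vimage_def])

lemma ren_cong: "(\<And>i. i \<in> fv A \<Longrightarrow> r i = s i) \<Longrightarrow> ren r A = ren s A"
proof (induction A arbitrary: r s)
  case (All A)
  have "ren (case_nat 0 (\<lambda>i. Suc (r i))) A = ren (case_nat 0 (\<lambda>i. Suc (s i))) A"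
    using All.prems by (intro All.IH) (auto split: nat.split)
  then show ?case by simp
next
  case (Ex A)
  have "ren (case_nat 0 (\<lambda>i. Suc (r i))) A = ren (case_nat 0 (\<lambda>i. Suc (s i))) A"
    using Ex.prems by (intro Ex.IH) (auto split: nat.split)
  then show ?case by simp
next
  case (And A B)
  show ?case using And.IH[of r s] And.prems by simp
next
  case (Or A B)
  show ?case using Or.IH[of r s] Or.prems by simp
next
  case (Imp A B)
  show ?case using Imp.IH[of r s] Imp.prems by simp
qed simp_all

lemma lift_image: "{i. Suc i \<in> case_nat 0 (\<lambda>i. Suc (r i)) ` S} = r ` {i. Suc i \<in> S}"
proof (intro set_eqI iffI)
  fix j assume "j \<in> {i. Suc i \<in> case_nat 0 (\<lambda>i. Suc (r i)) ` S}"
  then obtain k where "k \<in> S" "Suc j = case_nat 0 (\<lambda>i. Suc (r i)) k" by auto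
  then show "j \<in> r ` {i. Suc i \<in> S}" by (cases k) auto
next
  fix j assume "j \<in> r ` {i. Suc i \<in> S}"
  then obtain k where "Suc k \<in> S" "j = r k" by auto
  then show "j \<in> {i. Suc i \<in> case_nat 0 (\<lambda>i. Suc (r i)) ` S}"
    by (auto intro!: image_eqI[of _ _ "Suc k"])
qed

lemma fv_ren: "fv (ren r A) = r ` fv A"
  by (induction A arbitrary: r) (simp_all add: lift_image image_Un)

lemma lift_comp: "case_nat 0 (\<lambda>i. Suc (r i)) (case_nat 0 (\<lambda>i. Suc (s i)) j) =
    case_nat 0 (\<lambda>i. Suc (r (s i))) j"
  by (cases j) auto

lemma ren_ren: "ren r (ren s A) = ren (\<lambda>i. r (s i)) A"
  by (induction A arbitrary: r s) (simp_all add: lift_comp)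

lemma ren_id: "ren (\<lambda>i. i) A = A"
proof -
  have [simp]: "case_nat 0 Suc = (\<lambda>i. i)"
    by (auto split: nat.split)
  show ?thesis by (induction A) simp_all
qed

lemma inst_ren: "inst t (ren (case_nat 0 (\<lambda>i. Suc (r i))) A) = ren (case_nat t r) A"
  unfolding inst_def ren_ren by (intro ren_cong) (auto split: nat.split)

lemma ren_inst: "ren r (inst t A) = inst (r t) (ren (case_nat 0 (\<lambda>i. Suc (r i))) A)"
  unfolding inst_ren unfolding inst_def ren_ren by (intro ren_cong) (auto split: nat.split)

lemma ren_shift: "ren (case_nat 0 (\<lambda>i. Suc (r i))) (shift A) = shift (ren r A)"
  unfolding ren_ren by simp

subsection \<open>Structural rules\<close>

text \<open>The premise quantifies over all contexts because \<open>AllI\<close> passes to the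
  shifted one.\<close>

lemma deriv_inst: "(\<And>G. deriv T G A) \<Longrightarrow> deriv T G (inst t A)"
  by (rule AllE) (rule AllI)

text \<open>Axioms are not shifted by the eigenvariable rules, so their free variables can be
  generalised and instantiated anew one at a time. Finitely many rounds reach any renaming, since
  only finitely many variables occur.\<close>

lemma deriv_ren_axiom:
  assumes "A \<in> T"
  shows "deriv T G (ren r A)"
proof -
  \<comment> \<open>After \<open>n\<close> rounds the indices below \<open>n\<close> are renamed and
    the others moved down by \<open>n\<close>. In the induction step \<open>r\<close> is composed
    with \<open>Suc\<close>, which leaves index 0 to the old index \<open>n\<close>, the next one to
    be replaced.\<close>
  have *: "deriv T G (ren (\<lambda>i. if i < n then r i else i - n) A)" for n G and r :: "nat \<Rightarrow> nat"
  proof (induction n arbitrary: r G)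
    case 0
    then show ?case using assms by (simp add: ren_id Axiom)
  next
    case (Suc n)
    have "deriv T G (inst (r n) (ren (\<lambda>i. if i < n then Suc (r i) else i - n) A))"
      by (rule deriv_inst) (rule Suc.IH)
    also have "inst (r n) (ren (\<lambda>i. if i < n then Suc (r i) else i - n) A) =
        ren (\<lambda>i. if i < Suc n then r i else i - Suc n) A"
      unfolding inst_def ren_ren
      by (intro ren_cong) (auto split: nat.split simp: less_Suc_eq)
    finally show ?case .
  qed
  obtain n where "\<forall>i\<in>fv A. i < n"
    using finite_fv finite_nat_set_iff_bounded by blast
  then have "ren (\<lambda>i. if i < n then r i else i - n) A = ren r A"
    by (intro ren_cong) auto
  then show ?thesis using *[of G n r] by simp
qed

text \<open>Renaming and weakening go through one induction; \<open>r\<close> need not be injective,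
  so distinct variables may be identified.\<close>

lemma deriv_ren_mono: "deriv T G A \<Longrightarrow> ren r ` G \<subseteq> H \<Longrightarrow> deriv T H (ren r A)"
proof (induction arbitrary: r H rule: deriv.induct)
  case (Axiom A G)
  show ?case using Axiom(1) by (rule deriv_ren_axiom)
next
  case (Hyp A G)
  then show ?case by (auto intro: deriv.Hyp)
next
  case (BotE G A)
  show ?case using BotE.IH[OF BotE.prems] by (simp add: deriv.BotE)
next
  case (AndI G A B)
  show ?case using AndI.IH[OF AndI.prems] by (simp add: deriv.AndI)
next
  case (AndE1 G A B)
  show ?case using AndE1.IH[OF AndE1.prems] unfolding ren.simps by (rule deriv.AndE1)
next
  case (AndE2 G A B)
  show ?case using AndE2.IH[OF AndE2.prems] unfolding ren.simps by (rule deriv.AndE2)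
next
  case (OrI1 G A B)
  show ?case using OrI1.IH[OF OrI1.prems] unfolding ren.simps by (rule deriv.OrI1)
next
  case (OrI2 G B A)
  show ?case using OrI2.IH[OF OrI2.prems] unfolding ren.simps by (rule deriv.OrI2)
next
  case (ImpE G A B)
  show ?case using ImpE.IH[OF ImpE.prems] unfolding ren.simps by (rule deriv.ImpE)
next
  case (AllE G A t)
  show ?case using AllE.IH[OF AllE.prems] unfolding ren_inst ren.simps by (rule deriv.AllE)
next
  case (ExI G t A)
  show ?case using ExI.IH[OF ExI.prems] unfolding ren_inst ren.simps by (rule deriv.ExI)
next
  case (EqE G s t A)
  show ?case using EqE.IH[OF EqE.prems] unfolding ren_inst ren.simps by (rule deriv.EqE)
next
  case (OrE G A B C)
  have "ren r ` insert A G \<subseteq> insert (ren r A) H" "ren r ` insert B G \<subseteq> insert (ren r B) H"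
    using OrE.prems by auto
  from OrE.IH(1)[OF OrE.prems] OrE.IH(2)[OF this(1)] OrE.IH(3)[OF this(2)]
  show ?case unfolding ren.simps by (rule deriv.OrE)
next
  case (ImpI A G B)
  have "ren r ` insert A G \<subseteq> insert (ren r A) H" using ImpI.prems by auto
  from ImpI.IH[OF this] show ?case unfolding ren.simps by (rule deriv.ImpI)
next
  case (AllI G A)
  have "ren (case_nat 0 (\<lambda>i. Suc (r i))) ` shift ` G \<subseteq> shift ` H"
    using AllI.prems unfolding image_image ren_shift by auto
  from AllI.IH[OF this] show ?case unfolding ren.simps by (rule deriv.AllI)
next
  case (ExE G A C)
  let ?r = "case_nat 0 (\<lambda>i. Suc (r i))"
  have "ren ?r ` insert A (shift ` G) \<subseteq> insert (ren ?r A) (shift ` H)"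
    using ExE.prems unfolding image_insert image_image ren_shift by auto
  from ExE.IH(2)[OF this] have "deriv T (insert (ren ?r A) (shift ` H)) (shift (ren r C))"
    unfolding ren_shift .
  with ExE.IH(1)[OF ExE.prems] show ?case unfolding ren.simps by (rule deriv.ExE)
next
  case (EqI G t)
  then show ?case by (simp add: deriv.EqI)
qed

lemma deriv_ren: "deriv T G A \<Longrightarrow> deriv T (ren r ` G) (ren r A)"
  by (erule deriv_ren_mono) simp

lemma deriv_mono: "deriv T G A \<Longrightarrow> G \<subseteq> G' \<Longrightarrow> deriv T G' A"
  using deriv_ren_mono[of T G A "\<lambda>i. i" G'] by (simp add: ren_id image_def)

lemma deriv_cut: "deriv T G A \<Longrightarrow> deriv T (insert A G) B \<Longrightarrow> deriv T G B"
  by (rule ImpE[OF ImpI])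

lemma deriv_finite: "deriv T G A \<Longrightarrow> \<exists>H. finite H \<and> H \<subseteq> G \<and> deriv T H A"
proof (induction rule: deriv.induct)
  case (Axiom A G)
  then show ?case by (metis deriv.Axiom empty_subsetI finite.emptyI)
next
  case (Hyp A G)
  then show ?case by (intro exI[of _ "{A}"]) (auto intro: deriv.Hyp)
next
  case (AndI G A B)
  then obtain H1 H2 where *: "finite H1" "H1 \<subseteq> G" "deriv T H1 A" "finite H2" "H2 \<subseteq> G" "deriv T H2 B"
    by blast
  have "deriv T (H1 \<union> H2) (And A B)"
    by (rule deriv.AndI; rule deriv_mono, rule *) blast+
  then show ?case using * by (meson finite_UnI Un_least)
next
  case (OrE G A B C)
  then obtain H1 H2 H3 where *: "finite H1" "H1 \<subseteq> G" "deriv T H1 (Or A B)"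
     "finite H2" "H2 \<subseteq> insert A G" "deriv T H2 C" "finite H3" "H3 \<subseteq> insert B G" "deriv T H3 C"
    by blast
  let ?H = "H1 \<union> (H2 - {A}) \<union> (H3 - {B})"
  have "deriv T ?H (Or A B)" by (rule deriv_mono[OF *(3)]) blast
  moreover have "deriv T (insert A ?H) C" by (rule deriv_mono[OF *(6)]) blast
  moreover have "deriv T (insert B ?H) C" by (rule deriv_mono[OF *(9)]) blast
  ultimately have "deriv T ?H C" by (rule deriv.OrE)
  then show ?case using * by (intro exI[of _ ?H]) auto
next
  case (ImpI A G B)
  then obtain H where *: "finite H" "H \<subseteq> insert A G" "deriv T H B"
    by blast
  have "deriv T (H - {A}) (Imp A B)"
    by (rule deriv.ImpI) (rule deriv_mono[OF *(3)], blast)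
  then show ?case using * by (intro exI[of _ "H - {A}"]) auto
next
  case (ImpE G A B)
  then obtain H1 H2 where *: "finite H1" "H1 \<subseteq> G" "deriv T H1 (Imp A B)"
      "finite H2" "H2 \<subseteq> G" "deriv T H2 A"
    by blast
  have "deriv T (H1 \<union> H2) (Imp A B)" by (rule deriv_mono[OF *(3)]) blast
  moreover have "deriv T (H1 \<union> H2) A" by (rule deriv_mono[OF *(6)]) blast
  ultimately have "deriv T (H1 \<union> H2) B" by (rule deriv.ImpE)
  then show ?case using * by (meson finite_UnI Un_least)
next
  case (AllI G A)
  then obtain H where "finite H" "H \<subseteq> shift ` G" "deriv T H A" by blast
  then obtain K where "finite K" "K \<subseteq> G" "deriv T (shift ` K) A"
    by (metis finite_subset_image)
  then show ?case by (meson deriv.AllI)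
next
  case (ExE G A C)
  then obtain H1 H2 where *: "finite H1" "H1 \<subseteq> G" "deriv T H1 (Ex A)"
      "finite H2" "H2 \<subseteq> insert A (shift ` G)" "deriv T H2 (shift C)"
    by blast
  then have "finite (H2 - {A})" "H2 - {A} \<subseteq> shift ` G" by auto
  then obtain H3 where **: "finite H3" "H3 \<subseteq> G" "H2 - {A} = shift ` H3"
    by (meson finite_subset_image)
  then have sub: "H2 \<subseteq> insert A (shift ` (H1 \<union> H3))" by auto
  have "deriv T (H1 \<union> H3) (Ex A)" by (rule deriv_mono[OF *(3)]) blast
  then have "deriv T (H1 \<union> H3) C" by (rule deriv.ExE) (rule deriv_mono[OF *(6) sub])
  then show ?case using * ** by (meson finite_UnI Un_least)
next
  case (EqE G s t A)
  then obtain H1 H2 where *: "finite H1" "H1 \<subseteq> G" "deriv T H1 (Eq s t)"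
      "finite H2" "H2 \<subseteq> G" "deriv T H2 (inst s A)"
    by blast
  have "deriv T (H1 \<union> H2) (Eq s t)" by (rule deriv_mono[OF *(3)]) blast
  moreover have "deriv T (H1 \<union> H2) (inst s A)" by (rule deriv_mono[OF *(6)]) blast
  ultimately have "deriv T (H1 \<union> H2) (inst t A)" by (rule deriv.EqE)
  then show ?case using * by (meson finite_UnI Un_least)
next
  case (BotE G A)
  then show ?case by (meson deriv.BotE)
next
  case (AndE1 G A B)
  then show ?case by (meson deriv.AndE1)
next
  case (AndE2 G A B)
  then show ?case by (meson deriv.AndE2)
next
  case (OrI1 G A B)
  then show ?case by (meson deriv.OrI1)
next
  case (OrI2 G B A)
  then show ?case by (meson deriv.OrI2)
next
  case (AllE G A t)
  then show ?case by (meson deriv.AllE)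
next
  case (ExI G t A)
  then show ?case by (meson deriv.ExI)
next
  case (EqI G t)
  then show ?case by (meson deriv.EqI empty_subsetI finite.emptyI)
qed

text \<open>Free variables serve as parameters. This renaming moves \<open>c\<close> to index 0,
  where a quantifier can bind it, and acts as \<open>shift\<close> on everything without
  \<open>c\<close>; it turns the eigenvariable rules into rules with a fresh parameter.\<close>

lemma ren_fresh:
  assumes "c \<notin> fv A"
  shows "ren (\<lambda>i. if i = c then 0 else Suc i) A = shift A"
  using assms by (intro ren_cong) auto

lemma ren_inst_fresh:
  assumes "c \<notin> fv (All A)"
  shows "ren (\<lambda>i. if i = c then 0 else Suc i) (inst c A) = A"
proof -
  have "ren (\<lambda>i. if i = c then 0 else Suc i) (inst c A) = ren (\<lambda>i. i) A"
    unfolding inst_def ren_ren using assms by (intro ren_cong) (auto split: nat.split)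
  then show ?thesis by (simp add: ren_id)
qed

lemma fresh_image:
  assumes "\<And>B. B \<in> G \<Longrightarrow> c \<notin> fv B"
  shows "ren (\<lambda>i. if i = c then 0 else Suc i) ` G = shift ` G"
  using assms ren_fresh by (auto simp: image_iff)+

lemma deriv_AllI_fresh:
  assumes "deriv T G (inst c A)" "c \<notin> fv (All A)" "\<And>B. B \<in> G \<Longrightarrow> c \<notin> fv B"
  shows "deriv T G (All A)"
  using deriv_ren[OF assms(1), of "\<lambda>i. if i = c then 0 else Suc i"]
  by (simp add: ren_inst_fresh[OF assms(2)] fresh_image[OF assms(3)] AllI)

lemma deriv_ExE_fresh:
  assumes "deriv T (insert (inst c A) G) C" "deriv T G (Ex A)" "c \<notin> fv (All A)" "c \<notin> fv C"
    "\<And>B. B \<in> G \<Longrightarrow> c \<notin> fv B"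
  shows "deriv T G C"
  using deriv_ren[OF assms(1), of "\<lambda>i. if i = c then 0 else Suc i"] assms(2)
  by (simp add: ren_inst_fresh[OF assms(3)] ren_fresh[OF assms(4)] fresh_image[OF assms(5)])
    (rule ExE)

subsection \<open>Prime saturated theories\<close>

text \<open>Deductively closed, consistent, prime theories with Henkin witnesses, in the language
  whose constants are the variables in \<open>U\<close>. They become the worlds of the canonical
  model.\<close>

definition saturated :: "fm set \<Rightarrow> nat set \<Rightarrow> fm set \<Rightarrow> bool" where
  "saturated T U G \<longleftrightarrow> (\<forall>A\<in>G. fv A \<subseteq> U) \<and> (\<forall>A. fv A \<subseteq> U \<longrightarrow> deriv T G A \<longrightarrow> A \<in> G) \<and> Bot \<notin> G \<and>
     (\<forall>A B. Or A B \<in> G \<longrightarrow> A \<in> G \<or> B \<in> G) \<and> (\<forall>A. Ex A \<in> G \<longrightarrow> (\<exists>c\<in>U. inst c A \<in> G))"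

text \<open>The intuitionistic Lindenbaum construction: what is preserved is the underivability of
  \<open>C\<close>, not mere consistency. Each stage adds at most two formulas, so infinitely many
  variables of \<open>U\<close> remain available as witnesses.\<close>

lemma saturated_extension:
  assumes G: "\<forall>A\<in>G. fv A \<subseteq> U" and C: "fv C \<subseteq> U"
    and inf: "infinite {c\<in>U. \<forall>A\<in>G. c \<notin> fv A}" and nd: "\<not> deriv T G C"
  obtains H where "saturated T U H" "G \<subseteq> H" "C \<notin> H"
proof -
  define ok where "ok K \<longleftrightarrow> (\<forall>A\<in>K. fv A \<subseteq> U) \<and> G \<subseteq> K \<and> finite (K - G) \<and> \<not> deriv T K C" for K
  define stp where "stp A K L \<longleftrightarrow> K \<subseteq> L \<and> (fv A \<subseteq> U \<longrightarrow> \<not> deriv T (insert A K) C \<longrightarrow>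
     A \<in> L \<and> (\<forall>B. A = Ex B \<longrightarrow> (\<exists>c\<in>U. inst c B \<in> L)))" for A K L
  have step: "\<exists>L. ok L \<and> stp A K L" if K: "ok K" for A K
  proof (cases "fv A \<subseteq> U \<and> \<not> deriv T (insert A K) C")
    case False
    then show ?thesis using K by (intro exI[of _ K]) (auto simp: stp_def)
  next
    case True
    show ?thesis
    proof (cases "\<exists>B. A = Ex B")
      case False
      with True K show ?thesis
        by (intro exI[of _ "insert A K"]) (auto simp: ok_def stp_def insert_Diff_if)
    next
      case Ex: True
      then obtain B where B: "A = Ex B" by blast
      let ?N = "fv A \<union> fv C \<union> (\<Union>D\<in>K - G. fv D)"
      have "finite ?N" using K by (auto simp: ok_def)
      then have "infinite ({c\<in>U. \<forall>A\<in>G. c \<notin> fv A} - ?N)"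
        using inf by (rule Diff_infinite_finite)
      then obtain c where c: "c \<in> U" "\<forall>A\<in>G. c \<notin> fv A" "c \<notin> ?N"
        using infinite_imp_nonempty by blast
      have fr: "c \<notin> fv D" if "D \<in> insert A K" for D using that c by auto
      have "\<not> deriv T (insert (inst c B) (insert A K)) C"
      proof
        assume *: "deriv T (insert (inst c B) (insert A K)) C"
        have **: "deriv T (insert A K) (Ex B)" unfolding B by (rule Hyp) simp
        have "deriv T (insert A K) C"
          by (rule deriv_ExE_fresh[OF * **]) (use c(3) B fr in simp_all)
        then show False using True by blast
      qed
      moreover have "fv (inst c B) \<subseteq> U"
        using c True B unfolding inst_def fv_ren by (auto split: nat.splits)
      ultimately show ?thesis using True K B c
        by (intro exI[of _ "insert (inst c B) (insert A K)"])
          (auto simp: ok_def stp_def insert_Diff_if)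
    qed
  qed
  have "\<exists>f. \<forall>n. ok (f n) \<and> stp (from_nat n) (f n) (f (Suc n))"
  proof (rule dependent_nat_choice)
    show "\<exists>K. ok K" using nd G by (intro exI[of _ G]) (simp add: ok_def)
  qed (rule step)
  then obtain f where "\<forall>n. ok (f n) \<and> stp (from_nat n) (f n) (f (Suc n))" ..
  then have f: "\<And>n. ok (f n)" "\<And>n. stp (from_nat n) (f n) (f (Suc n))" by simp_all
  have "f n \<subseteq> f (Suc n)" for n using f(2)[of n] by (simp add: stp_def)
  then have inc: "n \<le> m \<Longrightarrow> f n \<subseteq> f m" for n m by (rule lift_Suc_mono_le)
  define H where "H = (\<Union>n. f n)"
  have fH: "f n \<subseteq> H" for n by (auto simp: H_def)
  have GH: "G \<subseteq> H" using f(1)[of 0] fH[of 0] by (auto simp: ok_def)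
  have HU: "\<forall>A\<in>H. fv A \<subseteq> U" using f(1) by (auto simp: H_def ok_def)
  have nH: "\<not> deriv T H C"
  proof
    assume "deriv T H C"
    then obtain K where K: "finite K" "K \<subseteq> H" "deriv T K C"
      using deriv_finite[OF \<open>deriv T H C\<close>] by (elim exE conjE)
    have "\<exists>n. K \<subseteq> f n" using K(1,2)
    proof (induction K)
      case (insert A K)
      then obtain n m where "K \<subseteq> f n" "A \<in> f m" by (auto simp: H_def)
      then have "insert A K \<subseteq> f (max n m)"
        using inc[of n "max n m"] inc[of m "max n m"] by auto
      then show ?case by blast
    qed auto
    then obtain n where "K \<subseteq> f n" by (elim exE)
    then have "deriv T (f n) C" by (rule deriv_mono[OF K(3)])
    then show False using f(1)[of n] by (simp add: ok_def)
  qed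
  \<comment> \<open>A formula over \<open>U\<close> that does not lead to \<open>C\<close> was added
    at its own stage, numbered \<open>to_nat A\<close>. Deductive closure, primeness and witnesses
    all follow from this maximality.\<close>
  have max: "A \<in> H \<and> (\<forall>B. A = Ex B \<longrightarrow> (\<exists>c\<in>U. inst c B \<in> H))"
    if "fv A \<subseteq> U" "\<not> deriv T (insert A H) C" for A
  proof -
    have "\<not> deriv T (insert A (f (to_nat A))) C"
      using that(2) deriv_mono[OF _ insert_mono[OF fH]] by metis
    then show ?thesis using f(2)[of "to_nat A"] that(1) fH by (auto simp: stp_def) blast
  qed
  have closed: "A \<in> H" if "fv A \<subseteq> U" "deriv T H A" for A
    using max[OF that(1)] deriv_cut[OF that(2)] nH by metis
  have "A \<in> H \<or> B \<in> H" if "Or A B \<in> H" for A B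
  proof (rule ccontr)
    assume "\<not> ?thesis"
    moreover have "fv A \<subseteq> U" "fv B \<subseteq> U" using bspec[OF HU that] by simp_all
    ultimately have "deriv T (insert A H) C" "deriv T (insert B H) C" using max by blast+
    then show False using nH OrE[OF Hyp[OF that]] by metis
  qed
  moreover have "\<exists>c\<in>U. inst c A \<in> H" if "Ex A \<in> H" for A
    using max[of "Ex A"] that HU nH by (auto simp: insert_absorb)
  moreover have "Bot \<notin> H" using nH BotE[OF Hyp] by metis
  ultimately have "saturated T U H" using HU closed unfolding saturated_def by blast
  moreover have "C \<notin> H" using nH Hyp by metis
  ultimately show thesis using GH that by blast
qed

subsection \<open>Kripke models\<close>

text \<open>\<open>eq\<close> is a congruence that may grow along the order; it cannot be identity
  in HOL, because elements that differ at one world may become equal at a later one.\<close>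

locale kripke =
  fixes le :: "'w \<Rightarrow> 'w \<Rightarrow> bool" (infix "\<preceq>" 50)
    and D :: "'w \<Rightarrow> 'a set"
    and mem :: "'w \<Rightarrow> 'a \<Rightarrow> 'a \<Rightarrow> bool"
    and eq :: "'w \<Rightarrow> 'a \<Rightarrow> 'a \<Rightarrow> bool"
  assumes le_refl [simp, intro!]: "w \<preceq> w"
    and le_trans [trans]: "u \<preceq> v \<Longrightarrow> v \<preceq> w \<Longrightarrow> u \<preceq> w"
    and D_mono: "v \<preceq> w \<Longrightarrow> x \<in> D v \<Longrightarrow> x \<in> D w"
    and mem_mono: "v \<preceq> w \<Longrightarrow> mem v x y \<Longrightarrow> mem w x y"
    and eq_mono: "v \<preceq> w \<Longrightarrow> eq v x y \<Longrightarrow> eq w x y"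
    and mem_D: "mem w x y \<Longrightarrow> x \<in> D w \<and> y \<in> D w"
    and eq_D: "eq w x y \<Longrightarrow> x \<in> D w \<and> y \<in> D w"
    and eq_refl: "x \<in> D w \<Longrightarrow> eq w x x"
    and eq_sym: "eq w x y \<Longrightarrow> eq w y x"
    and eq_trans [trans]: "eq w x y \<Longrightarrow> eq w y z \<Longrightarrow> eq w x z"
    and mem_cong: "mem w x y \<Longrightarrow> eq w x x' \<Longrightarrow> eq w y y' \<Longrightarrow> mem w x' y'"
begin

primrec frc :: "fm \<Rightarrow> 'w \<Rightarrow> (nat \<Rightarrow> 'a) \<Rightarrow> bool" where
  "frc (Mem x y) w e = mem w (e x) (e y)"
| "frc (Eq x y) w e = eq w (e x) (e y)"
| "frc Bot w e = False"
| "frc (And A B) w e = (frc A w e \<and> frc B w e)"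
| "frc (Or A B) w e = (frc A w e \<or> frc B w e)"
| "frc (Imp A B) w e = (\<forall>v. w \<preceq> v \<longrightarrow> frc A v e \<longrightarrow> frc B v e)"
| "frc (All A) w e = (\<forall>v. w \<preceq> v \<longrightarrow> (\<forall>x\<in>D v. frc A v (case_nat x e)))"
| "frc (Ex A) w e = (\<exists>x\<in>D w. frc A w (case_nat x e))"

end

text \<open>Canonical model: a world is a level \<open>k\<close> with a saturated theory over the
  variables \<open>V k\<close>, and its elements are these variables themselves. Classical reasoning
  is harmless here, as it concerns only the existence of a countermodel.\<close>

theorem kripke_completeness:
  assumes nd: "\<not> deriv T {} A"
  shows "\<exists>le D mem eq. \<exists>(w :: nat \<times> fm set) (e :: nat \<Rightarrow> nat). kripke le D mem eq \<and>
     (\<forall>B\<in>T. \<forall>v f. (\<forall>i. f i \<in> D v) \<longrightarrow> kripke.frc le D mem eq B v f) \<and> e ` fv A \<subseteq> D w \<and>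
     \<not> kripke.frc le D mem eq A w e"
proof -
  \<comment> \<open>Coded pairs split the variables into infinitely many infinite blocks, and each
    level adds one block. What is not derivable at level \<open>k\<close> can thus be refuted at
    level \<open>k + 1\<close>, where fresh parameters are at hand.\<close>
  define V where "V k = fv A \<union> {x. fst (prod_decode x) \<le> k}" for k
  have V_mono: "j \<le> k \<Longrightarrow> V j \<subseteq> V k" for j k by (auto simp: V_def)
  have V_inf: "infinite {c\<in>V (Suc k). c \<notin> V k}" for k
  proof
    assume "finite {c\<in>V (Suc k). c \<notin> V k}"
    then have "finite (fv A \<union> {c\<in>V (Suc k). c \<notin> V k})" by simp
    then have "finite (range (\<lambda>n. prod_encode (Suc k, n)))"
      by (rule rev_finite_subset) (auto simp: V_def)
    moreover have "inj (\<lambda>n. prod_encode (Suc k, n))" by (auto simp: inj_on_def)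
    ultimately show False using finite_imageD infinite_UNIV_nat by blast
  qed
  have "infinite {c \<in> V 0. \<forall>B\<in>{}. c \<notin> fv B}"
  proof
    assume "finite {c \<in> V 0. \<forall>B\<in>{}. c \<notin> fv B}"
    then have "finite (range (\<lambda>n. prod_encode (0, n)))"
      by (rule rev_finite_subset) (auto simp: V_def)
    moreover have "inj (\<lambda>n. prod_encode (0, n))" by (auto simp: inj_on_def)
    ultimately show False using finite_imageD infinite_UNIV_nat by blast
  qed
  then obtain G0 where G0: "saturated T (V 0) G0" "A \<notin> G0"
    using saturated_extension[of "{}" "V 0" A T] nd by (auto simp: V_def)
  \<comment> \<open>The type of worlds also contains pairs that are not saturated theories. They are
    read as the root \<open>(0, G0)\<close>, so that the relations of the locale are total without
    side conditions.\<close>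
  define nw where "nw w = (if saturated T (V (fst w)) (snd w) then w else (0, G0))" for w
  define le where "le v w \<longleftrightarrow> fst (nw v) \<le> fst (nw w) \<and> snd (nw v) \<subseteq> snd (nw w)" for v w
  define D where "D w = V (fst (nw w))" for w
  define mem where "mem w x y \<longleftrightarrow> Mem x y \<in> snd (nw w)" for w x y
  define eq where "eq w x y \<longleftrightarrow> Eq x y \<in> snd (nw w)" for w x y
  have sat: "saturated T (D w) (snd (nw w))" for w using G0 by (auto simp: nw_def D_def)
  have inU: "fv B \<subseteq> D w" if "B \<in> snd (nw w)" for B w using sat[of w] that unfolding saturated_def by blast
  have cl: "B \<in> snd (nw w)" if "deriv T (snd (nw w)) B" "fv B \<subseteq> D w" for B w
    using sat[of w] that unfolding saturated_def by blast
  have EqE': "inst t B \<in> snd (nw w)" if "eq w s t" "inst s B \<in> snd (nw w)" for w s t B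
  proof (rule cl)
    show "deriv T (snd (nw w)) (inst t B)" using that by (meson EqE Hyp eq_def)
    show "fv (inst t B) \<subseteq> D w" using inU[OF that(2)] inU[OF that(1)[unfolded eq_def]]
      unfolding inst_def fv_ren by (auto split: nat.splits)
  qed
  have kr: "kripke le D mem eq"
  proof
    show D_mono: "x \<in> D w" if "le v w" "x \<in> D v" for v w x
      using that V_mono by (auto simp: le_def D_def)
    show mem_D: "x \<in> D w \<and> y \<in> D w" if "mem w x y" for w x y
      using inU[of "Mem x y" w] that by (auto simp: mem_def)
    show eq_D: "x \<in> D w \<and> y \<in> D w" if "eq w x y" for w x y
      using inU[of "Eq x y" w] that by (auto simp: eq_def)
    show eq_refl: "eq w x x" if "x \<in> D w" for w x
      using that unfolding eq_def by (intro cl EqI) auto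
    show eq_sym: "eq w y x" if "eq w x y" for w x y
      using EqE'[OF that, of "Eq 0 (Suc x)"] eq_refl[of x w] eq_D[OF that]
      by (simp add: inst_def eq_def)
    show "eq w x z" if "eq w x y" "eq w y z" for w x y z
      using EqE'[OF that(2), of "Eq (Suc x) 0"] that(1) by (simp add: inst_def eq_def)
    show "mem w x' y'" if "mem w x y" "eq w x x'" "eq w y y'" for w x y x' y'
      using EqE'[OF that(2), of "Mem 0 (Suc y)"] EqE'[OF that(3), of "Mem (Suc x') 0"] that(1)
      by (simp add: inst_def mem_def)
  qed (auto simp: le_def mem_def eq_def)
  interpret kripke le D mem eq by (rule kr)
  have V_Suc: "D w \<subseteq> V (Suc (fst (nw w)))" for w using V_mono by (simp add: D_def)
  have ext: "\<exists>v. le w v \<and> G \<subseteq> snd (nw v) \<and> C \<notin> snd (nw v) \<and> D v = V (Suc (fst (nw w)))"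
    if h: "snd (nw w) \<subseteq> G" "\<forall>B\<in>G. fv B \<subseteq> D w" "fv C \<subseteq> V (Suc (fst (nw w)))"
      "\<not> deriv T G C" for w G C
  proof -
    have 1: "\<forall>B\<in>G. fv B \<subseteq> V (Suc (fst (nw w)))" using h(2) V_Suc by blast
    have 2: "infinite {c\<in>V (Suc (fst (nw w))). \<forall>B\<in>G. c \<notin> fv B}"
    proof
      assume "finite {c\<in>V (Suc (fst (nw w))). \<forall>B\<in>G. c \<notin> fv B}"
      then have "finite {c\<in>V (Suc (fst (nw w))). c \<notin> V (fst (nw w))}"
        by (rule rev_finite_subset) (use h(2) in \<open>auto simp: D_def\<close>)
      then show False using V_inf by blast
    qed
    obtain H where "saturated T (V (Suc (fst (nw w)))) H" "G \<subseteq> H" "C \<notin> H"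
      using saturated_extension[OF 1 h(3) 2 h(4)] by blast
    then show ?thesis using h(1)
      by (intro exI[of _ "(Suc (fst (nw w)), H)"]) (auto simp: le_def nw_def[of "(_, H)"] D_def)
  qed
  \<comment> \<open>Environments into the canonical model map variables to variables, so they are
    themselves renamings.\<close>
  have truth: "frc B w e \<longleftrightarrow> ren e B \<in> snd (nw w)" if "e ` fv B \<subseteq> D w" for B w e
    using that
  proof (induction B arbitrary: w e)
    case (Mem x y)
    show ?case by (simp only: frc.simps ren.simps mem_def[of w "e x" "e y"])
  next
    case (Eq x y)
    show ?case by (simp only: frc.simps ren.simps eq_def[of w "e x" "e y"])
  next
    case Bot
    then show ?case using sat by (simp add: saturated_def)
  next
    case (And A B)
    have fA: "fv (ren e A) \<subseteq> D w" and fB: "fv (ren e B) \<subseteq> D w" using And.prems by (auto simp: fv_ren)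
    have "ren e A \<in> snd (nw w)" "ren e B \<in> snd (nw w)" if "And (ren e A) (ren e B) \<in> snd (nw w)"
      using cl[OF AndE1[OF Hyp[OF that]] fA] cl[OF AndE2[OF Hyp[OF that]] fB] .
    moreover have "And (ren e A) (ren e B) \<in> snd (nw w)"
      if "ren e A \<in> snd (nw w)" "ren e B \<in> snd (nw w)"
      using cl[OF AndI[OF Hyp[OF that(1)] Hyp[OF that(2)]]] fA fB by simp
    moreover have "frc A w e \<longleftrightarrow> ren e A \<in> snd (nw w)" "frc B w e \<longleftrightarrow> ren e B \<in> snd (nw w)"
      using And.prems by (auto intro!: And.IH)
    ultimately show ?case by auto
  next
    case (Or A B)
    have fA: "fv (ren e A) \<subseteq> D w" and fB: "fv (ren e B) \<subseteq> D w" using Or.prems by (auto simp: fv_ren)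
    have "Or (ren e A) (ren e B) \<in> snd (nw w)" if "ren e A \<in> snd (nw w)"
      using cl[OF OrI1[OF Hyp[OF that]]] fA fB by simp
    moreover have "Or (ren e A) (ren e B) \<in> snd (nw w)" if "ren e B \<in> snd (nw w)"
      using cl[OF OrI2[OF Hyp[OF that]]] fA fB by simp
    moreover have "frc A w e \<longleftrightarrow> ren e A \<in> snd (nw w)" "frc B w e \<longleftrightarrow> ren e B \<in> snd (nw w)"
      using Or.prems by (auto intro!: Or.IH)
    moreover have "ren e A \<in> snd (nw w) \<or> ren e B \<in> snd (nw w)"
      if "Or (ren e A) (ren e B) \<in> snd (nw w)"
      using sat[of w] that by (auto simp: saturated_def)
    ultimately show ?case by auto
  next
    case (Imp A B)
    have fvA: "fv (ren e A) \<subseteq> D w" and fvB: "fv (ren e B) \<subseteq> D w"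
      using Imp.prems by (auto simp: fv_ren)
    have eA: "frc A v e \<longleftrightarrow> ren e A \<in> snd (nw v)" and eB: "frc B v e \<longleftrightarrow> ren e B \<in> snd (nw v)"
      if "le w v" for v
      using Imp.prems D_mono[OF that] by (auto intro!: Imp.IH)
    show ?case
    proof
      assume "ren e (Imp A B) \<in> snd (nw w)"
      then have "ren e (Imp A B) \<in> snd (nw v)" if "le w v" for v using that by (auto simp: le_def)
      then have imp: "Imp (ren e A) (ren e B) \<in> snd (nw v)" if "le w v" for v using that by simp
      have "ren e B \<in> snd (nw v)" if "le w v" "ren e A \<in> snd (nw v)" for v
        using cl[OF ImpE[OF Hyp[OF imp[OF that(1)]] Hyp[OF that(2)]]] fvB D_mono[OF that(1)] by blast
      then show "frc (Imp A B) w e" using eA eB by auto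
    next
      assume f: "frc (Imp A B) w e"
      show "ren e (Imp A B) \<in> snd (nw w)"
      proof (rule ccontr)
        assume "ren e (Imp A B) \<notin> snd (nw w)"
        then have nd: "\<not> deriv T (insert (ren e A) (snd (nw w))) (ren e B)"
          using cl[of w "ren e (Imp A B)"] fvA fvB by (auto intro: ImpI)
        have fvs: "\<forall>B\<in>insert (ren e A) (snd (nw w)). fv B \<subseteq> D w" using fvA inU by auto
        have "\<exists>v. le w v \<and> insert (ren e A) (snd (nw w)) \<subseteq> snd (nw v) \<and> ren e B \<notin> snd (nw v) \<and>
            D v = V (Suc (fst (nw w)))"
          using fvB V_Suc[of w] by (intro ext[OF _ fvs _ nd]) auto
        then show False using f eA eB by auto
      qed
    qed
  next
    case (All A)
    let ?B = "ren (case_nat 0 (\<lambda>i. Suc (e i))) A"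
    have fvB: "fv (All ?B) \<subseteq> D w"
      using All.prems by (simp only: ren.simps[symmetric] fv_ren)
    have eA: "frc A v (case_nat x e) \<longleftrightarrow> inst x ?B \<in> snd (nw v)" if "le w v" "x \<in> D v" for v x
      unfolding inst_ren
    proof (rule All.IH)
      have "case_nat x e ` fv A \<subseteq> insert x (e ` fv (All A))" by (auto split: nat.splits)
      moreover have "D w \<subseteq> D v" using D_mono[OF that(1)] by (rule subsetI)
      ultimately show "case_nat x e ` fv A \<subseteq> D v"
        using subset_trans[OF All.prems] that(2) by (meson insert_subset subset_trans)
    qed
    show ?case
    proof
      assume "ren e (All A) \<in> snd (nw w)"
      then have "All ?B \<in> snd (nw v)" if "le w v" for v using that by (auto simp: le_def)
      then have all: "All ?B \<in> snd (nw v)" if "le w v" for v using that by simp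
      have "inst x ?B \<in> snd (nw v)" if "le w v" "x \<in> D v" for v x
      proof (rule cl[OF AllE[OF Hyp[OF all[OF that(1)]]]])
        have "fv (inst x ?B) \<subseteq> insert x (fv (All ?B))"
          unfolding inst_def fv_ren[of "case_nat x _"] by (auto split: nat.splits)
        then show "fv (inst x ?B) \<subseteq> D v" using that fvB D_mono[OF that(1)] by blast
      qed
      then show "frc (All A) w e" using eA by auto
    next
      assume f: "frc (All A) w e"
      show "ren e (All A) \<in> snd (nw w)"
      proof (rule ccontr)
        assume n: "ren e (All A) \<notin> snd (nw w)"
        \<comment> \<open>This parameter is new at the next level, hence fresh for the whole theory
          of \<open>w\<close>; deriving the instance from that theory would derive the quantified
          formula.\<close>
        obtain c where c: "c \<in> V (Suc (fst (nw w)))" "c \<notin> V (fst (nw w))"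
          using V_inf[of "fst (nw w)"] using infinite_imp_nonempty by blast
        have fr: "c \<notin> fv B" if "B \<in> snd (nw w)" for B using inU[OF that] c by (auto simp: D_def)
        have nd: "\<not> deriv T (snd (nw w)) (inst c ?B)"
        proof
          assume "deriv T (snd (nw w)) (inst c ?B)"
          then have "deriv T (snd (nw w)) (All ?B)"
            using fvB c fr by (intro deriv_AllI_fresh) (auto simp: D_def)
          then show False using n fvB cl by auto
        qed
        have fvs: "\<forall>B\<in>snd (nw w). fv B \<subseteq> D w" using inU by blast
        have fi: "fv (inst c ?B) \<subseteq> V (Suc (fst (nw w)))"
        proof -
          have "fv (inst c ?B) \<subseteq> insert c (fv (All ?B))"
            unfolding inst_def fv_ren[of "case_nat c _"] by (auto split: nat.splits)
          then show ?thesis using c fvB V_Suc[of w] by blast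
        qed
        have "\<exists>v. le w v \<and> snd (nw w) \<subseteq> snd (nw v) \<and> inst c ?B \<notin> snd (nw v) \<and>
            D v = V (Suc (fst (nw w)))"
          by (rule ext[OF _ fvs fi nd]) simp
        then show False using f eA c by auto
      qed
    qed
  next
    case (Ex A)
    let ?B = "ren (case_nat 0 (\<lambda>i. Suc (e i))) A"
    have fvB: "fv (Ex ?B) \<subseteq> D w"
      using Ex.prems by (simp only: ren.simps[symmetric] fv_ren)
    have eA: "frc A w (case_nat x e) \<longleftrightarrow> inst x ?B \<in> snd (nw w)" if "x \<in> D w" for x
      unfolding inst_ren
    proof (rule Ex.IH)
      have "case_nat x e ` fv A \<subseteq> insert x (e ` fv (Ex A))" by (auto split: nat.splits)
      then show "case_nat x e ` fv A \<subseteq> D w"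
        using Ex.prems that by (meson insert_subset subset_trans)
    qed
    have "\<exists>x\<in>D w. inst x ?B \<in> snd (nw w)" if "Ex ?B \<in> snd (nw w)"
      using sat[of w] that by (auto simp: saturated_def)
    moreover have "Ex ?B \<in> snd (nw w)" if "inst x ?B \<in> snd (nw w)" for x
      using cl[OF ExI[OF Hyp[OF that]] fvB] .
    ultimately show ?case using eA by auto
  qed
  have D0: "D (0, G0) = V 0" "snd (nw (0, G0)) = G0" by (simp_all add: D_def nw_def)
  have "\<not> frc A (0, G0) id"
    using truth[of id A "(0, G0)"] G0 D0 by (auto simp: V_def ren_id id_def)
  moreover have "frc B v f" if "B \<in> T" "\<forall>i. f i \<in> D v" for B v f
  proof -
    have "deriv T (snd (nw v)) (ren f B)" using that(1) by (rule deriv_ren_axiom)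
    then have "ren f B \<in> snd (nw v)" using that by (intro cl) (auto simp: fv_ren)
    then show ?thesis using truth[of f B v] that by auto
  qed
  moreover have "id ` fv A \<subseteq> D (0, G0)" using D0 by (auto simp: V_def)
  ultimately show ?thesis using kr by blast
qed

section \<open>Semantics of formulas with HOL-bound variables\<close>

context kripke
begin

lemma frc_mono: "frc A v e \<Longrightarrow> v \<preceq> w \<Longrightarrow> frc A w e"
proof (induction A arbitrary: v w e)
  case (Imp A B)
  then show ?case by (meson frc.simps(6) le_trans)
next
  case (All A)
  then show ?case by (meson frc.simps(7) le_trans)
next
  case (Ex A)
  then show ?case by (meson frc.simps(8) D_mono)
qed (auto intro: mem_mono eq_mono)

lemma frc_ren: "frc (ren r A) w e = frc A w (\<lambda>i. e (r i))"
proof (induction A arbitrary: r w e)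
  case (All A)
  have "(\<lambda>i. case_nat x e (case_nat 0 (\<lambda>i. Suc (r i)) i)) = case_nat x (\<lambda>i. e (r i))" for x
    by (auto split: nat.split)
  then show ?case by (simp add: All)
next
  case (Ex A)
  have "(\<lambda>i. case_nat x e (case_nat 0 (\<lambda>i. Suc (r i)) i)) = case_nat x (\<lambda>i. e (r i))" for x
    by (auto split: nat.split)
  then show ?case by (simp add: Ex)
qed simp_all

text \<open>
  The environment at depth \<open>d\<close>: \<open>e\<close> gives the values of the levels below \<open>d\<close>, \<open>p\<close> those of the
  parameters that are left free in an axiom schema.
\<close>

definition lenv :: "nat \<Rightarrow> (nat \<Rightarrow> 'a) \<Rightarrow> (nat \<Rightarrow> 'a) \<Rightarrow> nat \<Rightarrow> 'a" where
  "lenv d e p i = (if i < d then e (d - Suc i) else p (i - d))"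

lemma lenv_Suc: "case_nat x (lenv d e p) = lenv (Suc d) (e(d := x)) p"
  by (rule ext) (auto simp: lenv_def split: nat.split)

lemma lenv_level: "l < d \<Longrightarrow> lenv d e p (d - Suc l) = e l"
  by (auto simp: lenv_def)

text \<open>
  \<open>FR p \<Gamma> A P\<close>: in every context in which the levels in \<open>\<Gamma>\<close> have the values recorded there, the formula
  \<open>A\<close> is forced exactly at the worlds in \<open>P\<close>. \<open>TR p \<Gamma> t Q\<close>: likewise, \<open>Q w v\<close> says that \<open>v\<close> is a value
  of the term \<open>t\<close> at \<open>w\<close>.
\<close>

definition FR :: "(nat \<Rightarrow> 'a) \<Rightarrow> (nat \<times> 'a) set \<Rightarrow> form \<Rightarrow> ('w \<Rightarrow> bool) \<Rightarrow> bool" where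
  "FR p \<Gamma> A P \<longleftrightarrow> (\<forall>d e. (\<forall>(l, x)\<in>\<Gamma>. l < d \<and> e l = x) \<longrightarrow> (\<forall>w. frc (A d) w (lenv d e p) = P w))"

definition TR :: "(nat \<Rightarrow> 'a) \<Rightarrow> (nat \<times> 'a) set \<Rightarrow> trm \<Rightarrow> ('w \<Rightarrow> 'a \<Rightarrow> bool) \<Rightarrow> bool" where
  "TR p \<Gamma> t Q \<longleftrightarrow> (\<forall>\<Delta> K k. \<Gamma> \<subseteq> \<Delta> \<longrightarrow>
     (\<forall>\<Theta> l x. \<Delta> \<subseteq> \<Theta> \<longrightarrow> (l, x) \<in> \<Theta> \<longrightarrow> FR p \<Theta> (K l) (k x)) \<longrightarrow>
     FR p \<Delta> (t K) (\<lambda>w. \<exists>v. Q w v \<and> k v w))"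

lemma FR_D:
  "FR p \<Gamma> A P \<Longrightarrow> \<forall>(l, x)\<in>\<Gamma>. l < d \<and> e l = x \<Longrightarrow> frc (A d) w (lenv d e p) = P w"
  unfolding FR_def by metis

lemma FR_mono:
  assumes "FR p \<Gamma> A P" "\<Gamma> \<subseteq> \<Delta>"
  shows "FR p \<Delta> A P"
  unfolding FR_def
proof (intro allI impI)
  fix d e w
  assume "\<forall>(l, x)\<in>\<Delta>. l < d \<and> e l = x"
  then have "\<forall>(l, x)\<in>\<Gamma>. l < d \<and> e l = x" using assms(2) by auto
  then show "frc (A d) w (lenv d e p) = P w" by (rule FR_D[OF assms(1)])
qed

text \<open>The continuation is tested in all contexts extending \<Delta>, because evaluating
  \<open>t\<close> may bind further levels before the continuation is reached.\<close>

lemma TR_D: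
  assumes "TR p \<Gamma> t Q" "\<Gamma> \<subseteq> \<Delta>" "\<And>\<Theta> l x. \<Delta> \<subseteq> \<Theta> \<Longrightarrow> (l, x) \<in> \<Theta> \<Longrightarrow> FR p \<Theta> (K l) (k x)"
  shows "FR p \<Delta> (t K) (\<lambda>w. \<exists>v. Q w v \<and> k v w)"
  by (rule assms(1)[unfolded TR_def, rule_format, OF assms(2)]) (rule assms(3))

lemma TR_I:
  assumes "\<And>\<Delta> K k. \<Gamma> \<subseteq> \<Delta> \<Longrightarrow> (\<And>\<Theta> l x. \<Delta> \<subseteq> \<Theta> \<Longrightarrow> (l, x) \<in> \<Theta> \<Longrightarrow> FR p \<Theta> (K l) (k x)) \<Longrightarrow>
    FR p \<Delta> (t K) (\<lambda>w. \<exists>v. Q w v \<and> k v w)"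
  shows "TR p \<Gamma> t Q"
  unfolding TR_def by (intro allI impI) (rule assms, simp_all)

lemma TR_mono:
  assumes "TR p \<Gamma> t Q" "\<Gamma> \<subseteq> \<Delta>"
  shows "TR p \<Delta> t Q"
  by (rule TR_I, rule TR_D[OF assms(1)]) (use assms(2) in simp_all)

lemma TR_insert: "TR p \<Gamma> t Q \<Longrightarrow> TR p (insert b \<Gamma>) t Q"
  by (erule TR_mono) blast

lemma FR_cong: "FR p \<Gamma> A P \<Longrightarrow> (\<And>w. P w = Q w) \<Longrightarrow> FR p \<Gamma> A Q"
  by (simp add: FR_def)

lemma TR_cong: "TR p \<Gamma> t P \<Longrightarrow> (\<And>w v. P w v = Q w v) \<Longrightarrow> TR p \<Gamma> t Q"
  by (simp add: TR_def)

lemma TR_var: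
  assumes "(l, x) \<in> \<Gamma>"
  shows "TR p \<Gamma> (var l) (\<lambda>w v. v = x)"
proof (rule TR_I)
  fix \<Delta> K k
  assume \<Delta>: "\<Gamma> \<subseteq> \<Delta>" and K: "\<And>\<Theta> l x. \<Delta> \<subseteq> \<Theta> \<Longrightarrow> (l, x) \<in> \<Theta> \<Longrightarrow> FR p \<Theta> (K l) (k x)"
  have "FR p \<Delta> (K l) (k x)" by (rule K[OF order_refl subsetD[OF \<Delta> assms]])
  then show "FR p \<Delta> (var l K) (\<lambda>w. \<exists>v. v = x \<and> k v w)" by (simp add: var_def)
qed

lemma FR_level:
  "(l, x) \<in> \<Gamma> \<Longrightarrow> \<forall>(l, x)\<in>\<Gamma>. l < d \<and> e l = x \<Longrightarrow> lenv d e p (d - Suc l) = x"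
  using lenv_level by (fastforce dest: bspec)

lemma FR_Mem:
  "(l, x) \<in> \<Gamma> \<Longrightarrow> (m, y) \<in> \<Gamma> \<Longrightarrow> FR p \<Gamma> (\<lambda>d. Mem (d - Suc l) (d - Suc m)) (\<lambda>w. mem w x y)"
  unfolding FR_def by (simp add: FR_level)

lemma FR_Eq:
  "(l, x) \<in> \<Gamma> \<Longrightarrow> (m, y) \<in> \<Gamma> \<Longrightarrow> FR p \<Gamma> (\<lambda>d. Eq (d - Suc l) (d - Suc m)) (\<lambda>w. eq w x y)"
  unfolding FR_def by (simp add: FR_level)

lemma FR_mem:
  assumes "TR p \<Gamma> s S" "TR p \<Gamma> t Q"
  shows "FR p \<Gamma> (s \<^bold>\<in> t) (\<lambda>w. \<exists>x. S w x \<and> (\<exists>y. Q w y \<and> mem w x y))"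
  unfolding f_mem_def
  by (rule TR_D[OF assms(1) order_refl], rule TR_D[OF assms(2)], assumption, rule FR_Mem)
    (blast, assumption)

lemma FR_eq:
  assumes "TR p \<Gamma> s S" "TR p \<Gamma> t Q"
  shows "FR p \<Gamma> (s \<^bold>= t) (\<lambda>w. \<exists>x. S w x \<and> (\<exists>y. Q w y \<and> eq w x y))"
  unfolding f_eq_def
  by (rule TR_D[OF assms(1) order_refl], rule TR_D[OF assms(2)], assumption, rule FR_Eq)
    (blast, assumption)

lemma FR_not: "FR p \<Gamma> A P \<Longrightarrow> FR p \<Gamma> (\<^bold>\<not> A) (\<lambda>w. \<forall>v. w \<preceq> v \<longrightarrow> \<not> P v)"
  unfolding FR_def f_not_def by simp

lemma FR_and: "FR p \<Gamma> A P \<Longrightarrow> FR p \<Gamma> B Q \<Longrightarrow> FR p \<Gamma> (A \<^bold>\<and> B) (\<lambda>w. P w \<and> Q w)"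
  unfolding FR_def f_and_def by simp

lemma FR_or: "FR p \<Gamma> A P \<Longrightarrow> FR p \<Gamma> B Q \<Longrightarrow> FR p \<Gamma> (A \<^bold>\<or> B) (\<lambda>w. P w \<or> Q w)"
  unfolding FR_def f_or_def by simp

lemma FR_imp:
  "FR p \<Gamma> A P \<Longrightarrow> FR p \<Gamma> B Q \<Longrightarrow> FR p \<Gamma> (A \<^bold>\<longrightarrow> B) (\<lambda>w. \<forall>v. w \<preceq> v \<longrightarrow> P v \<longrightarrow> Q v)"
  unfolding FR_def f_imp_def by simp

lemma FR_iff:
  "FR p \<Gamma> A P \<Longrightarrow> FR p \<Gamma> B Q \<Longrightarrow> FR p \<Gamma> (A \<^bold>\<longleftrightarrow> B) (\<lambda>w. \<forall>v. w \<preceq> v \<longrightarrow> P v = Q v)"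
  unfolding f_iff_def by (rule FR_cong, (rule FR_and FR_imp | assumption)+) blast

lemma FR_bind:
  assumes "\<And>l x. FR p (insert (l, x) \<Gamma>) (F (var l)) (P x)" "\<forall>(l, x)\<in>\<Gamma>. l < d \<and> e l = x"
  shows "frc (F (var d) (Suc d)) w (case_nat x (lenv d e p)) = P x w"
proof -
  have "\<forall>(m, y)\<in>insert (d, x) \<Gamma>. m < Suc d \<and> (e(d := x)) m = y" using assms(2) by auto
  from FR_D[OF assms(1) this] show ?thesis unfolding lenv_Suc .
qed

lemma FR_all:
  assumes "\<And>l x. FR p (insert (l, x) \<Gamma>) (F (var l)) (P x)"
  shows "FR p \<Gamma> (f_all F) (\<lambda>w. \<forall>v. w \<preceq> v \<longrightarrow> (\<forall>x\<in>D v. P x v))"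
  unfolding FR_def f_all_def using FR_bind[OF assms] by simp

lemma FR_ex:
  assumes "\<And>l x. FR p (insert (l, x) \<Gamma>) (F (var l)) (P x)"
  shows "FR p \<Gamma> (f_ex F) (\<lambda>w. \<exists>x\<in>D w. P x w)"
  unfolding FR_def f_ex_def using FR_bind[OF assms] by simp

lemma FR_ball:
  assumes "TR p \<Gamma> a S" "\<And>l x. FR p (insert (l, x) \<Gamma>) (F (var l)) (P x)"
  shows "FR p \<Gamma> (f_ball a F) (\<lambda>w. \<forall>v. w \<preceq> v \<longrightarrow> (\<forall>x. (\<exists>y. S v y \<and> mem v x y) \<longrightarrow> P x v))"
  unfolding f_ball_def
  by (rule FR_cong, rule FR_all, rule FR_imp[OF FR_mem[OF TR_var[OF insertI1] TR_insert[OF assms(1)]] assms(2)])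
    (auto intro: le_trans dest: mem_D)

lemma FR_bex:
  assumes "TR p \<Gamma> a S" "\<And>l x. FR p (insert (l, x) \<Gamma>) (F (var l)) (P x)"
  shows "FR p \<Gamma> (f_bex a F) (\<lambda>w. \<exists>x. (\<exists>y. S w y \<and> mem w x y) \<and> P x w)"
  unfolding f_bex_def
  by (rule FR_cong, rule FR_ex, rule FR_and[OF FR_mem[OF TR_var[OF insertI1] TR_insert[OF assms(1)]] assms(2)])
    (auto dest: mem_D)

text \<open>Uniqueness is not built in: every element satisfying the description is a value. That
  the values agree up to \<open>eq\<close> has to be proved where it matters.\<close>

lemma TR_desc:
  assumes "\<And>l x. FR p (insert (l, x) \<Gamma>) (F (var l)) (P x)"
  shows "TR p \<Gamma> (desc F) (\<lambda>w x. x \<in> D w \<and> P x w)"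
proof (rule TR_I)
  fix \<Delta> K k
  assume \<Delta>: "\<Gamma> \<subseteq> \<Delta>" and K: "\<And>\<Theta> l x. \<Delta> \<subseteq> \<Theta> \<Longrightarrow> (l, x) \<in> \<Theta> \<Longrightarrow> FR p \<Theta> (K l) (k x)"
  have 1: "FR p (insert (l, x) \<Delta>) (F (var l)) (P x)" for l x
    by (rule FR_mono[OF assms]) (use \<Delta> in blast)
  have 2: "FR p (insert (l, x) \<Delta>) (K l) (k x)" for l x
    by (rule K) auto
  show "FR p \<Delta> (desc F K) (\<lambda>w. \<exists>v. (v \<in> D w \<and> P v w) \<and> k v w)"
    unfolding FR_def desc_def
  proof (intro allI impI)
    fix d e w
    assume e: "\<forall>(l, x)\<in>\<Delta>. l < d \<and> e l = x"
    have "frc (K d (Suc d)) w (case_nat x (lenv d e p)) = k x w" for x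
    proof -
      have "\<forall>(m, y)\<in>insert (d, x) \<Delta>. m < Suc d \<and> (e(d := x)) m = y" using e by auto
      from FR_D[OF 2 this] show ?thesis unfolding lenv_Suc .
    qed
    then show "frc (fm.Ex ((F (var d) \<^bold>\<and> K d) (Suc d))) w (lenv d e p) =
        (\<exists>v. (v \<in> D w \<and> P v w) \<and> k v w)"
      using FR_bind[OF 1 e] by (auto simp: f_and_def)
  qed
qed

lemma TR_eval_in:
  assumes "TR p \<Gamma> t Q" "\<And>l x. TR p (insert (l, x) \<Gamma>) (F (var l)) (P x)"
  shows "TR p \<Gamma> (eval_in t F) (\<lambda>w v. \<exists>x. Q w x \<and> P x w v)"
  unfolding eval_in_def
proof (rule TR_I)
  fix \<Delta> K k
  assume \<Delta>: "\<Gamma> \<subseteq> \<Delta>" and K: "\<And>\<Theta> l x. \<Delta> \<subseteq> \<Theta> \<Longrightarrow> (l, x) \<in> \<Theta> \<Longrightarrow> FR p \<Theta> (K l) (k x)"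
  have "FR p \<Theta> (F (var l) K) (\<lambda>w. \<exists>v. P x w v \<and> k v w)" if "\<Delta> \<subseteq> \<Theta>" "(l, x) \<in> \<Theta>" for \<Theta> l x
    by (rule TR_D[OF assms(2)[of l x]], use \<Delta> that in blast, rule K) (use that in auto)
  then have "FR p \<Delta> (t (\<lambda>l. F (var l) K)) (\<lambda>w. \<exists>x. Q w x \<and> (\<exists>v. P x w v \<and> k v w))"
    by (rule TR_D[OF assms(1) \<Delta>])
  then show "FR p \<Delta> (t (\<lambda>l. F (var l) K)) (\<lambda>w. \<exists>v. (\<exists>x. Q w x \<and> P x w v) \<and> k v w)"
    by (rule FR_cong) metis
qed

lemma FR_eval_in:
  assumes "TR p \<Gamma> t Q" "\<And>l x. FR p (insert (l, x) \<Gamma>) (F (var l)) (P x)"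
  shows "FR p \<Gamma> (f_eval_in t F) (\<lambda>w. \<exists>x. Q w x \<and> P x w)"
  unfolding f_eval_in_def
  by (rule TR_D[OF assms(1) order_refl], rule FR_mono[OF assms(2)]) blast

lemma FR_ren:
  assumes "\<And>d e. \<forall>(l, x)\<in>\<Gamma>. l < d \<and> e l = x \<Longrightarrow> (\<lambda>i. lenv d e p (r d i)) = q"
  shows "FR p \<Gamma> (\<lambda>d. ren (r d) A) (\<lambda>w. frc A w q)"
  unfolding FR_def frc_ren using assms by simp

lemma FR_plug1:
  assumes "TR p \<Gamma> t Q"
  shows "FR p \<Gamma> (A\<lbrakk>[t]\<rbrakk>) (\<lambda>w. \<exists>x. Q w x \<and> frc A w (case_nat x p))"
  unfolding plug_def eval_list.simps
proof (rule TR_D[OF assms order_refl], rule FR_ren)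
  fix \<Theta> :: "(nat \<times> 'a) set" and l x d e
  assume "(l, x) \<in> \<Theta>" "\<forall>(l, x)\<in>\<Theta>. l < d \<and> e l = x"
  then have "l < d" "e l = x" by auto
  then show "(\<lambda>i. lenv d e p (if i < length [l] then d - Suc ([l] ! i) else d + (i - length [l]))) =
      case_nat x p"
    by (auto simp: lenv_def fun_eq_iff split: nat.splits)
qed

lemma FR_plug2:
  assumes "TR p \<Gamma> t Q" "TR p \<Gamma> s S"
  shows "FR p \<Gamma> (A\<lbrakk>[t, s]\<rbrakk>)
    (\<lambda>w. \<exists>x. Q w x \<and> (\<exists>y. S w y \<and> frc A w (case_nat x (case_nat y p))))"
  unfolding plug_def eval_list.simps
proof (rule TR_D[OF assms(1) order_refl], rule TR_D[OF assms(2)], assumption, rule FR_ren)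
  fix \<Theta> \<Theta>' :: "(nat \<times> 'a) set" and l m x y d e
  assume "\<Theta> \<subseteq> \<Theta>'" "(l, x) \<in> \<Theta>" "(m, y) \<in> \<Theta>'" "\<forall>(l, x)\<in>\<Theta>'. l < d \<and> e l = x"
  then have "l < d" "m < d" "e l = x" "e m = y" by auto
  then show "(\<lambda>i. lenv d e p (if i < length [l, m] then d - Suc ([l, m] ! i) else d + (i - length [l, m]))) =
      case_nat x (case_nat y p)"
    by (auto simp: lenv_def fun_eq_iff split: nat.splits)
qed

text \<open>These rules compute meanings: after \<open>FR_cong\<close> the meaning is a schematic
  variable, which the rules fill in along the syntax of the formula, and the last goal compares the
  result with the intended condition.\<close>

lemmas FR_rules = FR_mem FR_eq FR_not FR_and FR_or FR_imp FR_iff FR_ball FR_bex FR_all FR_ex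
  FR_eval_in TR_desc TR_eval_in TR_var insertI1 insertI2

lemma FR_closed:
  assumes "FR p {} A P"
  shows "frc (closed A) w p = P w"
  using assms[unfolded FR_def, rule_format, of 0 p] by (simp add: closed_def lenv_def[abs_def])

text \<open>A universal quantifier followed by an implication passes to later worlds twice;
  persistence of the domains and transitivity merge the two passages.\<close>

lemma all_imp_simp:
  "(\<forall>v. w \<preceq> v \<longrightarrow> (\<forall>x\<in>D v. \<forall>u. v \<preceq> u \<longrightarrow> P x u)) \<longleftrightarrow> (\<forall>v. w \<preceq> v \<longrightarrow> (\<forall>x\<in>D v. P x v))"
  by (meson le_refl le_trans D_mono)

subsection \<open>Sets\<close>

text \<open>From here on: meanings of the terms for the empty set, successor, \<open>omega\<close>,
  unordered and ordered pair, product, and application to one and to two arguments. They are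
  relations with the value as last argument, since a term may have several values, equal up to
  \<open>eq\<close>. \<open>SCC\<close> and \<open>FN\<close> are meanings of predicates.\<close>

definition EM :: "'w \<Rightarrow> 'a \<Rightarrow> bool" where
  "EM w e \<longleftrightarrow> e \<in> D w \<and> (\<forall>v. w \<preceq> v \<longrightarrow> (\<forall>x. \<not> mem v x e))"

definition SC :: "'w \<Rightarrow> 'a \<Rightarrow> 'a \<Rightarrow> bool" where
  "SC w x s \<longleftrightarrow> s \<in> D w \<and> (\<forall>v. w \<preceq> v \<longrightarrow> (\<forall>z. mem v z s \<longleftrightarrow> mem v z x \<or> eq v z x))"

definition SCC :: "'w \<Rightarrow> 'a \<Rightarrow> bool" where
  "SCC w b \<longleftrightarrow> (\<exists>e. EM w e \<and> mem w e b) \<and>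
     (\<forall>v. w \<preceq> v \<longrightarrow> (\<forall>x. mem v x b \<longrightarrow> (\<exists>s. SC v x s \<and> mem v s b)))"

definition OM :: "'w \<Rightarrow> 'a \<Rightarrow> bool" where
  "OM w a \<longleftrightarrow> a \<in> D w \<and> SCC w a \<and>
     (\<forall>v. w \<preceq> v \<longrightarrow> (\<forall>b\<in>D v. SCC v b \<longrightarrow> (\<forall>x. mem v x a \<longrightarrow> mem v x b)))"

definition UP :: "'w \<Rightarrow> 'a \<Rightarrow> 'a \<Rightarrow> 'a \<Rightarrow> bool" where
  "UP w x y p \<longleftrightarrow> p \<in> D w \<and> (\<forall>v. w \<preceq> v \<longrightarrow> (\<forall>z. mem v z p \<longleftrightarrow> eq v z x \<or> eq v z y))"

definition PR :: "'w \<Rightarrow> 'a \<Rightarrow> 'a \<Rightarrow> 'a \<Rightarrow> bool" where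
  "PR w x y p \<longleftrightarrow> (\<exists>a b. UP w x x a \<and> UP w x y b \<and> UP w a b p)"

definition TM :: "'w \<Rightarrow> 'a \<Rightarrow> 'a \<Rightarrow> 'a \<Rightarrow> bool" where
  "TM w a b c \<longleftrightarrow> c \<in> D w \<and> (\<forall>v. w \<preceq> v \<longrightarrow> (\<forall>p. mem v p c \<longleftrightarrow>
     (\<exists>x. mem v x a \<and> (\<exists>y. mem v y b \<and> PR v x y p))))"

definition AP :: "'w \<Rightarrow> 'a \<Rightarrow> 'a \<Rightarrow> 'a \<Rightarrow> bool" where
  "AP w f x y \<longleftrightarrow> y \<in> D w \<and> (\<exists>p. PR w x y p \<and> mem w p f)"

definition A2 :: "'w \<Rightarrow> 'a \<Rightarrow> 'a \<Rightarrow> 'a \<Rightarrow> 'a \<Rightarrow> bool" where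
  "A2 w f x y z \<longleftrightarrow> (\<exists>q. PR w x y q \<and> AP w f q z)"

definition FN :: "'w \<Rightarrow> 'a \<Rightarrow> 'a \<Rightarrow> 'a \<Rightarrow> bool" where
  "FN w f a b \<longleftrightarrow> (\<forall>v. w \<preceq> v \<longrightarrow> (\<forall>p. mem v p f \<longrightarrow> (\<exists>x. mem v x a \<and> (\<exists>y. mem v y b \<and> PR v x y p)))) \<and>
     (\<forall>v. w \<preceq> v \<longrightarrow> (\<forall>x. mem v x a \<longrightarrow> (\<exists>y. AP v f x y \<and>
        (\<forall>u. v \<preceq> u \<longrightarrow> (\<forall>z. AP u f x z \<longrightarrow> eq u z y)))))"

definition FSUM where
  "FSUM w c ad ze n T s \<longleftrightarrow> s \<in> D w \<and> (\<exists>g\<in>D w. (\<exists>m. SC w n m \<and> FN w g m c) \<and>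
     (\<exists>y. (\<exists>e. EM w e \<and> AP w g e y) \<and> eq w y ze) \<and>
     (\<forall>v. w \<preceq> v \<longrightarrow> (\<forall>k. mem v k n \<longrightarrow> (\<exists>y. (\<exists>m. SC v k m \<and> AP v g m y) \<and>
        (\<exists>u. (\<exists>a. AP v g k a \<and> (\<exists>b. T k v b \<and> A2 v ad a b u)) \<and> eq v y u)))) \<and>
     (\<exists>y. AP w g n y \<and> eq w y s))"

lemma EM_mono: "EM v e \<Longrightarrow> v \<preceq> w \<Longrightarrow> EM w e"
  unfolding EM_def by (meson D_mono le_trans)

lemma SCC_mono: "SCC v b \<Longrightarrow> v \<preceq> w \<Longrightarrow> SCC w b"
  unfolding SCC_def by (meson EM_mono mem_mono le_trans)

lemma PR_cong_pair:
  assumes "PR w x y p" "eq w q p"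
  shows "PR w x y q"
proof -
  have "UP w a b q" if "UP w a b p" for a b
    using that assms(2) unfolding UP_def
    by (meson eq_D eq_mono eq_sym mem_cong mem_D eq_refl)
  then show ?thesis using assms(1) unfolding PR_def by blast
qed

lemma PR_D: "PR w x y p \<Longrightarrow> p \<in> D w"
  by (auto simp: PR_def UP_def)

lemma PR_eq_simp: "(\<exists>q. PR w x y q \<and> eq w p q) \<longleftrightarrow> PR w x y p"
  using PR_cong_pair PR_D eq_refl by blast

lemma TR_emp: "TR p \<Gamma> emp EM"
  unfolding emp_def
  by (rule TR_cong, (rule FR_rules)+) (auto simp: EM_def all_imp_simp dest: mem_D)

lemma TR_succ:
  assumes "TR p \<Gamma> t Q"
  shows "TR p \<Gamma> (succ t) (\<lambda>w s. \<exists>x. Q w x \<and> SC w x s)"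
  unfolding succ_def
  by (rule TR_cong, (rule FR_rules | rule assms)+)
    (simp add: SC_def all_imp_simp, meson mem_D eq_D)

lemma FR_successor_closed:
  assumes "TR p \<Gamma> b (\<lambda>w v. v = b')"
  shows "FR p \<Gamma> (successor_closed b) (\<lambda>w. SCC w b')"
  unfolding successor_closed_def
  by (rule FR_cong, (rule FR_rules TR_emp TR_succ | rule assms | rule TR_insert)+)
    (simp add: SCC_def)

lemma FR_is_omega:
  assumes "TR p \<Gamma> a (\<lambda>w v. v = a')"
  shows "FR p \<Gamma> (is_omega a) (\<lambda>w. SCC w a' \<and>
    (\<forall>v. w \<preceq> v \<longrightarrow> (\<forall>b\<in>D v. SCC v b \<longrightarrow> (\<forall>x. mem v x a' \<longrightarrow> mem v x b))))"
  unfolding is_omega_def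
  by (rule FR_cong, (rule FR_successor_closed FR_rules | rule assms | rule TR_insert)+)
    (simp add: all_imp_simp, meson SCC_mono le_refl le_trans D_mono)

lemma TR_omega: "TR p \<Gamma> omega OM"
  unfolding omega_def
  by (rule TR_cong, (rule FR_is_omega FR_rules)+) (simp add: OM_def)

lemma TR_upair:
  assumes "TR p \<Gamma> s S" "TR p \<Gamma> t Q"
  shows "TR p \<Gamma> (upair s t) (\<lambda>w q. \<exists>x. S w x \<and> (\<exists>y. Q w y \<and> UP w x y q))"
  unfolding upair_def
  by (rule TR_cong, (rule FR_rules | rule assms | rule TR_insert)+)
    (simp add: UP_def all_imp_simp, meson mem_D eq_D)

lemma TR_pair:
  assumes "TR p \<Gamma> s S" "TR p \<Gamma> t Q"
  shows "TR p \<Gamma> (pair s t) (\<lambda>w q. \<exists>x. S w x \<and> (\<exists>y. Q w y \<and> PR w x y q))"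
  unfolding pair_def
  by (rule TR_cong, (rule TR_upair FR_rules | rule assms | rule TR_insert)+)
    (auto simp: PR_def)

lemma TR_times:
  assumes "TR p \<Gamma> s S" "TR p \<Gamma> t Q"
  shows "TR p \<Gamma> (times s t) (\<lambda>w q. \<exists>x. S w x \<and> (\<exists>y. Q w y \<and> TM w x y q))"
  unfolding times_def
  by (rule TR_cong, (rule TR_pair FR_rules | rule assms | rule TR_insert)+)
    (simp add: TM_def PR_eq_simp all_imp_simp, meson PR_D mem_D)

lemma TR_app:
  assumes "TR p \<Gamma> f S" "TR p \<Gamma> t Q"
  shows "TR p \<Gamma> (app f t) (\<lambda>w y. \<exists>x. Q w x \<and> (\<exists>g. S w g \<and> AP w g x y))"
  unfolding app_def
  by (rule TR_cong, (rule TR_pair FR_rules | rule assms | rule TR_insert)+)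
    (simp add: AP_def, blast)

lemma TR_app_pair:
  assumes "TR p \<Gamma> f (\<lambda>w v. v = g)" "TR p \<Gamma> s S" "TR p \<Gamma> t Q"
  shows "TR p \<Gamma> (app f (pair s t)) (\<lambda>w z. \<exists>x. S w x \<and> (\<exists>y. Q w y \<and> A2 w g x y z))"
  by (rule TR_cong, (rule TR_app TR_pair | rule assms | rule TR_insert)+)
    (simp add: A2_def, blast)

lemma FR_is_fun:
  assumes "TR p \<Gamma> f (\<lambda>w v. v = g)" "TR p \<Gamma> s S" "TR p \<Gamma> t Q"
  shows "FR p \<Gamma> (is_fun f s t) (\<lambda>w. \<exists>a. S w a \<and> (\<exists>b. Q w b \<and> FN w g a b))"
  unfolding is_fun_def
  by (rule FR_cong, (rule TR_pair FR_rules | rule assms | rule TR_insert)+)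
    (simp add: PR_eq_simp all_imp_simp, simp add: FN_def AP_def Bex_def Ball_def conj_assoc imp_conjL)

lemma TR_fsum:
  assumes "TR p \<Gamma> c (\<lambda>w v. v = c')" "TR p \<Gamma> ad (\<lambda>w v. v = ad')" "TR p \<Gamma> z (\<lambda>w v. v = z')"
    "TR p \<Gamma> n (\<lambda>w v. v = n')" "\<And>l k. TR p (insert (l, k) \<Gamma>) (t (var l)) (T k)"
  shows "TR p \<Gamma> (fsum c ad z n t) (\<lambda>w s. FSUM w c' ad' z' n' T s)"
proof -
  have 5: "TR p (insert (l, k) (insert b (insert b' \<Gamma>))) (t (var l)) (T k)" for l k b b'
    by (rule TR_mono[OF assms(5)[of l k]]) blast
  show ?thesis
    unfolding fsum_def
    by (rule TR_cong, (rule FR_is_fun TR_app_pair TR_app TR_succ TR_emp 5 FR_rules | rule assms(1-4) | rule TR_insert)+)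
      (simp add: FSUM_def)
qed

end

section \<open>Set theory in Kripke models of CZF\<close>

context kripke
begin

definition ok :: "nat \<Rightarrow> (nat \<Rightarrow> 'a) \<Rightarrow> (nat \<times> 'a) set \<Rightarrow> bool" where
  "ok d e \<Gamma> \<longleftrightarrow> (\<forall>(l, x)\<in>\<Gamma>. l < d \<and> e l = x)"

lemma FR_I:
  assumes "ok d e \<Gamma>" "FR p \<Gamma> A P" "P w"
  shows "frc (A d) w (lenv d e p)"
  using assms FR_D[OF assms(2) assms(1)[unfolded ok_def]] by simp

lemma closed_E:
  assumes "frc (closed A) w p" "FR p {} A P" "P w \<Longrightarrow> thesis"
  shows thesis
  using assms FR_closed[OF assms(2)] by simp

lemma inst_all: "\<forall>v. w \<preceq> v \<longrightarrow> (\<forall>x\<in>D v. P x v) \<Longrightarrow> a \<in> D w \<Longrightarrow> P a w"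
  by simp

lemma inst_imp: "\<forall>v. w \<preceq> v \<longrightarrow> P v \<longrightarrow> Q v \<Longrightarrow> P w \<Longrightarrow> Q w"
  by simp

abbreviation params :: "'a list \<Rightarrow> (nat \<times> 'a) set" where
  "params cs \<equiv> set (zip [0..<length cs] cs)"

text \<open>Axioms are known to be forced only under environments with all values in the domain.
  Indices beyond the parameters therefore get the default \<open>hd cs\<close>, and parameter lists
  are required to be nonempty.\<close>

abbreviation penv :: "'a list \<Rightarrow> nat \<Rightarrow> 'a" where
  "penv cs \<equiv> lenv (length cs) ((!) cs) (\<lambda>_. hd cs)"

lemma penv_D: "set cs \<subseteq> D w \<Longrightarrow> cs \<noteq> [] \<Longrightarrow> penv cs i \<in> D w"
  by (auto simp: lenv_def)

lemma params_ok: "(l, x) \<in> params cs \<Longrightarrow> l < length cs \<and> cs ! l = x"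
  by (auto simp: in_set_zip)

lemma params1: "params [a] = {(0, a)}"
  by auto

text \<open>Bridge from formulas with HOL-bound variables to the de Bruijn formulas that instantiate
  axiom schemas: the parameters occupy the lowest levels, so the argument of the schema is the next
  level, which is index 0.\<close>

lemma definable1:
  assumes "\<And>p l x. FR p (insert (l, x) (params cs)) (\<Phi> (var l)) (\<phi> x)"
  shows "frc (\<Phi> (var (length cs)) (Suc (length cs))) w (case_nat x (penv cs)) = \<phi> x w"
  unfolding lenv_Suc
  by (rule FR_D[OF assms[of _ "length cs" x]]) (auto dest!: params_ok)

lemma definable2:
  assumes "\<And>p l m x y. FR p (insert (l, x) (insert (m, y) (params cs))) (\<Phi> (var l) (var m)) (\<phi> x y)"
  shows "frc (\<Phi> (var (Suc (length cs))) (var (length cs)) (Suc (Suc (length cs)))) w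
    (case_nat x (case_nat y (penv cs))) = \<phi> x y w"
  unfolding lenv_Suc
  by (rule FR_D[OF assms[of _ "Suc (length cs)" x "length cs" y]]) (auto dest!: params_ok)

end

locale czf = kripke +
  assumes czf_axiom: "A \<in> CZF \<union> DC \<Longrightarrow> \<forall>i. p i \<in> D w \<Longrightarrow> frc A w p"
begin

subsection \<open>The axioms\<close>

lemma extensionality:
  assumes "a \<in> D w" "b \<in> D w" "\<And>v x. w \<preceq> v \<Longrightarrow> mem v x a \<longleftrightarrow> mem v x b"
  shows "eq w a b"
proof -
  have "frc ax_extensionality w (\<lambda>_. a)" using assms(1) by (intro czf_axiom) (auto simp: CZF_def)
  then show ?thesis
    unfolding ax_extensionality_def
    apply (rule closed_E)
     apply (rule FR_rules)+
    apply (drule inst_all[OF _ assms(1)], drule inst_all[OF _ assms(2)])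
    apply simp
    apply (erule inst_imp)
    using assms(3) apply (meson le_trans)
    done
qed

lemma pairing:
  assumes "x \<in> D w" "y \<in> D w"
  shows "\<exists>p. UP w x y p"
proof -
  have "frc ax_pairing w (\<lambda>_. x)" using assms(1) by (intro czf_axiom) (auto simp: CZF_def)
  then show ?thesis
    unfolding ax_pairing_def
    apply (rule closed_E)
     apply (rule FR_rules)+
    apply (drule inst_all[OF _ assms(1)], drule inst_all[OF _ assms(2)])
    apply (simp add: UP_def all_imp_simp)
    apply (meson eq_D mem_D)
    done
qed

lemma union:
  assumes "a \<in> D w"
  obtains b where "b \<in> D w" "\<And>v x. w \<preceq> v \<Longrightarrow> mem v x b \<longleftrightarrow> (\<exists>y. mem v y a \<and> mem v x y)"
proof -
  have "frc ax_union w (\<lambda>_. a)" using assms(1) by (intro czf_axiom) (auto simp: CZF_def)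
  then have "\<exists>b\<in>D w. \<forall>v. w \<preceq> v \<longrightarrow> (\<forall>x\<in>D v. mem v x b \<longleftrightarrow> (\<exists>y. mem v y a \<and> mem v x y))"
    unfolding ax_union_def
    apply (rule closed_E)
     apply (rule FR_rules)+
    apply (drule inst_all[OF _ assms])
    apply (simp add: all_imp_simp)
    done
  then show ?thesis using that by (metis mem_D)
qed

text \<open>Stated for a de Bruijn formula, unlike the schemas below: boundedness is a syntactic
  condition, and eliminated descriptions contain unbounded quantifiers.\<close>

lemma separation:
  assumes "bounded_fm A" "a \<in> D w" "\<And>i. p i \<in> D w"
  shows "\<exists>b\<in>D w. \<forall>v x. w \<preceq> v \<longrightarrow> mem v x b \<longleftrightarrow> mem v x a \<and> frc A v (case_nat x p)"
proof -
  have "frc (ax_separation A) w p" using assms by (intro czf_axiom) (auto simp: CZF_def)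
  then have "\<exists>b\<in>D w. \<forall>v. w \<preceq> v \<longrightarrow> (\<forall>x\<in>D v. mem v x b \<longleftrightarrow> mem v x a \<and> frc A v (case_nat x p))"
    unfolding ax_separation_def
    apply (rule closed_E)
     apply (rule FR_plug1 FR_rules)+
    apply (drule inst_all[OF _ assms(2)])
    apply (simp add: all_imp_simp)
    done
  then show ?thesis by (meson mem_D)
qed

lemma strong_collection:
  assumes "\<And>p l m x y. FR p (insert (l, x) (insert (m, y) (params cs))) (\<Phi> (var l) (var m)) (\<phi> x y)"
    and "a \<in> D w" "set cs \<subseteq> D w" "cs \<noteq> []"
    and "\<And>v x. w \<preceq> v \<Longrightarrow> mem v x a \<Longrightarrow> \<exists>y\<in>D v. \<phi> x y v"
  obtains b where "b \<in> D w"
    "\<And>v x. w \<preceq> v \<Longrightarrow> mem v x a \<Longrightarrow> \<exists>y. mem v y b \<and> \<phi> x y v"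
    "\<And>v y. w \<preceq> v \<Longrightarrow> mem v y b \<Longrightarrow> \<exists>x. mem v x a \<and> \<phi> x y v"
proof -
  let ?A = "\<Phi> (var (Suc (length cs))) (var (length cs)) (Suc (Suc (length cs)))"
  have "frc (ax_strong_collection ?A) w (penv cs)"
    using penv_D[OF assms(3,4)] by (intro czf_axiom) (auto simp: CZF_def)
  then have "(\<forall>v. w \<preceq> v \<longrightarrow> (\<forall>x. mem v x a \<longrightarrow> (\<exists>y\<in>D v. \<phi> x y v))) \<longrightarrow>
      (\<exists>b\<in>D w. (\<forall>v. w \<preceq> v \<longrightarrow> (\<forall>x. mem v x a \<longrightarrow> (\<exists>y. mem v y b \<and> \<phi> x y v))) \<and>
        (\<forall>v. w \<preceq> v \<longrightarrow> (\<forall>y. mem v y b \<longrightarrow> (\<exists>x. mem v x a \<and> \<phi> x y v))))"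
    unfolding ax_strong_collection_def
    apply (rule closed_E)
     apply (rule FR_plug2 FR_rules)+
    apply (drule inst_all[OF _ assms(2)])
    apply (simp add: definable2[OF assms(1)])
    done
  then show ?thesis using that assms(5) by (elim impE bexE conjE) simp_all
qed

lemma set_induction:
  assumes "\<And>p l x. FR p (insert (l, x) (params cs)) (\<Phi> (var l)) (\<phi> x)"
    and "set cs \<subseteq> D w" "cs \<noteq> []"
    and "\<And>v a. w \<preceq> v \<Longrightarrow> a \<in> D v \<Longrightarrow> (\<And>u x. v \<preceq> u \<Longrightarrow> mem u x a \<Longrightarrow> \<phi> x u) \<Longrightarrow> \<phi> a v"
    and "w \<preceq> v" "a \<in> D v"
  shows "\<phi> a v"
proof -
  let ?A = "\<Phi> (var (length cs)) (Suc (length cs))"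
  have "frc (ax_set_induction ?A) w (penv cs)"
    using penv_D[OF assms(2,3)] by (intro czf_axiom) (auto simp: CZF_def)
  then have "(\<forall>v. w \<preceq> v \<longrightarrow> (\<forall>a\<in>D v. (\<forall>u. v \<preceq> u \<longrightarrow> (\<forall>x. mem u x a \<longrightarrow> \<phi> x u)) \<longrightarrow> \<phi> a v)) \<longrightarrow>
      (\<forall>v. w \<preceq> v \<longrightarrow> (\<forall>a\<in>D v. \<phi> a v))"
    unfolding ax_set_induction_def
    apply (rule closed_E)
     apply (rule FR_plug1 FR_rules)+
    apply (simp add: definable1[OF assms(1)] all_imp_simp)
    apply (rule impI)
    apply (erule inst_imp)
    apply assumption
    done
  then show ?thesis using assms(4-6) by blast
qed

subsection \<open>Pairs and functions\<close>

lemma SC_mono: "SC v x s \<Longrightarrow> v \<preceq> w \<Longrightarrow> SC w x s"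
  unfolding SC_def by (meson D_mono le_trans)

lemma UP_mono: "UP v x y p \<Longrightarrow> v \<preceq> w \<Longrightarrow> UP w x y p"
  unfolding UP_def by (meson D_mono le_trans)

lemma PR_mono: "PR v x y p \<Longrightarrow> v \<preceq> w \<Longrightarrow> PR w x y p"
  unfolding PR_def by (meson UP_mono)

lemma AP_mono: "AP v f x y \<Longrightarrow> v \<preceq> w \<Longrightarrow> AP w f x y"
  unfolding AP_def by (meson PR_mono mem_mono D_mono)

lemma A2_mono: "A2 v f x y z \<Longrightarrow> v \<preceq> w \<Longrightarrow> A2 w f x y z"
  unfolding A2_def by (meson PR_mono AP_mono)

lemma OM_mono: "OM v a \<Longrightarrow> v \<preceq> w \<Longrightarrow> OM w a"
  unfolding OM_def by (meson D_mono SCC_mono le_trans)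

lemma UP_cong:
  assumes "UP w x y p" "eq w x x'" "eq w y y'"
  shows "UP w x' y' p"
  using assms unfolding UP_def by (meson eq_mono eq_sym eq_trans)

lemma UP_unique: "UP w x y p \<Longrightarrow> UP w x y q \<Longrightarrow> eq w p q"
  unfolding UP_def by (rule extensionality) auto

lemma UP_mem: "UP w x y p \<Longrightarrow> mem w z p \<longleftrightarrow> eq w z x \<or> eq w z y"
  unfolding UP_def by blast

lemma PR_ex:
  assumes "x \<in> D w" "y \<in> D w"
  shows "\<exists>p. PR w x y p"
proof -
  obtain a b where ab: "UP w x x a" "UP w x y b" using pairing assms by metis
  then obtain p where "UP w a b p" using pairing[of a w b] unfolding UP_def by metis
  then show ?thesis using ab unfolding PR_def by blast
qed

lemma PR_cong:
  assumes "PR w x y p" "eq w x x'" "eq w y y'"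
  shows "PR w x' y' p"
  using assms UP_cong unfolding PR_def by metis

lemma PR_unique:
  assumes "PR w x y p" "PR w x y q"
  shows "eq w p q"
proof -
  obtain a b c d where *: "UP w x x a" "UP w x y b" "UP w a b p" "UP w x x c" "UP w x y d" "UP w c d q"
    using assms unfolding PR_def by metis
  then have "UP w a b q" by (metis UP_unique UP_cong)
  then show ?thesis using * UP_unique by metis
qed

text \<open>Kuratowski pairs. Only disjunctions forced at \<open>w\<close> itself are split, so the
  usual comparison of \<open>{x}\<close> and \<open>{x, y}\<close> goes through at a single
  world.\<close>

lemma PR_inj:
  assumes "PR w x y p" "PR w x' y' p" and D: "x \<in> D w" "y \<in> D w" "x' \<in> D w" "y' \<in> D w"
  shows "eq w x x' \<and> eq w y y'"
proof -
  obtain a b a' b' where *: "UP w x x a" "UP w x y b" "UP w a b p"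
      "UP w x' x' a'" "UP w x' y' b'" "UP w a' b' p"
    using assms unfolding PR_def by metis
  have Da: "a \<in> D w" "b \<in> D w" "a' \<in> D w" "b' \<in> D w" using * by (auto simp: UP_def)
  have m: "\<And>z. mem w z a \<longleftrightarrow> eq w z x" "\<And>z. mem w z b \<longleftrightarrow> eq w z x \<or> eq w z y"
      "\<And>z. mem w z a' \<longleftrightarrow> eq w z x'" "\<And>z. mem w z b' \<longleftrightarrow> eq w z x' \<or> eq w z y'"
    using *(1,2,4,5) UP_mem by blast+
  have mc: "\<And>z s t. eq w s t \<Longrightarrow> mem w z s \<longleftrightarrow> mem w z t"
    by (meson eq_refl mem_D mem_cong eq_sym)
  have "mem w a p" "mem w b p" "mem w b' p"
    using UP_mem[OF *(3)] UP_mem[OF *(6)] Da eq_refl by blast+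
  then have c: "eq w a a' \<or> eq w a b'" "eq w b a' \<or> eq w b b'" "eq w b' a \<or> eq w b' b"
    using UP_mem[OF *(3)] UP_mem[OF *(6)] by blast+
  have xx: "eq w x' x" using c(1) mc m eq_refl[OF D(3)] by metis
  have y: "eq w y x' \<or> eq w y y'" using c(2) mc m eq_refl[OF D(2)] by metis
  have y': "eq w y' x \<or> eq w y' y" using c(3) mc m eq_refl[OF D(4)] by metis
  show ?thesis
  proof (cases "eq w y y'")
    case False
    then have "eq w y x'" "eq w y' x" using y y' eq_sym by blast+
    then show ?thesis using xx eq_sym eq_trans by meson
  qed (use xx eq_sym in blast)
qed

lemma AP_D: "AP w f x y \<Longrightarrow> y \<in> D w \<and> f \<in> D w"
  by (auto simp: AP_def dest: mem_D)

lemma AP_cong: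
  assumes "AP w f x y" "eq w x x'" "eq w y y'"
  shows "AP w f x' y'"
  using assms unfolding AP_def by (meson PR_cong eq_D)

lemma A2_D: "A2 w f x y z \<Longrightarrow> z \<in> D w"
  by (auto simp: A2_def dest: AP_D)

lemma A2_cong:
  assumes "A2 w f x y z" "eq w x x'" "eq w y y'" "eq w z z'"
  shows "A2 w f x' y' z'"
  using assms unfolding A2_def by (meson PR_cong AP_cong PR_D eq_refl)

lemma FN_unique:
  assumes "FN w f a b" "w \<preceq> v" "mem v x a" "AP v f x y" "AP v f x z"
  shows "eq v y z"
proof -
  obtain y0 where "\<forall>u. v \<preceq> u \<longrightarrow> (\<forall>z. AP u f x z \<longrightarrow> eq u z y0)"
    using assms(1-3) unfolding FN_def by blast
  then show ?thesis using assms(4,5) by (meson eq_sym eq_trans le_refl)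
qed

lemma FN_range:
  assumes "FN w f a b" "w \<preceq> v" "x \<in> D v" "AP v f x y"
  shows "mem v x a \<and> mem v y b"
proof -
  obtain p where p: "PR v x y p" "mem v p f" using assms(4) by (auto simp: AP_def)
  then obtain x' y' where *: "mem v x' a" "mem v y' b" "PR v x' y' p"
    using assms(1,2) unfolding FN_def by blast
  then have "eq v x' x \<and> eq v y' y"
    using PR_inj[OF *(3) p(1)] assms(3,4) by (auto dest: AP_D mem_D)
  then show ?thesis using * by (meson mem_cong mem_D eq_refl)
qed

lemma FN_ex:
  assumes "FN w f a b" "w \<preceq> v" "mem v x a"
  shows "\<exists>y. AP v f x y \<and> mem v y b"
proof -
  obtain y where "AP v f x y" using assms unfolding FN_def by blast
  then show ?thesis using FN_range[OF assms(1,2)] assms(3) by (meson mem_D)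
qed

text \<open>For a set \<open>f\<close> that is exactly the graph of \<phi>. Persistence of \<phi>
  enters because \<open>FN\<close> asks for uniqueness of the value at all later worlds.\<close>

lemma FN_I:
  assumes "\<And>v p. w \<preceq> v \<Longrightarrow> mem v p f \<longleftrightarrow> (\<exists>x y. mem v x a \<and> \<phi> v x y \<and> PR v x y p)" "f \<in> D w"
    and "\<And>v x y. w \<preceq> v \<Longrightarrow> mem v x a \<Longrightarrow> \<phi> v x y \<Longrightarrow> mem v y b"
    and "\<And>v x. w \<preceq> v \<Longrightarrow> mem v x a \<Longrightarrow> \<exists>y. \<phi> v x y"
    and "\<And>v x x' y y'. w \<preceq> v \<Longrightarrow> mem v x a \<Longrightarrow> mem v x' a \<Longrightarrow> eq v x x' \<Longrightarrow> \<phi> v x y \<Longrightarrow> \<phi> v x' y' \<Longrightarrow> eq v y y'"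
    and "\<And>v u x y. w \<preceq> v \<Longrightarrow> v \<preceq> u \<Longrightarrow> mem v x a \<Longrightarrow> \<phi> v x y \<Longrightarrow> \<phi> u x y"
  shows "FN w f a b"
    and "\<And>v x y. w \<preceq> v \<Longrightarrow> mem v x a \<Longrightarrow> \<phi> v x y \<Longrightarrow> AP v f x y"
proof -
  show ap: "AP v f x y" if "w \<preceq> v" "mem v x a" "\<phi> v x y" for v x y
  proof -
    have "mem v y b" using assms(3) that by blast
    then have D: "x \<in> D v" "y \<in> D v" using that mem_D by blast+
    then obtain p where "PR v x y p" using PR_ex by blast
    then show ?thesis using assms(1)[OF that(1)] that D unfolding AP_def by blast
  qed
  show "FN w f a b"
    unfolding FN_def
  proof (intro conjI allI impI)
    fix v p assume "w \<preceq> v" "mem v p f"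
    then obtain x y where "mem v x a" "\<phi> v x y" "PR v x y p" using assms(1) by blast
    then show "\<exists>x. mem v x a \<and> (\<exists>y. mem v y b \<and> PR v x y p)"
      using assms(3)[OF \<open>w \<preceq> v\<close>] by blast
  next
    fix v x assume v: "w \<preceq> v" "mem v x a"
    then obtain y where y: "\<phi> v x y" using assms(4) by blast
    have "eq u z y" if u: "v \<preceq> u" "AP u f x z" for u z
    proof -
      have wu: "w \<preceq> u" using v u le_trans by blast
      obtain p where p: "PR u x z p" "mem u p f" using u(2) by (auto simp: AP_def)
      then obtain x' z' where *: "mem u x' a" "\<phi> u x' z'" "PR u x' z' p"
        using assms(1)[OF wu] by blast
      have mx: "mem u x a" using v u mem_mono by blast
      have "eq u x x' \<and> eq u z z'"
        using PR_inj[OF p(1) *(3)] mem_D[OF mx] AP_D[OF u(2)] mem_D[OF *(1)]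
          mem_D[OF assms(3)[OF wu *(1,2)]] by blast
      moreover have "\<phi> u x y" using assms(6) v u y by blast
      ultimately show ?thesis using assms(5)[OF wu mx *(1)] * by (meson eq_sym eq_trans)
    qed
    then show "\<exists>y. AP v f x y \<and> (\<forall>u. v \<preceq> u \<longrightarrow> (\<forall>z. AP u f x z \<longrightarrow> eq u z y))"
      using ap[OF v y] by blast
  qed
qed

lemma TM_mem:
  assumes "TM w a b c" "w \<preceq> v" "PR v x y q" "mem v x a" "mem v y b"
  shows "mem v q c"
  using assms unfolding TM_def by blast

lemma A2_ex:
  assumes "TM w a b c" "FN w f c d" "w \<preceq> v" "mem v x a" "mem v y b"
  shows "\<exists>z. A2 v f x y z \<and> mem v z d"
proof -
  obtain q where q: "PR v x y q" using PR_ex assms(4,5) mem_D by blast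
  then have "mem v q c" using TM_mem assms by blast
  then show ?thesis using FN_ex[OF assms(2,3)] q unfolding A2_def by blast
qed

lemma A2_unique:
  assumes "TM w a b c" "FN w f c d" "w \<preceq> v" "mem v x a" "mem v y b" "A2 v f x y z" "A2 v f x y z'"
  shows "eq v z z'"
proof -
  obtain q q' where q: "PR v x y q" "AP v f q z" "PR v x y q'" "AP v f q' z'"
    using assms(6,7) unfolding A2_def by blast
  then have "AP v f q z'" using AP_cong[OF q(4) PR_unique[OF q(3,1)]] AP_D eq_refl by blast
  then show ?thesis using FN_unique[OF assms(2,3) TM_mem[OF assms(1,3) q(1) assms(4,5)] q(2)] by blast
qed

subsection \<open>Existence of sets\<close>

text \<open>The slice \<open>{x} \<times> b\<close>. Collection provides some pair for every
  \<open>y\<close>, and as ordered pairs are unique up to \<open>eq\<close>, the collected set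
  contains all of them.\<close>

lemma image_pairs:
  assumes "x \<in> D w" "b \<in> D w"
  obtains c where "c \<in> D w" "\<And>v p. w \<preceq> v \<Longrightarrow> mem v p c \<longleftrightarrow> (\<exists>y. mem v y b \<and> PR v x y p)"
proof -
  let ?\<Phi> = "\<lambda>y p. p \<^bold>= pair (var 0) y"
  have "FR p (insert (l, y) (insert (m, q) (params [x]))) (?\<Phi> (var l) (var m)) (\<lambda>v. PR v x y q)" for p l m y q
    unfolding params1 by (rule FR_cong, (rule TR_pair FR_rules)+) (simp add: PR_eq_simp)
  then obtain c where c: "c \<in> D w" "\<And>v y. w \<preceq> v \<Longrightarrow> mem v y b \<Longrightarrow> \<exists>p. mem v p c \<and> PR v x y p"
    "\<And>v p. w \<preceq> v \<Longrightarrow> mem v p c \<Longrightarrow> \<exists>y. mem v y b \<and> PR v x y p"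
  proof (rule strong_collection[where w = w and a = b])
    fix v y assume "w \<preceq> v" "mem v y b"
    then show "\<exists>p\<in>D v. PR v x y p" using PR_ex[of x v y] assms D_mono mem_D PR_D by blast
  qed (use assms in auto)
  show thesis
  proof (rule that[OF c(1)])
    fix v p assume v: "w \<preceq> v"
    show "mem v p c \<longleftrightarrow> (\<exists>y. mem v y b \<and> PR v x y p)"
    proof
      assume "\<exists>y. mem v y b \<and> PR v x y p"
      then obtain y where y: "mem v y b" "PR v x y p" by blast
      then obtain q where "mem v q c" "PR v x y q" using c(2) v by blast
      then show "mem v p c" using y PR_unique by (meson mem_cong mem_D eq_refl)
    qed (use c(3) v in blast)
  qed
qed

end

context czf
begin

text \<open>CZF has no power set from which the product could be separated; it is the union of a
  collected set of slices.\<close>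

lemma times_ex:
  assumes "a \<in> D w" "b \<in> D w"
  shows "\<exists>c. TM w a b c"
proof -
  let ?\<phi> = "\<lambda>x c v. \<forall>u. v \<preceq> u \<longrightarrow> (\<forall>p. mem u p c \<longleftrightarrow> (\<exists>y. mem u y b \<and> PR u x y p))"
  have "FR p (insert (l, x) (insert (m, c) (params [b])))
      (\<^bold>\<forall>q. q \<^bold>\<in> var m \<^bold>\<longleftrightarrow> (\<^bold>\<exists>y\<^bold>\<in>var 0. q \<^bold>= pair (var l) y)) (?\<phi> x c)" for p l m x c
    unfolding params1
    by (rule FR_cong, (rule TR_pair FR_rules)+)
      (simp add: PR_eq_simp all_imp_simp, meson PR_D mem_D)
  then obtain B where B: "B \<in> D w" "\<And>v x. w \<preceq> v \<Longrightarrow> mem v x a \<Longrightarrow> \<exists>c. mem v c B \<and> ?\<phi> x c v"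
    "\<And>v c. w \<preceq> v \<Longrightarrow> mem v c B \<Longrightarrow> \<exists>x. mem v x a \<and> ?\<phi> x c v"
  proof (rule strong_collection[where w = w and a = a])
    fix v x assume v: "w \<preceq> v" "mem v x a"
    then obtain c where c: "c \<in> D v" "\<And>u p. v \<preceq> u \<Longrightarrow> mem u p c \<longleftrightarrow> (\<exists>y. mem u y b \<and> PR u x y p)"
      using image_pairs[of x v b] mem_D D_mono assms(2) by metis
    then show "\<exists>c\<in>D v. ?\<phi> x c v" by blast
  qed (use assms in auto)
  obtain c where c: "c \<in> D w" "\<And>v p. w \<preceq> v \<Longrightarrow> mem v p c \<longleftrightarrow> (\<exists>d. mem v d B \<and> mem v p d)"
    using union[OF B(1)] by blast
  have "mem v p c \<longleftrightarrow> (\<exists>x. mem v x a \<and> (\<exists>y. mem v y b \<and> PR v x y p))" if v: "w \<preceq> v" for v p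
  proof
    assume "mem v p c"
    then obtain d where d: "mem v d B" "mem v p d" using c(2)[OF v] by blast
    then obtain x where x: "mem v x a" "?\<phi> x d v" using B(3)[OF v] by blast
    then show "\<exists>x. mem v x a \<and> (\<exists>y. mem v y b \<and> PR v x y p)" using d(2) le_refl by blast
  next
    assume "\<exists>x. mem v x a \<and> (\<exists>y. mem v y b \<and> PR v x y p)"
    then obtain x y where xy: "mem v x a" "mem v y b" "PR v x y p" by blast
    then obtain d where d: "mem v d B" "?\<phi> x d v" using B(2)[OF v] by blast
    then have "mem v p d" using xy le_refl by blast
    then show "mem v p c" using c(2)[OF v] d(1) by blast
  qed
  then show ?thesis using c(1) unfolding TM_def by blast
qed

text \<open>The property need not be bounded, so the graph is collected, not separated: each
  \<open>x\<close> yields the pair of \<open>x\<close> and its value, and the second half of strong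
  collection excludes other elements.\<close>

lemma function_ex:
  assumes def: "\<And>p l m x y. FR p (insert (l, x) (insert (m, y) (params cs))) (\<Phi> (var l) (var m)) (\<phi> x y)"
    and D: "a \<in> D w" "set cs \<subseteq> D w" "cs \<noteq> []"
    and range: "\<And>v x y. w \<preceq> v \<Longrightarrow> mem v x a \<Longrightarrow> \<phi> x y v \<Longrightarrow> mem v y b"
    and total: "\<And>v x. w \<preceq> v \<Longrightarrow> mem v x a \<Longrightarrow> \<exists>y. \<phi> x y v"
    and functional: "\<And>v x x' y y'. w \<preceq> v \<Longrightarrow> mem v x a \<Longrightarrow> mem v x' a \<Longrightarrow> eq v x x' \<Longrightarrow>
      \<phi> x y v \<Longrightarrow> \<phi> x' y' v \<Longrightarrow> eq v y y'"
    and mono: "\<And>v u x y. w \<preceq> v \<Longrightarrow> v \<preceq> u \<Longrightarrow> mem v x a \<Longrightarrow> \<phi> x y v \<Longrightarrow> \<phi> x y u"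
  shows "\<exists>f\<in>D w. FN w f a b \<and> (\<forall>v x y. w \<preceq> v \<longrightarrow> mem v x a \<longrightarrow> \<phi> x y v \<longrightarrow> AP v f x y)"
proof -
  have "FR p (insert (l, x) (insert (m, q) (params cs))) (\<^bold>\<exists>y. \<Phi> (var l) y \<^bold>\<and> var m \<^bold>= pair (var l) y)
      (\<lambda>v. \<exists>y\<in>D v. \<phi> x y v \<and> PR v x y q)" for p l m x q
  proof -
    have 1: "FR p (insert (k, y) (insert (l, x) (insert (m, q) (params cs)))) (\<Phi> (var l) (var k)) (\<phi> x y)"
      for k y by (rule FR_mono[OF def[of _ l x k y]]) blast
    show ?thesis
      by (rule FR_cong, (rule 1 TR_pair FR_rules)+) (simp add: PR_eq_simp)
  qed
  then obtain f where f: "f \<in> D w"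
    "\<And>v x. w \<preceq> v \<Longrightarrow> mem v x a \<Longrightarrow> \<exists>q. mem v q f \<and> (\<exists>y\<in>D v. \<phi> x y v \<and> PR v x y q)"
    "\<And>v q. w \<preceq> v \<Longrightarrow> mem v q f \<Longrightarrow> \<exists>x. mem v x a \<and> (\<exists>y\<in>D v. \<phi> x y v \<and> PR v x y q)"
  proof (rule strong_collection[where w = w and a = a])
    fix v x assume v: "w \<preceq> v" "mem v x a"
    then obtain y where y: "\<phi> x y v" using total by blast
    then have "x \<in> D v" "y \<in> D v" using range v mem_D by blast+
    then show "\<exists>q\<in>D v. \<exists>y\<in>D v. \<phi> x y v \<and> PR v x y q" using PR_ex y PR_D by blast
  qed (use D in auto)
  have g: "mem v p f \<longleftrightarrow> (\<exists>x y. mem v x a \<and> \<phi> x y v \<and> PR v x y p)" if v: "w \<preceq> v" for v p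
  proof
    assume "\<exists>x y. mem v x a \<and> \<phi> x y v \<and> PR v x y p"
    then obtain x y where xy: "mem v x a" "\<phi> x y v" "PR v x y p" by blast
    then obtain q y' where q: "mem v q f" "\<phi> x y' v" "PR v x y' q" using f(2)[OF v] by blast
    have x: "eq v x x" using xy mem_D eq_refl by blast
    then have "eq v y' y" using functional[OF v] xy q by blast
    then have "eq v q p" using PR_unique[OF PR_cong[OF q(3) x] xy(3)] by blast
    then show "mem v p f" using q(1) by (meson mem_cong mem_D eq_refl)
  qed (use f(3) v in blast)
  show ?thesis
  proof (intro bexI[OF _ f(1)] conjI allI impI)
    show "FN w f a b"
      by (rule FN_I(1)[where \<phi> = "\<lambda>v x y. \<phi> x y v"]) (fact g f(1) range total functional mono)+
    show "AP v f x y" if h: "w \<preceq> v" "mem v x a" "\<phi> x y v" for v x y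
      by (rule FN_I(2)[where \<phi> = "\<lambda>v x y. \<phi> x y v"]) (fact g f(1) range total functional mono h)+
  qed
qed

subsection \<open>Natural numbers\<close>

lemma EM_unique: "EM w e \<Longrightarrow> EM w e' \<Longrightarrow> eq w e e'"
  unfolding EM_def by (rule extensionality) auto

lemma SC_unique: "SC w x s \<Longrightarrow> SC w x s' \<Longrightarrow> eq w s s'"
  unfolding SC_def by (rule extensionality) auto

lemma EM_cong: "EM w e \<Longrightarrow> eq w e e' \<Longrightarrow> EM w e'"
  unfolding EM_def by (meson eq_D eq_mono eq_sym mem_cong mem_D eq_refl)

lemma succ_ex:
  assumes "x \<in> D w"
  shows "\<exists>s. SC w x s"
proof -
  obtain p where p: "UP w x x p" using pairing assms by blast
  then have "p \<in> D w" by (simp add: UP_def)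
  then obtain q where q: "UP w x p q" using pairing assms by blast
  then have "q \<in> D w" by (simp add: UP_def)
  then obtain s where s: "s \<in> D w" "\<And>v z. w \<preceq> v \<Longrightarrow> mem v z s \<longleftrightarrow> (\<exists>y. mem v y q \<and> mem v z y)"
    using union by metis
  have "mem v z s \<longleftrightarrow> mem v z x \<or> eq v z x" if v: "w \<preceq> v" for v z
  proof -
    have "\<And>y. mem v y q \<longleftrightarrow> eq v y x \<or> eq v y p" "\<And>y. mem v y p \<longleftrightarrow> eq v y x"
      using p q v unfolding UP_def by blast+
    moreover have "eq v x x" "eq v p p" using assms \<open>p \<in> D w\<close> v D_mono eq_refl by blast+
    moreover have "mem v z y \<longleftrightarrow> mem v z t" if "eq v y t" for y t
      using that by (meson mem_cong mem_D eq_refl eq_sym)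
    ultimately show ?thesis using s(2)[OF v] by metis
  qed
  then show ?thesis using s(1) unfolding SC_def by blast
qed

lemma OM_empty:
  assumes "OM w om" "EM w e"
  shows "mem w e om"
proof -
  obtain e' where "EM w e'" "mem w e' om" using assms(1) unfolding OM_def SCC_def by blast
  then show ?thesis using EM_unique[OF _ assms(2)] by (meson mem_cong mem_D eq_refl)
qed

lemma OM_succ:
  assumes "OM w om" "w \<preceq> v" "mem v x om" "SC v x s"
  shows "mem v s om"
proof -
  obtain s' where "SC v x s'" "mem v s' om" using assms(1-3) unfolding OM_def SCC_def by blast
  then show ?thesis using SC_unique[OF _ assms(4)] by (meson mem_cong mem_D eq_refl)
qed

text \<open>The numbers that are zero or a successor form a successor-closed set, and
  \<open>omega\<close> is contained in every such set. This set comes from bounded separation, which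
  dictates the formula below.\<close>

lemma omega_cases:
  assumes om: "OM w om" and v: "w \<preceq> v" "mem v m om"
  shows "EM v m \<or> (\<exists>k. mem v k om \<and> SC v k m)"
proof -
  obtain e where e: "EM w e" "mem w e om" using om unfolding OM_def SCC_def by blast
  \<comment> \<open>Index 0 is the number, 1 the empty set and 2 \<open>omega\<close>. The formula
    says that the number is empty or is \<open>k \<union> {k}\<close> for some \<open>k\<close> in
    \<open>omega\<close>; writing out the equality of sets by two inclusions keeps it
    bounded.\<close>
  let ?A = "Or (Eq 0 1) (Ex (And (Mem 0 (Suc 2)) (And (Mem 0 1)
    (And (All (Imp (Mem 0 (Suc 1)) (Or (Mem 0 1) (Eq 0 1)))) (All (Imp (Mem 0 (Suc 0)) (Mem 0 2)))))))"
  let ?\<psi> = "\<lambda>v k x. mem v k om \<and> mem v k x \<and>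
    (\<forall>u. v \<preceq> u \<longrightarrow> (\<forall>z. mem u z x \<longrightarrow> mem u z k \<or> eq u z k)) \<and>
    (\<forall>u. v \<preceq> u \<longrightarrow> (\<forall>z. mem u z k \<longrightarrow> mem u z x))"
  have b: "bounded_fm ?A"
  proof -
    have "bounded_fm (Ex (And (Mem 0 (Suc 2)) (And (Mem 0 1)
      (And (All (Imp (Mem 0 (Suc 1)) (Or (Mem 0 1) (Eq 0 1)))) (All (Imp (Mem 0 (Suc 0)) (Mem 0 2)))))))"
      by (rule bounded_fm.intros)+
    then show ?thesis by (intro bounded_fm.intros(5) bounded_fm.intros(2))
  qed
  have f: "frc ?A v (case_nat x (case_nat e (\<lambda>_. om))) \<longleftrightarrow> eq v x e \<or> (\<exists>k. ?\<psi> v k x)" for v x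
  proof -
    have "frc ?A v (case_nat x (case_nat e (\<lambda>_. om))) \<longleftrightarrow> eq v x e \<or> (\<exists>k\<in>D v. mem v k om \<and> mem v k x \<and>
      (\<forall>u. v \<preceq> u \<longrightarrow> (\<forall>z\<in>D u. \<forall>t. u \<preceq> t \<longrightarrow> mem t z x \<longrightarrow> mem t z k \<or> eq t z k)) \<and>
      (\<forall>u. v \<preceq> u \<longrightarrow> (\<forall>z\<in>D u. \<forall>t. u \<preceq> t \<longrightarrow> mem t z k \<longrightarrow> mem t z x)))"
      by (simp add: eval_nat_numeral)
    then show ?thesis unfolding all_imp_simp by (meson mem_D)
  qed
  have De: "e \<in> D w" "om \<in> D w" using e mem_D by blast+
  then have De': "case_nat e (\<lambda>_. om) i \<in> D w" for i by (cases i) auto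
  obtain b where b0: "b \<in> D w"
      "\<forall>v x. w \<preceq> v \<longrightarrow> mem v x b \<longleftrightarrow> mem v x om \<and> frc ?A v (case_nat x (case_nat e (\<lambda>_. om)))"
    using separation[where p = "case_nat e (\<lambda>_. om)", OF b De(2) De'] by (elim bexE)
  have b: "b \<in> D w" "\<And>v x. w \<preceq> v \<Longrightarrow> mem v x b \<longleftrightarrow> mem v x om \<and> (eq v x e \<or> (\<exists>k. ?\<psi> v k x))"
    by (rule b0(1)) (simp only: b0(2)[rule_format] f)
  have "SCC w b"
    unfolding SCC_def
  proof (intro conjI allI impI)
    show "\<exists>e. EM w e \<and> mem w e b" using e b(2)[of w e] De eq_refl by blast
    fix v x assume v: "w \<preceq> v" "mem v x b"
    then have x: "mem v x om" using b(2) by blast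
    then obtain s where s: "SC v x s" using succ_ex mem_D by blast
    then have so: "mem v s om" using OM_succ[OF om v(1) x] by blast
    have sx: "mem u z s \<longleftrightarrow> mem u z x \<or> eq u z x" if "v \<preceq> u" for u z
      using s that unfolding SC_def by blast
    have "mem v x s" using sx[of v x] x mem_D eq_refl by blast
    then have "?\<psi> v x s" using x sx by blast
    then show "\<exists>s. SC v x s \<and> mem v s b" using s so b(2)[OF v(1)] by blast
  qed
  then have "SCC v b" "b \<in> D v" using SCC_mono D_mono v(1) b(1) by metis+
  then have "mem v m b" using om v unfolding OM_def by simp
  then have "eq v m e \<or> (\<exists>k. ?\<psi> v k m)" by (simp only: b(2)[OF v(1)])
  then show ?thesis
  proof (elim disjE exE)
    assume "eq v m e"
    then show ?thesis using EM_cong[OF EM_mono[OF e(1) v(1)] eq_sym] by simp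
  next
    fix k assume k: "?\<psi> v k m"
    have "mem u z m \<longleftrightarrow> mem u z k \<or> eq u z k" if u: "v \<preceq> u" for u z
    proof -
      have "mem u k m" using k mem_mono[OF u] by simp
      then have "mem u z m" if "eq u z k" using that by (meson mem_cong mem_D eq_refl eq_sym)
      then show ?thesis using k u by metis
    qed
    then have "SC v k m" unfolding SC_def using mem_D[OF v(2)] by simp
    then show ?thesis using k by metis
  qed
qed

text \<open>Minimality of \<open>omega\<close> gives induction only for sets. Induction for
  arbitrary formulas comes from set induction, since by \<open>omega_cases\<close> a number is empty
  or contains its predecessor.\<close>

lemma omega_induct:
  assumes def: "\<And>p l x. FR p (insert (l, x) (params (om # cs))) (\<Phi> (var l)) (\<phi> x)"
    and om: "OM w om" "set cs \<subseteq> D w"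
    and base: "\<And>v e. w \<preceq> v \<Longrightarrow> EM v e \<Longrightarrow> \<phi> e v"
    and step: "\<And>v k s. w \<preceq> v \<Longrightarrow> mem v k om \<Longrightarrow> \<phi> k v \<Longrightarrow> SC v k s \<Longrightarrow> \<phi> s v"
    and v: "w \<preceq> v" "mem v m om"
  shows "\<phi> m v"
proof -
  have "FR p (insert (l, x) (params (om # cs))) (var l \<^bold>\<in> var 0 \<^bold>\<longrightarrow> \<Phi> (var l))
      (\<lambda>v. \<forall>u. v \<preceq> u \<longrightarrow> mem u x om \<longrightarrow> \<phi> x u)" for p l x
  proof -
    have 0: "TR p (insert (l, x) (params (om # cs))) (var 0) (\<lambda>w v. v = om)"
      by (rule TR_var) (simp add: upt_rec)
    show ?thesis by (rule FR_cong, (rule 0 def FR_rules)+) simp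
  qed
  then have "\<forall>u. v \<preceq> u \<longrightarrow> mem u m om \<longrightarrow> \<phi> m u"
  proof (rule set_induction[where w = w and v = v and a = m])
    fix v a assume v: "w \<preceq> v" "a \<in> D v"
      and IH: "\<And>u x. v \<preceq> u \<Longrightarrow> mem u x a \<Longrightarrow> \<forall>t. u \<preceq> t \<longrightarrow> mem t x om \<longrightarrow> \<phi> x t"
    show "\<forall>u. v \<preceq> u \<longrightarrow> mem u a om \<longrightarrow> \<phi> a u"
    proof (intro allI impI)
      fix u assume u: "v \<preceq> u" "mem u a om"
      have wu: "w \<preceq> u" using v u le_trans by blast
      consider "EM u a" | k where "mem u k om" "SC u k a" using omega_cases[OF om(1) wu u(2)] by blast
      then show "\<phi> a u"
      proof cases
        case 1
        then show ?thesis using base wu by blast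
      next
        case 2
        then have "mem u k a" unfolding SC_def by (meson mem_D eq_refl le_refl)
        then have "\<phi> k u" using IH u 2 by blast
        then show ?thesis using step wu 2 by blast
      qed
    qed
  next
    show "set (om # cs) \<subseteq> D w" using om by (simp add: OM_def)
    show "m \<in> D v" using mem_D[OF v(2)] by simp
  qed (use v in simp_all)
  then show ?thesis using v by simp
qed

end

section \<open>Constructive ordered fields\<close>

text \<open>Modelled on real numbers modulo \<open>eq\<close> at one world, so equality is that of
  HOL. The order is not assumed linear; cotransitivity takes the place of comparison.\<close>

locale oring =
  fixes K :: "'c set"
    and pl :: "'c \<Rightarrow> 'c \<Rightarrow> 'c" (infixl "\<oplus>" 65)
    and ti :: "'c \<Rightarrow> 'c \<Rightarrow> 'c" (infixl "\<otimes>" 70)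
    and zr :: 'c ("\<zero>")
    and un :: 'c ("\<one>")
    and lt :: "'c \<Rightarrow> 'c \<Rightarrow> bool" (infix "\<sqsubset>" 50)
  assumes closed [simp]: "a \<in> K \<Longrightarrow> b \<in> K \<Longrightarrow> a \<oplus> b \<in> K" "a \<in> K \<Longrightarrow> b \<in> K \<Longrightarrow> a \<otimes> b \<in> K" "\<zero> \<in> K" "\<one> \<in> K"
    and add_comm: "a \<in> K \<Longrightarrow> b \<in> K \<Longrightarrow> a \<oplus> b = b \<oplus> a"
    and add_assoc: "a \<in> K \<Longrightarrow> b \<in> K \<Longrightarrow> c \<in> K \<Longrightarrow> (a \<oplus> b) \<oplus> c = a \<oplus> (b \<oplus> c)"
    and mult_comm: "a \<in> K \<Longrightarrow> b \<in> K \<Longrightarrow> a \<otimes> b = b \<otimes> a"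
    and mult_assoc: "a \<in> K \<Longrightarrow> b \<in> K \<Longrightarrow> c \<in> K \<Longrightarrow> (a \<otimes> b) \<otimes> c = a \<otimes> (b \<otimes> c)"
    and distrib: "a \<in> K \<Longrightarrow> b \<in> K \<Longrightarrow> c \<in> K \<Longrightarrow> a \<otimes> (b \<oplus> c) = (a \<otimes> b) \<oplus> (a \<otimes> c)"
    and add_zero [simp]: "a \<in> K \<Longrightarrow> a \<oplus> \<zero> = a"
    and mult_one [simp]: "a \<in> K \<Longrightarrow> a \<otimes> \<one> = a"
    and neg_ex: "a \<in> K \<Longrightarrow> \<exists>b\<in>K. a \<oplus> b = \<zero>"
    and zero_apart_one: "\<zero> \<sqsubset> \<one> \<or> \<one> \<sqsubset> \<zero>"
    and inverse_ex: "a \<in> K \<Longrightarrow> \<zero> \<sqsubset> a \<Longrightarrow> \<exists>b\<in>K. a \<otimes> b = \<one>"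
    and lt_asym: "a \<in> K \<Longrightarrow> b \<in> K \<Longrightarrow> a \<sqsubset> b \<Longrightarrow> \<not> b \<sqsubset> a"
    and cotrans: "a \<in> K \<Longrightarrow> b \<in> K \<Longrightarrow> c \<in> K \<Longrightarrow> a \<sqsubset> b \<Longrightarrow> a \<sqsubset> c \<or> c \<sqsubset> b"
    and lt_add: "a \<in> K \<Longrightarrow> b \<in> K \<Longrightarrow> c \<in> K \<Longrightarrow> a \<sqsubset> b \<Longrightarrow> a \<oplus> c \<sqsubset> b \<oplus> c"
    and lt_mult: "a \<in> K \<Longrightarrow> b \<in> K \<Longrightarrow> \<zero> \<sqsubset> a \<Longrightarrow> \<zero> \<sqsubset> b \<Longrightarrow> \<zero> \<sqsubset> a \<otimes> b"
begin

lemma zero_add [simp]: "a \<in> K \<Longrightarrow> \<zero> \<oplus> a = a"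
  using add_comm[of \<zero> a] by simp

lemma one_mult [simp]: "a \<in> K \<Longrightarrow> \<one> \<otimes> a = a"
  using mult_comm[of \<one> a] by simp

lemma add_left_comm: "a \<in> K \<Longrightarrow> b \<in> K \<Longrightarrow> c \<in> K \<Longrightarrow> a \<oplus> (b \<oplus> c) = b \<oplus> (a \<oplus> c)"
  using add_assoc[of a b c] add_assoc[of b a c] add_comm[of a b] by simp

lemma distrib_right: "a \<in> K \<Longrightarrow> b \<in> K \<Longrightarrow> c \<in> K \<Longrightarrow> (b \<oplus> c) \<otimes> a = (b \<otimes> a) \<oplus> (c \<otimes> a)"
  using distrib[of a b c] mult_comm[of a] by simp

lemma add_cancel:
  assumes "a \<in> K" "b \<in> K" "c \<in> K" "a \<oplus> c = b \<oplus> c"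
  shows "a = b"
proof -
  obtain d where d: "d \<in> K" "c \<oplus> d = \<zero>" using neg_ex assms(3) by blast
  have "a = (a \<oplus> c) \<oplus> d" using assms(1,3) d by (simp add: add_assoc)
  also have "\<dots> = (b \<oplus> c) \<oplus> d" by (simp only: assms(4))
  also have "\<dots> = b" using assms(2,3) d by (simp add: add_assoc)
  finally show ?thesis .
qed

definition ng :: "'c \<Rightarrow> 'c" where
  "ng a = (SOME b. b \<in> K \<and> a \<oplus> b = \<zero>)"

lemma ng: "a \<in> K \<Longrightarrow> ng a \<in> K" "a \<in> K \<Longrightarrow> a \<oplus> ng a = \<zero>"
  using someI_ex[of "\<lambda>b. b \<in> K \<and> a \<oplus> b = \<zero>"] neg_ex[of a] unfolding ng_def by blast+

lemma ng_unique: "a \<in> K \<Longrightarrow> b \<in> K \<Longrightarrow> a \<oplus> b = \<zero> \<Longrightarrow> b = ng a"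
  using add_cancel[of b "ng a" a] ng[of a] add_comm[of a] by simp

lemma ng_ng [simp]: "a \<in> K \<Longrightarrow> ng (ng a) = a"
  using ng_unique[of "ng a" a] ng[of a] add_comm[of a "ng a"] by simp

lemma ng_add: "a \<in> K \<Longrightarrow> b \<in> K \<Longrightarrow> ng (a \<oplus> b) = ng a \<oplus> ng b"
proof (rule ng_unique[symmetric])
  assume ab: "a \<in> K" "b \<in> K"
  note n = ng(1)[OF ab(1)] ng(1)[OF ab(2)]
  have "a \<oplus> b \<oplus> (ng a \<oplus> ng b) = (a \<oplus> ng a) \<oplus> (b \<oplus> ng b)"
    using ab n by (simp add: add_assoc add_left_comm[of "ng a" b])
  then show "a \<oplus> b \<oplus> (ng a \<oplus> ng b) = \<zero>" using ab ng(2) by simp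
qed (simp_all add: ng)

lemma mult_zero [simp]: "a \<in> K \<Longrightarrow> a \<otimes> \<zero> = \<zero>"
  using distrib[of a \<zero> \<zero>] add_cancel[of "a \<otimes> \<zero>" \<zero> "a \<otimes> \<zero>"] by simp

lemma zero_mult [simp]: "a \<in> K \<Longrightarrow> \<zero> \<otimes> a = \<zero>"
  using mult_comm[of \<zero> a] by simp

lemma mult_ng: "a \<in> K \<Longrightarrow> b \<in> K \<Longrightarrow> a \<otimes> ng b = ng (a \<otimes> b)"
  using ng_unique[of "a \<otimes> b" "a \<otimes> ng b"] distrib[of a b "ng b"] ng[of b] by simp

lemma ng_mult: "a \<in> K \<Longrightarrow> b \<in> K \<Longrightarrow> ng a \<otimes> b = ng (a \<otimes> b)"
  using mult_ng[of b a] mult_comm[of a b] mult_comm[of "ng a" b] ng[of a] by simp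

lemma lt_irrefl: "a \<in> K \<Longrightarrow> \<not> a \<sqsubset> a"
  using lt_asym by blast

lemma lt_trans: "a \<in> K \<Longrightarrow> b \<in> K \<Longrightarrow> c \<in> K \<Longrightarrow> a \<sqsubset> b \<Longrightarrow> b \<sqsubset> c \<Longrightarrow> a \<sqsubset> c"
  using cotrans[of a b c] lt_asym[of b c] by blast

lemma lt_add_cancel:
  assumes "a \<in> K" "b \<in> K" "c \<in> K" "a \<oplus> c \<sqsubset> b \<oplus> c"
  shows "a \<sqsubset> b"
  using lt_add[OF _ _ ng(1)[OF assms(3)] assms(4)] assms(1-3) ng[of c] by (simp add: add_assoc)

end

text \<open>
  The structure of the real numbers at a single world of a Kripke model: only the facts about \<open>\<le>\<close>,
  which refers to all later worlds, that are listed here can be used.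
\<close>

locale ofield = oring +
  fixes le :: "'a \<Rightarrow> 'a \<Rightarrow> bool" (infix "\<sqsubseteq>" 50)
  assumes le_not_lt: "a \<in> K \<Longrightarrow> b \<in> K \<Longrightarrow> a \<sqsubseteq> b \<Longrightarrow> \<not> b \<sqsubset> a"
    and lt_le: "a \<in> K \<Longrightarrow> b \<in> K \<Longrightarrow> a \<sqsubset> b \<Longrightarrow> a \<sqsubseteq> b"
    and le_refl: "a \<in> K \<Longrightarrow> a \<sqsubseteq> a"
    and le_trans: "a \<in> K \<Longrightarrow> b \<in> K \<Longrightarrow> c \<in> K \<Longrightarrow> a \<sqsubseteq> b \<Longrightarrow> b \<sqsubseteq> c \<Longrightarrow> a \<sqsubseteq> c"
    and le_antisym: "a \<in> K \<Longrightarrow> b \<in> K \<Longrightarrow> a \<sqsubseteq> b \<Longrightarrow> b \<sqsubseteq> a \<Longrightarrow> a = b"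
    and le_add: "a \<in> K \<Longrightarrow> b \<in> K \<Longrightarrow> c \<in> K \<Longrightarrow> a \<sqsubseteq> b \<Longrightarrow> a \<oplus> c \<sqsubseteq> b \<oplus> c"
begin

lemma le_lt_trans: "a \<in> K \<Longrightarrow> b \<in> K \<Longrightarrow> c \<in> K \<Longrightarrow> a \<sqsubseteq> b \<Longrightarrow> b \<sqsubset> c \<Longrightarrow> a \<sqsubset> c"
  using cotrans[of b c a] le_not_lt[of a b] by blast

lemma lt_add2: "a \<in> K \<Longrightarrow> b \<in> K \<Longrightarrow> c \<in> K \<Longrightarrow> d \<in> K \<Longrightarrow> a \<sqsubset> b \<Longrightarrow> c \<sqsubset> d \<Longrightarrow> a \<oplus> c \<sqsubset> b \<oplus> d"
  using lt_add[of a b c] lt_add[of c d b] lt_trans[of "a \<oplus> c" "b \<oplus> c" "b \<oplus> d"]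
    add_comm[of b c] add_comm[of b d] by simp

lemma le_add2: "a \<in> K \<Longrightarrow> b \<in> K \<Longrightarrow> c \<in> K \<Longrightarrow> d \<in> K \<Longrightarrow> a \<sqsubseteq> b \<Longrightarrow> c \<sqsubseteq> d \<Longrightarrow> a \<oplus> c \<sqsubseteq> b \<oplus> d"
  using le_add[of a b c] le_add[of c d b] le_trans[of "a \<oplus> c" "b \<oplus> c" "b \<oplus> d"]
    add_comm[of b c] add_comm[of b d] by simp

lemma lt_ng: "a \<in> K \<Longrightarrow> a \<sqsubset> \<zero> \<Longrightarrow> \<zero> \<sqsubset> ng a"
  using lt_add[of a \<zero> "ng a"] ng[of a] by simp

lemma le_ng: "a \<in> K \<Longrightarrow> \<zero> \<sqsubseteq> a \<Longrightarrow> ng a \<sqsubseteq> \<zero>"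
  using le_add[of \<zero> a "ng a"] ng[of a] by simp

lemma le_ng': "a \<in> K \<Longrightarrow> a \<sqsubseteq> \<zero> \<Longrightarrow> \<zero> \<sqsubseteq> ng a"
  using le_add[of a \<zero> "ng a"] ng[of a] by simp

lemma zero_lt_one: "\<zero> \<sqsubset> \<one>"
  using zero_apart_one
proof
  assume "\<one> \<sqsubset> \<zero>"
  then have n: "\<zero> \<sqsubset> ng \<one>" using lt_ng by simp
  have "ng \<one> \<otimes> ng \<one> = \<one>" using mult_ng[of "ng \<one>" \<one>] ng[of \<one>] by simp
  then show ?thesis using lt_mult[OF _ _ n n] ng[of \<one>] by simp
qed

lemma pos_add: "a \<in> K \<Longrightarrow> b \<in> K \<Longrightarrow> \<zero> \<sqsubset> a \<Longrightarrow> \<zero> \<sqsubset> b \<Longrightarrow> \<zero> \<sqsubset> a \<oplus> b"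
  using lt_add2[of \<zero> a \<zero> b] by simp

text \<open>Cotransitivity at the intermediate point \<open>a\<close>.\<close>

lemma pos_add_cases:
  assumes "a \<in> K" "b \<in> K" "\<zero> \<sqsubset> a \<oplus> b"
  shows "\<zero> \<sqsubset> a \<or> \<zero> \<sqsubset> b"
proof -
  have "\<zero> \<sqsubset> b" if "a \<sqsubset> a \<oplus> b"
    using lt_add[OF _ _ _ that, of "ng a"] assms ng[of a]
    by (simp add: add_comm[of a b] add_assoc)
  then show ?thesis using cotrans[of \<zero> "a \<oplus> b" a] assms by auto
qed

definition th :: 'a where
  "th = (\<one> \<oplus> \<one>) \<oplus> \<one>"

lemma th_closed [simp]: "th \<in> K"
  by (simp add: th_def)

lemma th_mult: "a \<in> K \<Longrightarrow> th \<otimes> a = (a \<oplus> a) \<oplus> a"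
  by (simp add: th_def distrib_right)

text \<open>The field axiom supplies an inverse without its sign. As \<open>e + e + e = 1\<close> is
  positive, some summand is positive, and all summands are \<open>e\<close>.\<close>

lemma third_ex: "\<exists>e\<in>K. \<zero> \<sqsubset> e \<and> th \<otimes> e = \<one>"
proof -
  have "\<zero> \<sqsubset> th" unfolding th_def by (simp add: pos_add zero_lt_one)
  then obtain e where e: "e \<in> K" "th \<otimes> e = \<one>" using inverse_ex[OF th_closed] by blast
  then have "\<zero> \<sqsubset> (e \<oplus> e) \<oplus> e" using zero_lt_one th_mult[of e] by simp
  then have "\<zero> \<sqsubset> e" using pos_add_cases[of "e \<oplus> e" e] pos_add_cases[of e e] e by auto
  then show ?thesis using e by blast
qed

lemma one_lt_two: "\<one> \<sqsubset> \<one> \<oplus> \<one>"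
  using lt_add[of \<zero> \<one> \<one>] zero_lt_one by simp

text \<open>The supremum of \<open>x\<close> and \<open>ng x\<close>, as in \<open>rabs\<close>:
  without decidable signs there is no definition by cases. It is a relation, since existence rests
  on the least-upper-bound principle, which is not among the assumptions of this locale.\<close>

definition isabs :: "'a \<Rightarrow> 'a \<Rightarrow> bool" where
  "isabs x m \<longleftrightarrow> m \<in> K \<and> x \<sqsubseteq> m \<and> ng x \<sqsubseteq> m \<and> (\<forall>b\<in>K. x \<sqsubseteq> b \<longrightarrow> ng x \<sqsubseteq> b \<longrightarrow> m \<sqsubseteq> b)"

lemma isabs_unique: "isabs x m \<Longrightarrow> isabs x n \<Longrightarrow> m = n"
  unfolding isabs_def using le_antisym[of m n] by simp

lemma isabs_nonneg: "x \<in> K \<Longrightarrow> \<zero> \<sqsubseteq> x \<Longrightarrow> isabs x x"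
  using le_ng[of x] le_trans[of "ng x" \<zero> x] le_refl ng[of x] unfolding isabs_def by simp

lemma isabs_ng: "x \<in> K \<Longrightarrow> isabs (ng x) m = isabs x m"
  unfolding isabs_def by auto

lemma isabs_nonpos: "x \<in> K \<Longrightarrow> x \<sqsubseteq> \<zero> \<Longrightarrow> isabs x (ng x)"
  using isabs_nonneg[of "ng x"] le_ng'[of x] isabs_ng[of x] ng[of x] by simp

text \<open>Adding the two bounds gives \<open>0 = x + ng x \<sqsubseteq> m + m\<close>. This yields
  only a negation at one world; applied at all later worlds it becomes the inequality
  \<open>LE\<close>.\<close>

lemma isabs_not_neg:
  assumes "x \<in> K" "isabs x m"
  shows "\<not> m \<sqsubset> \<zero>"
proof
  assume m: "m \<sqsubset> \<zero>"
  have mK: "m \<in> K" "x \<sqsubseteq> m" "ng x \<sqsubseteq> m" using assms unfolding isabs_def by auto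
  have "x \<oplus> ng x \<sqsubseteq> m \<oplus> m" using le_add2[of x m "ng x" m] mK assms(1) ng(1) by simp
  then have "\<zero> \<sqsubseteq> m \<oplus> m" using ng(2) assms(1) by simp
  moreover have "m \<oplus> m \<sqsubset> \<zero>" using lt_add2[of m \<zero> m \<zero>] m mK by simp
  ultimately show False using le_not_lt[of \<zero> "m \<oplus> m"] mK by simp
qed

lemma isabs_zero:
  assumes "x \<in> K" "isabs x \<zero>"
  shows "x = \<zero>"
proof -
  have x: "x \<sqsubseteq> \<zero>" "ng x \<sqsubseteq> \<zero>" using assms(2) by (simp_all add: isabs_def)
  have "\<zero> \<sqsubseteq> ng (ng x)" by (rule le_ng'[OF ng(1)[OF assms(1)] x(2)])
  then have "\<zero> \<sqsubseteq> x" using assms(1) by simp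
  then show ?thesis using le_antisym[OF assms(1) _ x(1)] by simp
qed

lemma isabs_triangle:
  assumes "x \<in> K" "y \<in> K" "isabs x a" "isabs y b" "isabs (x \<oplus> y) c"
  shows "c \<sqsubseteq> a \<oplus> b"
proof -
  have "x \<oplus> y \<sqsubseteq> a \<oplus> b" "ng x \<oplus> ng y \<sqsubseteq> a \<oplus> b"
    using assms ng(1) unfolding isabs_def by (simp_all add: le_add2)
  then show ?thesis using assms ng_add[of x y] unfolding isabs_def by auto
qed

text \<open>With decided signs each absolute value is the number or its negative. The decision is an
  explicit assumption, to be discharged at a suitable later world.\<close>

lemma isabs_mult:
  assumes K: "x \<in> K" "y \<in> K" and a: "isabs x a" "isabs y b" "isabs (x \<otimes> y) c"
    and tri: "x \<sqsubset> \<zero> \<or> x = \<zero> \<or> \<zero> \<sqsubset> x" "y \<sqsubset> \<zero> \<or> y = \<zero> \<or> \<zero> \<sqsubset> y"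
  shows "c = a \<otimes> b"
proof -
  have pos: "\<exists>s\<in>K. (s = z \<or> s = ng z) \<and> (\<zero> \<sqsubset> s \<or> s = \<zero>) \<and> isabs z s"
    if h: "z \<in> K" "z \<sqsubset> \<zero> \<or> z = \<zero> \<or> \<zero> \<sqsubset> z" for z
  proof -
    consider "z \<sqsubset> \<zero>" | "z = \<zero>" | "\<zero> \<sqsubset> z" using h(2) by blast
    then show ?thesis
    proof cases
      case 1
      then show ?thesis using h(1) lt_ng isabs_nonpos lt_le ng(1) by (intro bexI[of _ "ng z"]) auto
    next
      case 2
      then show ?thesis using isabs_nonneg[of \<zero>] le_refl by (intro bexI[of _ z]) auto
    next
      case 3
      then show ?thesis using h(1) isabs_nonneg lt_le by (intro bexI[of _ z]) auto
    qed
  qed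
  obtain s where s: "s \<in> K" "s = x \<or> s = ng x" "\<zero> \<sqsubset> s \<or> s = \<zero>" "isabs x s" using pos[OF K(1) tri(1)] by blast
  obtain t where t: "t \<in> K" "t = y \<or> t = ng y" "\<zero> \<sqsubset> t \<or> t = \<zero>" "isabs y t" using pos[OF K(2) tri(2)] by blast
  have st: "\<zero> \<sqsubseteq> s \<otimes> t" using s(1,3) t(1,3) lt_mult[of s t] lt_le[of \<zero> "s \<otimes> t"] le_refl[of \<zero>]
    by (metis closed(2,3) mult_zero zero_mult)
  have "s \<otimes> t = x \<otimes> y \<or> s \<otimes> t = ng (x \<otimes> y)"
    using s(2) t(2) mult_ng[OF K] ng_mult[OF K] mult_ng[OF ng(1)[OF K(1)] K(2)] ng_ng[OF closed(2)[OF K]]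
    by metis
  then have "isabs (x \<otimes> y) (s \<otimes> t)"
    using isabs_nonneg[OF closed(2)[OF s(1) t(1)] st] isabs_ng[OF closed(2)[OF K]] by metis
  then have "c = s \<otimes> t" using isabs_unique a(3) by blast
  then show ?thesis using isabs_unique[OF a(1) s(4)] isabs_unique[OF a(2) t(4)] by simp
qed

text \<open>Here \<open>y\<close> is the point near 1, \<open>z = 1 - y\<close>, and
  \<open>e\<close> is 1/3. The one-sided estimates of \<open>z\<close> by \<open>d\<close> and of
  \<open>th \<otimes> y\<close> by \<open>c\<close> suffice: they give
  \<open>3 = 3 z + 3 y < 1 + 2\<close>.\<close>

lemma approximation_contradiction:
  assumes K: "y \<in> K" "z \<in> K" "e \<in> K" "z \<oplus> y = \<one>" and e: "th \<otimes> e = \<one>"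
    and z: "isabs z d" "d \<sqsubset> e" and y: "isabs (th \<otimes> y) c" "c \<sqsubset> \<one> \<oplus> \<one>"
  shows False
proof -
  have "z \<sqsubset> e" using z K le_lt_trans[of z d e] unfolding isabs_def by simp
  then have "(z \<oplus> z) \<oplus> z \<sqsubset> (e \<oplus> e) \<oplus> e" using K by (intro lt_add2) simp_all
  then have "th \<otimes> z \<sqsubset> \<one>" using th_mult[of z] th_mult[of e] e K by simp
  moreover have "th \<otimes> y \<sqsubset> \<one> \<oplus> \<one>" using y K le_lt_trans[of "th \<otimes> y" c] unfolding isabs_def by simp
  ultimately have "th \<otimes> z \<oplus> th \<otimes> y \<sqsubset> \<one> \<oplus> (\<one> \<oplus> \<one>)" using K by (intro lt_add2) simp_all
  moreover have "th \<otimes> z \<oplus> th \<otimes> y = th" using distrib[of th z y] K by simp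
  ultimately show False using lt_irrefl[of th] by (simp add: th_def add_assoc)
qed

end

section \<open>Semantics of the real numbers and of q-normed spaces\<close>

locale realctx = czf le D mem eq
  for le :: "'w \<Rightarrow> 'w \<Rightarrow> bool" (infix "\<preceq>" 50) and D :: "'w \<Rightarrow> 'a set"
    and mem eq :: "'w \<Rightarrow> 'a \<Rightarrow> 'a \<Rightarrow> bool" +
  fixes R ad mu ls ze on :: 'a
begin

definition LT :: "'w \<Rightarrow> 'a \<Rightarrow> 'a \<Rightarrow> bool" where
  "LT w x y \<longleftrightarrow> (\<exists>q. PR w x y q \<and> mem w q ls)"

definition LE :: "'w \<Rightarrow> 'a \<Rightarrow> 'a \<Rightarrow> bool" where
  "LE w x y \<longleftrightarrow> (\<forall>v. w \<preceq> v \<longrightarrow> \<not> LT v y x)"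

definition NG :: "'w \<Rightarrow> 'a \<Rightarrow> 'a \<Rightarrow> bool" where
  "NG w x y \<longleftrightarrow> mem w y R \<and> (\<exists>z. A2 w ad x y z \<and> eq w z ze)"

definition RA :: "'w \<Rightarrow> 'a \<Rightarrow> 'a \<Rightarrow> bool" where
  "RA w x m \<longleftrightarrow> (\<exists>y. NG w x y \<and> mem w m R \<and> LE w x m \<and> LE w y m \<and>
     (\<forall>v. w \<preceq> v \<longrightarrow> (\<forall>b. mem v b R \<longrightarrow> LE v x b \<longrightarrow> LE v y b \<longrightarrow> LE v m b)))"

definition VM :: "'w \<Rightarrow> 'a \<Rightarrow> 'a \<Rightarrow> 'a \<Rightarrow> bool" where
  "VM w x y z \<longleftrightarrow> mem w z R \<and> (\<exists>t. A2 w ad z y t \<and> eq w t x)"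

lemma LE_mono: "LE v x y \<Longrightarrow> v \<preceq> w \<Longrightarrow> LE w x y"
  unfolding LE_def by (meson le_trans)

definition TF :: "(nat \<Rightarrow> 'a) \<Rightarrow> (nat \<times> 'a) set \<Rightarrow> reals \<Rightarrow> bool" where
  "TF p \<Gamma> F \<longleftrightarrow> TR p \<Gamma> (rset F) (\<lambda>w v. v = R) \<and> TR p \<Gamma> (radd_op F) (\<lambda>w v. v = ad) \<and>
     TR p \<Gamma> (rmul_op F) (\<lambda>w v. v = mu) \<and> TR p \<Gamma> (rless_rel F) (\<lambda>w v. v = ls) \<and>
     TR p \<Gamma> (rzero F) (\<lambda>w v. v = ze) \<and> TR p \<Gamma> (rone F) (\<lambda>w v. v = on)"

lemma TF_simps:
  assumes "TF p \<Gamma> F"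
  shows "TR p \<Gamma> (rset F) (\<lambda>w v. v = R)" "TR p \<Gamma> (radd_op F) (\<lambda>w v. v = ad)"
    "TR p \<Gamma> (rmul_op F) (\<lambda>w v. v = mu)" "TR p \<Gamma> (rless_rel F) (\<lambda>w v. v = ls)"
    "TR p \<Gamma> (rzero F) (\<lambda>w v. v = ze)" "TR p \<Gamma> (rone F) (\<lambda>w v. v = on)"
  using assms by (simp_all add: TF_def)

lemma TF_insert: "TF p \<Gamma> F \<Longrightarrow> TF p (insert b \<Gamma>) F"
  by (simp add: TF_def TR_insert)

lemma TR_radd:
  assumes "TF p \<Gamma> F" "TR p \<Gamma> s S" "TR p \<Gamma> t Q"
  shows "TR p \<Gamma> (s +\<^bsub>F\<^esub> t) (\<lambda>w z. \<exists>x. S w x \<and> (\<exists>y. Q w y \<and> A2 w ad x y z))"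
  unfolding radd_def by (rule TR_app_pair[OF TF_simps(2)[OF assms(1)] assms(2,3)])

lemma TR_rmul:
  assumes "TF p \<Gamma> F" "TR p \<Gamma> s S" "TR p \<Gamma> t Q"
  shows "TR p \<Gamma> (s *\<^bsub>F\<^esub> t) (\<lambda>w z. \<exists>x. S w x \<and> (\<exists>y. Q w y \<and> A2 w mu x y z))"
  unfolding rmul_def by (rule TR_app_pair[OF TF_simps(3)[OF assms(1)] assms(2,3)])

lemma FR_rless:
  assumes "TF p \<Gamma> F" "TR p \<Gamma> s S" "TR p \<Gamma> t Q"
  shows "FR p \<Gamma> (s <\<^bsub>F\<^esub> t) (\<lambda>w. \<exists>x. S w x \<and> (\<exists>y. Q w y \<and> LT w x y))"
  unfolding rless_def
  by (rule FR_cong, rule FR_mem[OF TR_pair[OF assms(2,3)] TF_simps(4)[OF assms(1)]])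
    (auto simp: LT_def)

lemma FR_rle:
  assumes "TF p \<Gamma> F" "TR p \<Gamma> s (\<lambda>w v. v = x)" "TR p \<Gamma> t (\<lambda>w v. v = y)"
  shows "FR p \<Gamma> (s \<le>\<^bsub>F\<^esub> t) (\<lambda>w. LE w x y)"
  unfolding rle_def
  by (rule FR_cong, rule FR_not[OF FR_rless[OF assms(1,3,2)]]) (simp add: LE_def)

text \<open>The values of the terms are existentially quantified under the negation in
  \<open>rle\<close>, hence universally quantified at all later worlds.\<close>

lemma FR_rle_term:
  assumes "TF p \<Gamma> F" "TR p \<Gamma> s S" "TR p \<Gamma> t Q"
  shows "FR p \<Gamma> (s \<le>\<^bsub>F\<^esub> t) (\<lambda>w. \<forall>v. w \<preceq> v \<longrightarrow> (\<forall>x y. S v x \<longrightarrow> Q v y \<longrightarrow> \<not> LT v y x))"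
  unfolding rle_def
  by (rule FR_cong, rule FR_not[OF FR_rless[OF assms(1,3,2)]]) auto

lemma FR_rapart:
  assumes "TF p \<Gamma> F" "TR p \<Gamma> s (\<lambda>w v. v = x)" "TR p \<Gamma> t (\<lambda>w v. v = y)"
  shows "FR p \<Gamma> (s \<noteq>\<^bsub>F\<^esub> t) (\<lambda>w. LT w x y \<or> LT w y x)"
  unfolding rapart_def
  by (rule FR_cong, rule FR_or[OF FR_rless[OF assms(1,2,3)] FR_rless[OF assms(1,3,2)]]) simp

lemma TR_rneg:
  assumes "TF p \<Gamma> F" "TR p \<Gamma> t Q"
  shows "TR p \<Gamma> (rneg F t) (\<lambda>w y. \<exists>x. Q w x \<and> NG w x y)"
  unfolding rneg_def
  by (rule TR_cong, (rule assms(2) FR_rules TR_radd | rule TF_simps assms(1) | rule TF_insert TR_insert)+)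
    (auto simp: NG_def dest: mem_D)

lemma sup_simp:
  "(\<forall>v. w \<preceq> v \<longrightarrow> (\<forall>b. mem v b R \<longrightarrow> (\<forall>u. v \<preceq> u \<longrightarrow> P u b \<and> Q u b \<longrightarrow> S u b))) \<longleftrightarrow>
    (\<forall>v. w \<preceq> v \<longrightarrow> (\<forall>b. mem v b R \<longrightarrow> P v b \<longrightarrow> Q v b \<longrightarrow> S v b))"
  by (meson mem_mono le_refl le_trans)

lemma TR_rabs:
  assumes "TF p \<Gamma> F" "TR p \<Gamma> t Q"
  shows "TR p \<Gamma> (rabs F t) (\<lambda>w y. \<exists>x. Q w x \<and> RA w x y)"
  unfolding rabs_def
  by (rule TR_cong, (rule assms(2) TR_rneg FR_rle FR_rules | rule TF_simps assms(1) | rule TF_insert TR_insert)+)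
    (simp add: RA_def sup_simp, meson mem_D)

lemma TR_rsum:
  assumes "TF p \<Gamma> F" "TR p \<Gamma> n (\<lambda>w v. v = n')" "\<And>l k. TR p (insert (l, k) \<Gamma>) (t (var l)) (T k)"
  shows "TR p \<Gamma> (rsum F n t) (\<lambda>w s. FSUM w R ad ze n' T s)"
  unfolding rsum_def by (rule TR_fsum[OF TF_simps(1,2,5)[OF assms(1)] assms(2,3)])

lemmas R_rules = FR_is_fun TR_times TR_rabs FR_rless FR_rle_term FR_rapart TR_radd TR_rmul FR_rules

end

locale normctx = realctx le D mem eq R ad mu ls ze on
  for le :: "'w \<Rightarrow> 'w \<Rightarrow> bool" (infix "\<preceq>" 50) and D :: "'w \<Rightarrow> 'a set"
    and mem eq :: "'w \<Rightarrow> 'a \<Rightarrow> 'a \<Rightarrow> bool" and R ad mu ls ze on :: 'a +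
  fixes I N :: 'a
begin

text \<open>The space is the real line over itself: vectors, addition, zero and scalar
  multiplication are those of the field, and only \<open>I\<close> and \<open>N\<close> are
  new.\<close>

definition TV :: "(nat \<Rightarrow> 'a) \<Rightarrow> (nat \<times> 'a) set \<Rightarrow> qspace \<Rightarrow> bool" where
  "TV p \<Gamma> V \<longleftrightarrow> TR p \<Gamma> (vset V) (\<lambda>w v. v = R) \<and> TR p \<Gamma> (vadd_op V) (\<lambda>w v. v = ad) \<and>
     TR p \<Gamma> (vzero V) (\<lambda>w v. v = ze) \<and> TR p \<Gamma> (smul_op V) (\<lambda>w v. v = mu) \<and>
     TR p \<Gamma> (vindex V) (\<lambda>w v. v = I) \<and> TR p \<Gamma> (vnorm_op V) (\<lambda>w v. v = N)"

lemma TV_simps: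
  assumes "TV p \<Gamma> V"
  shows "TR p \<Gamma> (vset V) (\<lambda>w v. v = R)" "TR p \<Gamma> (vadd_op V) (\<lambda>w v. v = ad)"
    "TR p \<Gamma> (vzero V) (\<lambda>w v. v = ze)" "TR p \<Gamma> (smul_op V) (\<lambda>w v. v = mu)"
    "TR p \<Gamma> (vindex V) (\<lambda>w v. v = I)" "TR p \<Gamma> (vnorm_op V) (\<lambda>w v. v = N)"
  using assms by (simp_all add: TV_def)

lemma TV_insert: "TV p \<Gamma> V \<Longrightarrow> TV p (insert b \<Gamma>) V"
  by (simp add: TV_def TR_insert)

lemma TR_vadd:
  assumes "TV p \<Gamma> V" "TR p \<Gamma> s S" "TR p \<Gamma> t Q"
  shows "TR p \<Gamma> (s \<oplus>\<^bsub>V\<^esub> t) (\<lambda>w z. \<exists>x. S w x \<and> (\<exists>y. Q w y \<and> A2 w ad x y z))"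
  unfolding vadd_def by (rule TR_app_pair[OF TV_simps(2)[OF assms(1)] assms(2,3)])

lemma TR_smul:
  assumes "TV p \<Gamma> V" "TR p \<Gamma> s S" "TR p \<Gamma> t Q"
  shows "TR p \<Gamma> (s \<odot>\<^bsub>V\<^esub> t) (\<lambda>w z. \<exists>x. S w x \<and> (\<exists>y. Q w y \<and> A2 w mu x y z))"
  unfolding smul_def by (rule TR_app_pair[OF TV_simps(4)[OF assms(1)] assms(2,3)])

lemma TR_vnorm:
  assumes "TV p \<Gamma> V" "TR p \<Gamma> s S" "TR p \<Gamma> t Q"
  shows "TR p \<Gamma> (vnorm V s t) (\<lambda>w z. \<exists>x. S w x \<and> (\<exists>y. Q w y \<and> A2 w N x y z))"
  unfolding vnorm_def by (rule TR_app_pair[OF TV_simps(6)[OF assms(1)] assms(2,3)])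

lemma TR_vminus:
  assumes "TV p \<Gamma> V" "TR p \<Gamma> s S" "TR p \<Gamma> t Q"
  shows "TR p \<Gamma> (s \<ominus>\<^bsub>V\<^esub> t) (\<lambda>w z. \<exists>x. S w x \<and> (\<exists>y. Q w y \<and> VM w x y z))"
  unfolding vminus_def
  by (rule TR_cong, (rule assms(2,3) FR_rules TR_vadd | rule TV_simps assms(1) | rule TV_insert TR_insert)+)
    (auto simp: VM_def dest: mem_D)

lemma TR_vsum:
  assumes "TV p \<Gamma> V" "TR p \<Gamma> n (\<lambda>w v. v = n')" "\<And>l k. TR p (insert (l, k) \<Gamma>) (t (var l)) (T k)"
  shows "TR p \<Gamma> (vsum V n t) (\<lambda>w s. FSUM w R ad ze n' T s)"
  unfolding vsum_def by (rule TR_fsum[OF TV_simps(1,2,3)[OF assms(1)] assms(2,3)])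

lemmas V_rules = FR_is_fun TR_times TR_rabs FR_rless FR_rle_term FR_rapart TR_radd TR_rmul TR_vadd TR_smul
  TR_vnorm TR_vminus FR_rules

end

section \<open>Forcing conditions of the axioms for the reals and for q-normed spaces\<close>

context realctx
begin

text \<open>Like the capitalised conditions that follow, this is the computed meaning of the
  formula. The nested passages to later worlds are left in place so that it matches the outcome of
  the \<open>FR\<close> rules.\<close>

definition HEYT :: "'w \<Rightarrow> bool" where
  "HEYT w \<longleftrightarrow> (\<exists>a. TM w R R a \<and> FN w ad a R) \<and> (\<exists>a. TM w R R a \<and> FN w mu a R) \<and> mem w ze R \<and> mem w on R \<and>
    (\<forall>v. w \<preceq> v \<longrightarrow> (\<forall>x. mem v x R \<longrightarrow> (\<forall>u. v \<preceq> u \<longrightarrow> (\<forall>y. mem u y R \<longrightarrow> (\<forall>t. u \<preceq> t \<longrightarrow> (\<forall>z. mem t z R \<longrightarrow>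
      (\<exists>a. A2 t ad x y a \<and> (\<exists>b. A2 t ad y x b \<and> eq t a b)) \<and>
      (\<exists>a. (\<exists>s. A2 t ad x y s \<and> A2 t ad s z a) \<and> (\<exists>b. (\<exists>s. A2 t ad y z s \<and> A2 t ad x s b) \<and> eq t a b)) \<and>
      (\<exists>a. A2 t mu x y a \<and> (\<exists>b. A2 t mu y x b \<and> eq t a b)) \<and>
      (\<exists>a. (\<exists>s. A2 t mu x y s \<and> A2 t mu s z a) \<and> (\<exists>b. (\<exists>s. A2 t mu y z s \<and> A2 t mu x s b) \<and> eq t a b)) \<and>
      (\<exists>a. (\<exists>s. A2 t ad y z s \<and> A2 t mu x s a) \<and>
        (\<exists>b. (\<exists>s. A2 t mu x y s \<and> (\<exists>r. A2 t mu x z r \<and> A2 t ad s r b)) \<and> eq t a b)))))))) \<and>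
    (\<forall>v. w \<preceq> v \<longrightarrow> (\<forall>x. mem v x R \<longrightarrow> (\<exists>a. A2 v ad x ze a \<and> eq v a x))) \<and>
    (\<forall>v. w \<preceq> v \<longrightarrow> (\<forall>x. mem v x R \<longrightarrow> (\<exists>a. A2 v mu x on a \<and> eq v a x))) \<and>
    (\<forall>v. w \<preceq> v \<longrightarrow> (\<forall>x. mem v x R \<longrightarrow> (\<exists>y. mem v y R \<and> (\<exists>a. A2 v ad x y a \<and> eq v a ze)))) \<and>
    (LT w ze on \<or> LT w on ze) \<and>
    (\<forall>v. w \<preceq> v \<longrightarrow> (\<forall>x. mem v x R \<longrightarrow> (\<forall>u. v \<preceq> u \<longrightarrow>
      (LT u x ze \<longrightarrow> (\<exists>y. mem u y R \<and> (\<exists>a. A2 u mu x y a \<and> eq u a on))) \<and>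
      (LT u ze x \<longrightarrow> (\<exists>y. mem u y R \<and> (\<exists>a. A2 u mu x y a \<and> eq u a on))))))"

lemma FR_heyting:
  assumes "TF p \<Gamma> F"
  shows "FR p \<Gamma> (heyting_field F) HEYT"
  unfolding heyting_field_def
  by (rule FR_cong, (rule R_rules | rule TF_simps assms(1) | rule TF_insert TR_insert)+)
    (simp add: LE_def[symmetric] HEYT_def)

definition ORD :: "'w \<Rightarrow> bool" where
  "ORD w \<longleftrightarrow> (\<forall>v. w \<preceq> v \<longrightarrow> (\<forall>x. mem v x R \<longrightarrow> (\<forall>u. v \<preceq> u \<longrightarrow> (\<forall>y. mem u y R \<longrightarrow>
    (\<forall>t. u \<preceq> t \<longrightarrow> LT t x y \<longrightarrow> \<not> LT t y x) \<and>
    (\<forall>t. u \<preceq> t \<longrightarrow> LT t x y \<longrightarrow> (\<forall>s. t \<preceq> s \<longrightarrow> (\<forall>z. mem s z R \<longrightarrow> LT s x z \<or> LT s z y))) \<and>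
    (\<forall>t. u \<preceq> t \<longrightarrow> (\<forall>s. t \<preceq> s \<longrightarrow> \<not> LT s x y \<and> \<not> LT s y x) \<longrightarrow> eq t x y) \<and>
    (\<forall>t. u \<preceq> t \<longrightarrow> LT t x y \<longrightarrow> (\<forall>s. t \<preceq> s \<longrightarrow> (\<forall>z. mem s z R \<longrightarrow>
      (\<exists>a. A2 s ad x z a \<and> (\<exists>b. A2 s ad y z b \<and> LT s a b))))) \<and>
    (\<forall>t. u \<preceq> t \<longrightarrow> LT t ze x \<and> LT t ze y \<longrightarrow> (\<exists>a. A2 t mu x y a \<and> LT t ze a))))))"

lemma FR_order:
  assumes "TF p \<Gamma> F"
  shows "FR p \<Gamma> (order_axioms F) ORD"
  unfolding order_axioms_def
  by (rule FR_cong, (rule R_rules | rule TF_simps assms(1) | rule TF_insert TR_insert)+)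
    (simp add: LE_def[symmetric] ORD_def)

definition LUBP :: "'w \<Rightarrow> bool" where
  "LUBP w \<longleftrightarrow> (\<forall>v. w \<preceq> v \<longrightarrow> (\<forall>S\<in>D v. \<forall>u. v \<preceq> u \<longrightarrow>
    (\<forall>t. u \<preceq> t \<longrightarrow> (\<forall>s. mem t s S \<longrightarrow> mem t s R)) \<and> (\<exists>s\<in>D u. mem u s S) \<and>
    (\<exists>b. mem u b R \<and> (\<forall>t. u \<preceq> t \<longrightarrow> (\<forall>s. mem t s S \<longrightarrow> LE t s b))) \<and>
    (\<forall>t. u \<preceq> t \<longrightarrow> (\<forall>x. mem t x R \<longrightarrow> (\<forall>r. t \<preceq> r \<longrightarrow> (\<forall>y. mem r y R \<longrightarrow> (\<forall>q. r \<preceq> q \<longrightarrow> LT q x y \<longrightarrow>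
      (\<forall>q'. q \<preceq> q' \<longrightarrow> (\<forall>s. mem q' s S \<longrightarrow> LE q' s y)) \<or> (\<exists>s. mem q s S \<and> LT q x s)))))) \<longrightarrow>
    (\<exists>b. mem u b R \<and> (\<forall>t. u \<preceq> t \<longrightarrow> (\<forall>s. mem t s S \<longrightarrow> LE t s b)) \<and>
      (\<forall>t. u \<preceq> t \<longrightarrow> (\<forall>x. mem t x R \<longrightarrow> (\<forall>r. t \<preceq> r \<longrightarrow> LT r x b \<longrightarrow> (\<exists>s. mem r s S \<and> LT r x s)))))))"

lemma FR_lub:
  assumes "TF p \<Gamma> F"
  shows "FR p \<Gamma> (least_upper_bound_principle F) LUBP"
  unfolding least_upper_bound_principle_def
  by (rule FR_cong, (rule R_rules | rule TF_simps assms(1) | rule TF_insert TR_insert)+)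
    (simp add: LE_def[symmetric] LUBP_def)

end

context normctx
begin

definition LIN :: "'w \<Rightarrow> bool" where
  "LIN w \<longleftrightarrow> (\<exists>a. TM w R R a \<and> FN w ad a R) \<and> (\<exists>a. TM w R R a \<and> FN w mu a R) \<and> mem w ze R \<and>
    (\<forall>v. w \<preceq> v \<longrightarrow> (\<forall>x. mem v x R \<longrightarrow> (\<forall>u. v \<preceq> u \<longrightarrow> (\<forall>y. mem u y R \<longrightarrow> (\<forall>t. u \<preceq> t \<longrightarrow> (\<forall>z. mem t z R \<longrightarrow>
      (\<exists>a. A2 t ad x y a \<and> (\<exists>b. A2 t ad y x b \<and> eq t a b)) \<and>
      (\<exists>a. (\<exists>s. A2 t ad x y s \<and> A2 t ad s z a) \<and> (\<exists>b. (\<exists>s. A2 t ad y z s \<and> A2 t ad x s b) \<and> eq t a b)))))))) \<and>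
    (\<forall>v. w \<preceq> v \<longrightarrow> (\<forall>x. mem v x R \<longrightarrow> (\<exists>a. A2 v ad x ze a \<and> eq v a x))) \<and>
    (\<forall>v. w \<preceq> v \<longrightarrow> (\<forall>x. mem v x R \<longrightarrow> (\<exists>y. mem v y R \<and> (\<exists>a. A2 v ad x y a \<and> eq v a ze)))) \<and>
    (\<forall>v. w \<preceq> v \<longrightarrow> (\<forall>x. mem v x R \<longrightarrow> (\<forall>u. v \<preceq> u \<longrightarrow> (\<forall>y. mem u y R \<longrightarrow> (\<forall>t. u \<preceq> t \<longrightarrow> (\<forall>z. mem t z R \<longrightarrow>
      (\<forall>s. t \<preceq> s \<longrightarrow> (\<forall>r. mem s r R \<longrightarrow>
      (\<exists>a. (\<exists>c. A2 s ad z r c \<and> A2 s mu x c a) \<and>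
        (\<exists>b. (\<exists>c. A2 s mu x z c \<and> (\<exists>d. A2 s mu x r d \<and> A2 s ad c d b)) \<and> eq s a b)) \<and>
      (\<exists>a. (\<exists>c. A2 s ad x y c \<and> A2 s mu c z a) \<and>
        (\<exists>b. (\<exists>c. A2 s mu x z c \<and> (\<exists>d. A2 s mu y z d \<and> A2 s ad c d b)) \<and> eq s a b)) \<and>
      (\<exists>a. (\<exists>c. A2 s mu x y c \<and> A2 s mu c z a) \<and>
        (\<exists>b. (\<exists>c. A2 s mu y z c \<and> A2 s mu x c b) \<and> eq s a b)))))))))) \<and>
    (\<forall>v. w \<preceq> v \<longrightarrow> (\<forall>x. mem v x R \<longrightarrow> (\<exists>a. A2 v mu on x a \<and> eq v a x)))"

lemma FR_linear:
  assumes "TF p \<Gamma> F" "TV p \<Gamma> V"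
  shows "FR p \<Gamma> (linear_space F V) LIN"
  unfolding linear_space_def
  by (rule FR_cong, (rule V_rules | rule TF_simps TV_simps assms | rule TF_insert TV_insert TR_insert)+)
    (simp add: LE_def[symmetric] LIN_def)

definition SEMI :: "'w \<Rightarrow> 'a \<Rightarrow> bool" where
  "SEMI w i \<longleftrightarrow>
    (\<forall>v. w \<preceq> v \<longrightarrow> (\<forall>x. mem v x R \<longrightarrow> (\<forall>u. v \<preceq> u \<longrightarrow> (\<forall>y. A2 u N i x y \<longrightarrow> \<not> LT u y ze)))) \<and>
    (\<forall>v. w \<preceq> v \<longrightarrow> (\<forall>a. mem v a R \<longrightarrow> (\<forall>u. v \<preceq> u \<longrightarrow> (\<forall>x. mem u x R \<longrightarrow>
      (\<exists>b. (\<exists>y. A2 u mu a x y \<and> A2 u N i y b) \<and>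
        (\<exists>c. (\<exists>d. RA u a d \<and> (\<exists>y. A2 u N i x y \<and> A2 u mu d y c)) \<and> eq u b c)))))) \<and>
    (\<forall>v. w \<preceq> v \<longrightarrow> (\<forall>x. mem v x R \<longrightarrow> (\<forall>u. v \<preceq> u \<longrightarrow> (\<forall>y. mem u y R \<longrightarrow> (\<forall>t. u \<preceq> t \<longrightarrow>
      (\<forall>c. (\<exists>s. A2 t ad x y s \<and> A2 t N i s c) \<longrightarrow>
        (\<forall>d. (\<exists>a. A2 t N i x a \<and> (\<exists>b. A2 t N i y b \<and> A2 t ad a b d)) \<longrightarrow> \<not> LT t d c)))))))"

lemma FR_seminorm:
  assumes "TF p \<Gamma> F" "TV p \<Gamma> V" "TR p \<Gamma> i (\<lambda>w v. v = i')"
  shows "FR p \<Gamma> (seminorm F V i) (\<lambda>w. SEMI w i')"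
  unfolding seminorm_def
  by (rule FR_cong, (rule V_rules | rule TF_simps TV_simps assms | rule TF_insert TV_insert TR_insert)+)
    (simp add: LE_def[symmetric] SEMI_def)

definition QN :: "'w \<Rightarrow> bool" where
  "QN w \<longleftrightarrow> LIN w \<and> (\<exists>a. TM w I R a \<and> FN w N a R) \<and> (\<forall>v. w \<preceq> v \<longrightarrow> (\<forall>i. mem v i I \<longrightarrow> SEMI v i)) \<and>
    (\<forall>v. w \<preceq> v \<longrightarrow> (\<forall>x. mem v x R \<longrightarrow> (\<exists>m. mem v m R \<and> (\<forall>u. v \<preceq> u \<longrightarrow> (\<forall>i. mem u i I \<longrightarrow>
      (\<forall>t. u \<preceq> t \<longrightarrow> (\<forall>c. (\<exists>y. A2 t N i x y \<and> RA t y c) \<longrightarrow> \<not> LT t m c))))))) \<and>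
    (\<forall>v. w \<preceq> v \<longrightarrow> (\<forall>x. mem v x R \<longrightarrow> (\<forall>u. v \<preceq> u \<longrightarrow> (\<forall>y. mem u y R \<longrightarrow> (\<forall>t. u \<preceq> t \<longrightarrow>
      eq t x y = (\<forall>s. t \<preceq> s \<longrightarrow> (\<forall>i. mem s i I \<longrightarrow>
        (\<exists>c. (\<exists>z. VM s x y z \<and> A2 s N i z c) \<and> eq s c ze))))))))"

lemma FR_q_normed:
  assumes "TF p \<Gamma> F" "TV p \<Gamma> V"
  shows "FR p \<Gamma> (q_normed_space F V) QN"
  unfolding q_normed_space_def
  by (rule FR_cong, (rule FR_linear FR_seminorm V_rules | rule TF_simps TV_simps assms | rule TF_insert TV_insert TR_insert)+)
    (simp add: LE_def[symmetric] QN_def)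

definition FINDIM :: "'w \<Rightarrow> bool" where
  "FINDIM w \<longleftrightarrow> (\<exists>n. (\<exists>om. OM w om \<and> mem w n om) \<and> (\<exists>b\<in>D w. FN w b n R \<and>
    (\<forall>v. w \<preceq> v \<longrightarrow> (\<forall>x. mem v x R \<longrightarrow> (\<exists>l\<in>D v. FN v l n R \<and>
      (\<exists>s. FSUM v R ad ze n (\<lambda>k w z. \<exists>x. AP w l k x \<and> (\<exists>y. AP w b k y \<and> A2 w mu x y z)) s \<and> eq v x s)))) \<and>
    (\<forall>v. w \<preceq> v \<longrightarrow> (\<forall>l\<in>D v. \<forall>u. v \<preceq> u \<longrightarrow> FN u l n R \<longrightarrow> (\<forall>t. u \<preceq> t \<longrightarrow>
      (\<exists>s. FSUM t R ad ze n (\<lambda>k w y. \<exists>x. AP w l k x \<and> RA w x y) s \<and> LT t ze s) \<longrightarrow>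
      (\<exists>i. mem t i I \<and> (\<exists>c. (\<exists>z. (\<exists>s. FSUM t R ad ze n
        (\<lambda>k w z. \<exists>x. AP w l k x \<and> (\<exists>y. AP w b k y \<and> A2 w mu x y z)) s \<and> VM t s ze z) \<and> A2 t N i z c) \<and>
        LT t ze c)))))))"

lemma FR_finite_dimensional:
  assumes "TF p \<Gamma> F" "TV p \<Gamma> V"
  shows "FR p \<Gamma> (finite_dimensional F V) FINDIM"
  unfolding finite_dimensional_def is_basis_def vapart_def
  by (rule FR_cong, (rule TR_rsum TR_vsum TR_omega TR_app V_rules FR_is_fun | rule TF_simps TV_simps assms | rule TF_insert TV_insert TR_insert)+)
    (simp add: LE_def[symmetric] FINDIM_def)

definition TBD :: "'w \<Rightarrow> bool" where
  "TBD w \<longleftrightarrow> (\<forall>v. w \<preceq> v \<longrightarrow> (\<forall>e. mem v e R \<longrightarrow> (\<forall>u. v \<preceq> u \<longrightarrow> LT u ze e \<longrightarrow> (\<exists>A\<in>D u.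
    (\<exists>n. (\<exists>om. OM u om \<and> mem u n om) \<and> (\<exists>f\<in>D u. FN u f n A \<and>
      (\<forall>t. u \<preceq> t \<longrightarrow> (\<forall>y. mem t y A \<longrightarrow> (\<exists>k. mem t k n \<and> (\<exists>z. AP t f k z \<and> eq t z y)))))) \<and>
    (\<forall>t. u \<preceq> t \<longrightarrow> (\<forall>x. mem t x A \<longrightarrow> mem t x R \<and> (\<forall>s. t \<preceq> s \<longrightarrow> (\<forall>i. mem s i I \<longrightarrow>
      (\<forall>r. s \<preceq> r \<longrightarrow> (\<forall>c. A2 r N i x c \<longrightarrow> \<not> LT r on c)))))) \<and>
    (\<forall>t. u \<preceq> t \<longrightarrow> (\<forall>x\<in>D t. \<forall>s. t \<preceq> s \<longrightarrow> mem s x R \<and> (\<forall>r. s \<preceq> r \<longrightarrow> (\<forall>i. mem r i I \<longrightarrow>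
      (\<forall>q. r \<preceq> q \<longrightarrow> (\<forall>c. A2 q N i x c \<longrightarrow> \<not> LT q on c)))) \<longrightarrow>
      (\<exists>y. mem s y A \<and> (\<forall>r. s \<preceq> r \<longrightarrow> (\<forall>i. mem r i I \<longrightarrow>
        (\<exists>c. (\<exists>z. VM r x y z \<and> A2 r N i z c) \<and> LT r c e))))))))))"

lemma FR_totally_bounded:
  assumes "TF p \<Gamma> F" "TV p \<Gamma> V"
  shows "FR p \<Gamma> (totally_bounded F V (unit_ball F V)) TBD"
  unfolding totally_bounded_def unit_ball_def approximation_def finitely_enumerable_def
  by (rule FR_cong, (rule TR_omega TR_app V_rules | rule TF_simps TV_simps assms | rule TF_insert TV_insert TR_insert)+)
    (simp add: LE_def[symmetric] TBD_def)

end

context kripke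
begin

definition BSEQ :: "'w \<Rightarrow> 'a \<Rightarrow> bool" where
  "BSEQ w s \<longleftrightarrow> (\<exists>a. OM w a \<and> (\<exists>b. (\<exists>x. (\<exists>e. EM w e \<and> SC w e x) \<and> SC w x b) \<and> FN w s a b))"

definition WL :: "'w \<Rightarrow> 'a \<Rightarrow> bool" where
  "WL w s \<longleftrightarrow> (\<forall>v. w \<preceq> v \<longrightarrow> (\<forall>n. (\<exists>om. OM v om \<and> mem v n om) \<longrightarrow>
      (\<exists>x. AP v s n x \<and> (\<exists>e. EM v e \<and> eq v x e)))) \<or>
    (\<forall>v. w \<preceq> v \<longrightarrow> (\<exists>u. v \<preceq> u \<and> (\<exists>n. (\<exists>om. OM u om \<and> mem u n om) \<and>
      (\<forall>x. AP u s n x \<longrightarrow> (\<forall>e. EM u e \<longrightarrow> \<not> eq u x e)))))"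

lemma FR_WLPO:
  "FR p \<Gamma> WLPO (\<lambda>w. \<forall>v. w \<preceq> v \<longrightarrow> (\<forall>s\<in>D v. \<forall>u. v \<preceq> u \<longrightarrow> BSEQ u s \<longrightarrow> WL u s))"
  unfolding WLPO_def binary_sequence_def
  by (rule FR_cong, (rule TR_omega TR_succ TR_emp TR_app FR_is_fun FR_rules | rule TR_insert)+)
    (simp add: BSEQ_def WL_def)

end

locale reals_model = realctx le D mem eq R ad mu ls ze on
  for le :: "'w \<Rightarrow> 'w \<Rightarrow> bool" (infix "\<preceq>" 50) and D :: "'w \<Rightarrow> 'a set"
    and mem eq :: "'w \<Rightarrow> 'a \<Rightarrow> 'a \<Rightarrow> bool" and R ad mu ls ze on :: 'a +
  fixes w0 :: 'w
  assumes heyt: "HEYT w0" and ord: "ORD w0" and lub: "LUBP w0"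
begin

lemmas heyt' = heyt[unfolded HEYT_def]

lemma ring_facts:
  assumes "w0 \<preceq> v" "mem v x R" "mem v y R" "mem v z R"
  shows "(\<exists>a. A2 v ad x y a \<and> (\<exists>b. A2 v ad y x b \<and> eq v a b))"
    and "(\<exists>a. (\<exists>s. A2 v ad x y s \<and> A2 v ad s z a) \<and> (\<exists>b. (\<exists>s. A2 v ad y z s \<and> A2 v ad x s b) \<and> eq v a b))"
    and "(\<exists>a. A2 v mu x y a \<and> (\<exists>b. A2 v mu y x b \<and> eq v a b))"
    and "(\<exists>a. (\<exists>s. A2 v mu x y s \<and> A2 v mu s z a) \<and> (\<exists>b. (\<exists>s. A2 v mu y z s \<and> A2 v mu x s b) \<and> eq v a b))"
    and "(\<exists>a. (\<exists>s. A2 v ad y z s \<and> A2 v mu x s a) \<and>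
        (\<exists>b. (\<exists>s. A2 v mu x y s \<and> (\<exists>r. A2 v mu x z r \<and> A2 v ad s r b)) \<and> eq v a b))"
proof -
  note * = heyt'[THEN conjunct2, THEN conjunct2, THEN conjunct2, THEN conjunct2, THEN conjunct1,
    rule_format, OF assms(1,2) le_refl assms(3) le_refl assms(4)]
  note 2 = *[THEN conjunct2] note 3 = 2[THEN conjunct2] note 4 = 3[THEN conjunct2] note 5 = 4[THEN conjunct2]
  show "(\<exists>a. A2 v ad x y a \<and> (\<exists>b. A2 v ad y x b \<and> eq v a b))" by (rule *[THEN conjunct1])
  show "(\<exists>a. (\<exists>s. A2 v ad x y s \<and> A2 v ad s z a) \<and> (\<exists>b. (\<exists>s. A2 v ad y z s \<and> A2 v ad x s b) \<and> eq v a b))"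
    by (rule 2[THEN conjunct1])
  show "(\<exists>a. A2 v mu x y a \<and> (\<exists>b. A2 v mu y x b \<and> eq v a b))" by (rule 3[THEN conjunct1])
  show "(\<exists>a. (\<exists>s. A2 v mu x y s \<and> A2 v mu s z a) \<and> (\<exists>b. (\<exists>s. A2 v mu y z s \<and> A2 v mu x s b) \<and> eq v a b))"
    by (rule 4[THEN conjunct1])
  show "(\<exists>a. (\<exists>s. A2 v ad y z s \<and> A2 v mu x s a) \<and>
        (\<exists>b. (\<exists>s. A2 v mu x y s \<and> (\<exists>r. A2 v mu x z r \<and> A2 v ad s r b)) \<and> eq v a b))"
    by (rule 5)
qed

lemma zero_one_mem: "w0 \<preceq> v \<Longrightarrow> mem v ze R" "w0 \<preceq> v \<Longrightarrow> mem v on R"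
  using mem_mono heyt'[THEN conjunct2, THEN conjunct2, THEN conjunct1]
    heyt'[THEN conjunct2, THEN conjunct2, THEN conjunct2, THEN conjunct1] by metis+

lemma unit_facts:
  assumes "w0 \<preceq> v" "mem v x R"
  shows "\<exists>a. A2 v ad x ze a \<and> eq v a x" "\<exists>a. A2 v mu x on a \<and> eq v a x"
    "\<exists>y. mem v y R \<and> (\<exists>a. A2 v ad x y a \<and> eq v a ze)"
    "LT v ze x \<Longrightarrow> \<exists>y. mem v y R \<and> (\<exists>a. A2 v mu x y a \<and> eq v a on)"
  using heyt' assms le_refl by meson+

lemma order_facts:
  assumes "w0 \<preceq> v" "mem v x R" "mem v y R"
  shows "LT v x y \<Longrightarrow> \<not> LT v y x"
    "LT v x y \<Longrightarrow> mem v z R \<Longrightarrow> LT v x z \<or> LT v z y"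
    "(\<And>u. v \<preceq> u \<Longrightarrow> \<not> LT u x y \<and> \<not> LT u y x) \<Longrightarrow> eq v x y"
    "LT v x y \<Longrightarrow> mem v z R \<Longrightarrow> \<exists>a. A2 v ad x z a \<and> (\<exists>b. A2 v ad y z b \<and> LT v a b)"
    "LT v ze x \<Longrightarrow> LT v ze y \<Longrightarrow> \<exists>a. A2 v mu x y a \<and> LT v ze a"
proof -
  note * = ord[unfolded ORD_def, rule_format, OF assms(1,2) le_refl assms(3)]
  note 2 = *[THEN conjunct2] note 3 = 2[THEN conjunct2] note 4 = 3[THEN conjunct2] note 5 = 4[THEN conjunct2]
  show "LT v x y \<Longrightarrow> \<not> LT v y x" using *[THEN conjunct1] by simp
  show "LT v x y \<Longrightarrow> mem v z R \<Longrightarrow> LT v x z \<or> LT v z y"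
    by (rule 2[THEN conjunct1, rule_format, OF le_refl _ le_refl])
  show "(\<And>u. v \<preceq> u \<Longrightarrow> \<not> LT u x y \<and> \<not> LT u y x) \<Longrightarrow> eq v x y" using 3[THEN conjunct1] by simp
  show "LT v x y \<Longrightarrow> mem v z R \<Longrightarrow> \<exists>a. A2 v ad x z a \<and> (\<exists>b. A2 v ad y z b \<and> LT v a b)"
    by (rule 4[THEN conjunct1, rule_format, OF le_refl _ le_refl])
  show "LT v ze x \<Longrightarrow> LT v ze y \<Longrightarrow> \<exists>a. A2 v mu x y a \<and> LT v ze a" using 5 by simp
qed

lemma ad_ex: "w0 \<preceq> v \<Longrightarrow> mem v x R \<Longrightarrow> mem v y R \<Longrightarrow> \<exists>z. A2 v ad x y z \<and> mem v z R"
  using heyt'[THEN conjunct1] A2_ex by meson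

lemma mu_ex: "w0 \<preceq> v \<Longrightarrow> mem v x R \<Longrightarrow> mem v y R \<Longrightarrow> \<exists>z. A2 v mu x y z \<and> mem v z R"
  using heyt'[THEN conjunct2, THEN conjunct1] A2_ex by meson

lemma ad_unique: "w0 \<preceq> v \<Longrightarrow> mem v x R \<Longrightarrow> mem v y R \<Longrightarrow> A2 v ad x y z \<Longrightarrow> A2 v ad x y z' \<Longrightarrow> eq v z z'"
  using heyt'[THEN conjunct1] A2_unique by meson

lemma mu_unique: "w0 \<preceq> v \<Longrightarrow> mem v x R \<Longrightarrow> mem v y R \<Longrightarrow> A2 v mu x y z \<Longrightarrow> A2 v mu x y z' \<Longrightarrow> eq v z z'"
  using heyt'[THEN conjunct2, THEN conjunct1] A2_unique by meson

lemma mem_eq: "mem v x a \<Longrightarrow> eq v x y \<Longrightarrow> mem v y a"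
  by (meson mem_cong mem_D eq_refl)

lemma ad_range: "w0 \<preceq> v \<Longrightarrow> mem v x R \<Longrightarrow> mem v y R \<Longrightarrow> A2 v ad x y z \<Longrightarrow> mem v z R"
  using ad_ex[of v x y] ad_unique[of v x y] mem_eq by metis

lemma mu_range: "w0 \<preceq> v \<Longrightarrow> mem v x R \<Longrightarrow> mem v y R \<Longrightarrow> A2 v mu x y z \<Longrightarrow> mem v z R"
  using mu_ex[of v x y] mu_unique[of v x y] mem_eq by metis

lemma LT_mono: "LT v x y \<Longrightarrow> v \<preceq> w \<Longrightarrow> LT w x y"
  unfolding LT_def by (meson PR_mono mem_mono)

lemma LT_cong: "LT v x y \<Longrightarrow> eq v x x' \<Longrightarrow> eq v y y' \<Longrightarrow> LT v x' y'"
  unfolding LT_def by (meson PR_cong)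

lemma LE_cong: "LE v x y \<Longrightarrow> eq v x x' \<Longrightarrow> eq v y y' \<Longrightarrow> LE v x' y'"
  unfolding LE_def by (meson LT_cong eq_mono eq_sym)

subsection \<open>The real numbers at a world, modulo equality\<close>

text \<open>At a fixed world \<open>eq\<close> is an equivalence relation, and its classes of reals
  form an ordered ring with HOL equality. The classes change with the world, so passing to a later
  world is done on representatives.\<close>

definition cl :: "'w \<Rightarrow> 'a \<Rightarrow> 'a set" where
  "cl v x = {y. eq v x y}"

definition K :: "'w \<Rightarrow> 'a set set" where
  "K v = cl v ` {x. mem v x R}"

text \<open>The choice by \<open>SOME\<close> is harmless: for addition and multiplication of reals
  all values agree up to \<open>eq\<close>, so their class is determined.\<close>

definition op :: "'a \<Rightarrow> 'w \<Rightarrow> 'a set \<Rightarrow> 'a set \<Rightarrow> 'a set" where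
  "op f v X Y = cl v (SOME z. \<exists>x\<in>X. \<exists>y\<in>Y. A2 v f x y z)"

definition rel :: "('w \<Rightarrow> 'a \<Rightarrow> 'a \<Rightarrow> bool) \<Rightarrow> 'w \<Rightarrow> 'a set \<Rightarrow> 'a set \<Rightarrow> bool" where
  "rel r v X Y \<longleftrightarrow> (\<exists>x\<in>X. \<exists>y\<in>Y. r v x y)"

lemma cl_eq: "y \<in> D v \<Longrightarrow> cl v x = cl v y \<longleftrightarrow> eq v x y"
  unfolding cl_def using eq_refl eq_sym eq_trans by blast

lemma cl_eqI: "eq v x y \<Longrightarrow> cl v x = cl v y"
  using cl_eq eq_D by blast

lemma op_cl:
  assumes "A2 v f x y z" "x \<in> D v" "y \<in> D v" "\<And>z'. A2 v f x y z' \<Longrightarrow> eq v z' z"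
  shows "op f v (cl v x) (cl v y) = cl v z"
proof -
  let ?P = "\<lambda>z. \<exists>x'\<in>cl v x. \<exists>y'\<in>cl v y. A2 v f x' y' z"
  have "?P z" using assms(1-3) eq_refl unfolding cl_def by blast
  then have "?P (SOME z. ?P z)" by (rule someI)
  then obtain x' y' where *: "eq v x x'" "eq v y y'" "A2 v f x' y' (SOME z. ?P z)"
    unfolding cl_def by blast
  then have "A2 v f x y (SOME z. ?P z)" using A2_cong eq_sym eq_refl A2_D by meson
  then show ?thesis unfolding op_def by (intro cl_eqI assms(4))
qed

lemma pl_cl: "w0 \<preceq> v \<Longrightarrow> mem v x R \<Longrightarrow> mem v y R \<Longrightarrow> A2 v ad x y z \<Longrightarrow> op ad v (cl v x) (cl v y) = cl v z"
  by (rule op_cl) (auto dest: mem_D intro: ad_unique)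

lemma ti_cl: "w0 \<preceq> v \<Longrightarrow> mem v x R \<Longrightarrow> mem v y R \<Longrightarrow> A2 v mu x y z \<Longrightarrow> op mu v (cl v x) (cl v y) = cl v z"
  by (rule op_cl) (auto dest: mem_D intro: mu_unique)

lemma lt_cl: "mem v x R \<Longrightarrow> mem v y R \<Longrightarrow> rel LT v (cl v x) (cl v y) \<longleftrightarrow> LT v x y"
  unfolding rel_def cl_def by (auto dest: mem_D intro: eq_refl eq_sym LT_cong)

lemma le_cl: "mem v x R \<Longrightarrow> mem v y R \<Longrightarrow> rel LE v (cl v x) (cl v y) \<longleftrightarrow> LE v x y"
  unfolding rel_def cl_def by (auto dest: mem_D intro: eq_refl eq_sym LE_cong)

lemma cl_K: "mem v x R \<Longrightarrow> cl v x \<in> K v"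
  unfolding K_def by blast

lemma K_E: "X \<in> K v \<Longrightarrow> (\<And>x. mem v x R \<Longrightarrow> X = cl v x \<Longrightarrow> thesis) \<Longrightarrow> thesis"
  unfolding K_def by blast

lemma oring_at:
  assumes v: "w0 \<preceq> v"
  shows "oring (K v) (op ad v) (op mu v) (cl v ze) (cl v on) (rel LT v)"
proof
  note pl = pl_cl[OF v] and ti = ti_cl[OF v] and adr = ad_range[OF v] and mur = mu_range[OF v]
  fix a b assume "a \<in> K v" "b \<in> K v"
  then obtain x y where x: "mem v x R" "a = cl v x" and y: "mem v y R" "b = cl v y" by (elim K_E)
  show "op ad v a b \<in> K v" using ad_ex[OF v x(1) y(1)] pl[OF x(1) y(1)] x y cl_K by metis
  show "op mu v a b \<in> K v" using mu_ex[OF v x(1) y(1)] ti[OF x(1) y(1)] x y cl_K by metis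
  show "op ad v a b = op ad v b a"
    using ring_facts(1)[OF v x(1) y(1) y(1)] pl[OF x(1) y(1)] pl[OF y(1) x(1)] x y cl_eqI by metis
  show "op mu v a b = op mu v b a"
    using ring_facts(3)[OF v x(1) y(1) y(1)] ti[OF x(1) y(1)] ti[OF y(1) x(1)] x y cl_eqI by metis
  show "rel LT v a b \<Longrightarrow> \<not> rel LT v b a" using order_facts(1)[OF v x(1) y(1)] lt_cl x y by simp
  show "rel LT v (cl v ze) a \<Longrightarrow> rel LT v (cl v ze) b \<Longrightarrow> rel LT v (cl v ze) (op mu v a b)"
  proof -
    assume "rel LT v (cl v ze) a" "rel LT v (cl v ze) b"
    then have "LT v ze x" "LT v ze y"
      using lt_cl[OF zero_one_mem(1)[OF v] x(1)] lt_cl[OF zero_one_mem(1)[OF v] y(1)] x y by simp_all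
    then obtain c where h: "A2 v mu x y c" "LT v ze c"
      using order_facts(5)[OF v x(1) y(1)] by (elim meta_impE exE conjE)
    show ?thesis
      using h(2) by (simp only: x(2) y(2) ti[OF x(1) y(1) h(1)]
          lt_cl[OF zero_one_mem(1)[OF v] mur[OF x(1) y(1) h(1)]])
  qed
  fix c assume "c \<in> K v"
  then obtain z where z: "mem v z R" "c = cl v z" by (elim K_E)
  show "op ad v (op ad v a b) c = op ad v a (op ad v b c)"
  proof -
    obtain p s q t where h: "A2 v ad x y s" "A2 v ad s z p" "A2 v ad y z t" "A2 v ad x t q" "eq v p q"
      using ring_facts(2)[OF v x(1) y(1) z(1)] by (elim exE conjE)
    have "op ad v (op ad v a b) c = cl v p"
      by (simp only: x(2) y(2) z(2) pl[OF x(1) y(1) h(1)] pl[OF adr[OF x(1) y(1) h(1)] z(1) h(2)])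
    moreover have "op ad v a (op ad v b c) = cl v q"
      by (simp only: x(2) y(2) z(2) pl[OF y(1) z(1) h(3)] pl[OF x(1) adr[OF y(1) z(1) h(3)] h(4)])
    ultimately show ?thesis using cl_eqI[OF h(5)] by simp
  qed
  show "op mu v (op mu v a b) c = op mu v a (op mu v b c)"
  proof -
    obtain p s q t where h: "A2 v mu x y s" "A2 v mu s z p" "A2 v mu y z t" "A2 v mu x t q" "eq v p q"
      using ring_facts(4)[OF v x(1) y(1) z(1)] by (elim exE conjE)
    have "op mu v (op mu v a b) c = cl v p"
      by (simp only: x(2) y(2) z(2) ti[OF x(1) y(1) h(1)] ti[OF mur[OF x(1) y(1) h(1)] z(1) h(2)])
    moreover have "op mu v a (op mu v b c) = cl v q"
      by (simp only: x(2) y(2) z(2) ti[OF y(1) z(1) h(3)] ti[OF x(1) mur[OF y(1) z(1) h(3)] h(4)])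
    ultimately show ?thesis using cl_eqI[OF h(5)] by simp
  qed
  show "op mu v a (op ad v b c) = op ad v (op mu v a b) (op mu v a c)"
  proof -
    obtain p s q t r where h: "A2 v ad y z s" "A2 v mu x s p" "A2 v mu x y t" "A2 v mu x z r" "A2 v ad t r q" "eq v p q"
      using ring_facts(5)[OF v x(1) y(1) z(1)] by (elim exE conjE)
    have "op mu v a (op ad v b c) = cl v p"
      by (simp only: x(2) y(2) z(2) pl[OF y(1) z(1) h(1)] ti[OF x(1) adr[OF y(1) z(1) h(1)] h(2)])
    moreover have "op ad v (op mu v a b) (op mu v a c) = cl v q"
      by (simp only: x(2) y(2) z(2) ti[OF x(1) y(1) h(3)] ti[OF x(1) z(1) h(4)]
          pl[OF mur[OF x(1) y(1) h(3)] mur[OF x(1) z(1) h(4)] h(5)])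
    ultimately show ?thesis using cl_eqI[OF h(6)] by simp
  qed
  show "rel LT v a b \<Longrightarrow> rel LT v a c \<or> rel LT v c b"
    using order_facts(2)[OF v x(1) y(1) _ z(1)] lt_cl x y z by simp
  show "rel LT v a b \<Longrightarrow> rel LT v (op ad v a c) (op ad v b c)"
  proof -
    assume "rel LT v a b"
    then have "LT v x y" using lt_cl[OF x(1) y(1)] x y by simp
    then obtain p q where h: "A2 v ad x z p" "A2 v ad y z q" "LT v p q"
      using order_facts(4)[OF v x(1) y(1) _ z(1)] by (elim meta_impE exE conjE)
    show ?thesis
      using h(3) by (simp only: x(2) y(2) z(2) pl[OF x(1) z(1) h(1)] pl[OF y(1) z(1) h(2)]
          lt_cl[OF adr[OF x(1) z(1) h(1)] adr[OF y(1) z(1) h(2)]])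
  qed
next
  show "cl v ze \<in> K v" "cl v on \<in> K v" using zero_one_mem[OF v] cl_K by blast+
  show "rel LT v (cl v ze) (cl v on) \<or> rel LT v (cl v on) (cl v ze)"
    using heyt' lt_cl zero_one_mem[OF v] LT_mono[OF _ v] by meson
  fix a assume "a \<in> K v"
  then obtain x where x: "mem v x R" "a = cl v x" by (elim K_E)
  show "op ad v a (cl v ze) = a"
    using unit_facts(1)[OF v x(1)] pl_cl[OF v x(1) zero_one_mem(1)[OF v]] x cl_eqI by metis
  show "op mu v a (cl v on) = a"
    using unit_facts(2)[OF v x(1)] ti_cl[OF v x(1) zero_one_mem(2)[OF v]] x cl_eqI by metis
  show "\<exists>b\<in>K v. op ad v a b = cl v ze"
    using unit_facts(3)[OF v x(1)] pl_cl[OF v x(1)] x cl_eqI cl_K by metis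
  show "rel LT v (cl v ze) a \<Longrightarrow> \<exists>b\<in>K v. op mu v a b = cl v on"
    using unit_facts(4)[OF v x(1)] ti_cl[OF v x(1)] x cl_eqI cl_K lt_cl zero_one_mem(1)[OF v] by metis
qed

lemma LE_trans:
  assumes "w0 \<preceq> v" "mem v x R" "mem v y R" "mem v z R" "LE v x y" "LE v y z"
  shows "LE v x z"
  unfolding LE_def
proof (intro allI impI notI)
  fix u assume u: "v \<preceq> u" "LT u z x"
  have "mem u x R" "mem u y R" "mem u z R" "w0 \<preceq> u" using assms u mem_mono le_trans by blast+
  then have "LT u z y \<or> LT u y x" using order_facts(2) u(2) by blast
  then show False using assms(5,6) u(1) unfolding LE_def by blast
qed

lemma LT_LE: "w0 \<preceq> v \<Longrightarrow> mem v x R \<Longrightarrow> mem v y R \<Longrightarrow> LT v x y \<Longrightarrow> LE v x y"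
  unfolding LE_def using order_facts(1) LT_mono le_trans mem_mono by meson

text \<open>A strict inequality against the claim at a later world can be cancelled there, and then
  contradicts \<open>LE v x y\<close>.\<close>

lemma LE_add:
  assumes v: "w0 \<preceq> v" and R: "mem v x R" "mem v y R" "mem v z R" and le: "LE v x y"
    and A: "A2 v ad x z a" "A2 v ad y z b"
  shows "LE v a b"
  unfolding LE_def
proof (intro allI impI notI)
  fix u assume u: "v \<preceq> u" "LT u b a"
  have w: "w0 \<preceq> u" using v u le_trans by blast
  interpret o: oring "K u" "op ad u" "op mu u" "cl u ze" "cl u on" "rel LT u" by (rule oring_at[OF w])
  have Ru: "mem u x R" "mem u y R" "mem u z R" using R u mem_mono by blast+
  have Au: "A2 u ad x z a" "A2 u ad y z b" using A u A2_mono by blast+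
  have "mem u a R" "mem u b R" using ad_range[OF w] Ru Au by blast+
  then have "rel LT u (op ad u (cl u y) (cl u z)) (op ad u (cl u x) (cl u z))"
    using pl_cl[OF w Ru(1,3) Au(1)] pl_cl[OF w Ru(2,3) Au(2)] lt_cl u by simp
  then have "rel LT u (cl u y) (cl u x)" using o.lt_add_cancel Ru cl_K by blast
  then show False using lt_cl Ru le u(1) unfolding LE_def by blast
qed

lemma ofield_at:
  assumes v: "w0 \<preceq> v"
  shows "ofield (K v) (op ad v) (op mu v) (cl v ze) (cl v on) (rel LT v) (rel LE v)"
proof (intro ofield.intro ofield_axioms.intro oring_at[OF v])
  fix a b assume "a \<in> K v" "b \<in> K v"
  then obtain x y where x: "mem v x R" "a = cl v x" and y: "mem v y R" "b = cl v y" by (elim K_E)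
  show "rel LE v a b \<Longrightarrow> \<not> rel LT v b a" using lt_cl le_cl x y le_refl unfolding LE_def by blast
  show "rel LT v a b \<Longrightarrow> rel LE v a b" using lt_cl le_cl x y LT_LE[OF v] by blast
  show "rel LE v a b \<Longrightarrow> rel LE v b a \<Longrightarrow> a = b"
  proof -
    assume "rel LE v a b" "rel LE v b a"
    then have "eq v x y" using le_cl x y unfolding LE_def by (intro order_facts(3)[OF v]) auto
    then show ?thesis using x y cl_eqI by blast
  qed
  fix c assume "c \<in> K v"
  then obtain z where z: "mem v z R" "c = cl v z" by (elim K_E)
  show "rel LE v a b \<Longrightarrow> rel LE v b c \<Longrightarrow> rel LE v a c"
    using le_cl x y z LE_trans[OF v x(1) y(1) z(1)] by simp
  show "rel LE v a b \<Longrightarrow> rel LE v (op ad v a c) (op ad v b c)"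
  proof -
    assume "rel LE v a b"
    moreover obtain p where p: "A2 v ad x z p" "mem v p R" using ad_ex[OF v x(1) z(1)] by blast
    moreover obtain q where q: "A2 v ad y z q" "mem v q R" using ad_ex[OF v y(1) z(1)] by blast
    ultimately have "LE v p q" using LE_add[OF v x(1) y(1) z(1)] le_cl x y by blast
    then show ?thesis using pl_cl[OF v x(1) z(1) p(1)] pl_cl[OF v y(1) z(1) q(1)] le_cl p q x y z by simp
  qed
next
  fix a assume "a \<in> K v"
  then obtain x where x: "mem v x R" "a = cl v x" by (elim K_E)
  have "LE v x x" unfolding LE_def using order_facts(1) v x mem_mono le_trans by meson
  then show "rel LE v a a" using le_cl x by simp
qed

end

context reals_model
begin

subsection \<open>The absolute value\<close>

abbreviation ISABS :: "'w \<Rightarrow> 'a set \<Rightarrow> 'a set \<Rightarrow> bool" where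
  "ISABS v \<equiv> ofield.isabs (K v) (op ad v) (cl v ze) (rel LE v)"

lemma NG_mono: "NG v x y \<Longrightarrow> v \<preceq> w \<Longrightarrow> NG w x y"
  unfolding NG_def by (meson mem_mono A2_mono eq_mono)

lemma RA_mono: "RA v x m \<Longrightarrow> v \<preceq> w \<Longrightarrow> RA w x m"
  unfolding RA_def by (meson NG_mono LE_mono mem_mono le_trans)

lemma NG_ex: "w0 \<preceq> v \<Longrightarrow> mem v x R \<Longrightarrow> \<exists>y. NG v x y"
  using unit_facts(3) unfolding NG_def by blast

lemma NG_ng:
  assumes v: "w0 \<preceq> v" and x: "mem v x R" and y: "NG v x y"
  shows "cl v y = oring.ng (K v) (op ad v) (cl v ze) (cl v x)"
proof -
  interpret o: ofield "K v" "op ad v" "op mu v" "cl v ze" "cl v on" "rel LT v" "rel LE v"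
    by (rule ofield_at[OF v])
  obtain z where z: "mem v y R" "A2 v ad x y z" "eq v z ze" using y unfolding NG_def by blast
  have "op ad v (cl v x) (cl v y) = cl v ze" using pl_cl[OF v x z(1,2)] cl_eqI[OF z(3)] by simp
  then show ?thesis by (rule o.ng_unique[OF cl_K[OF x] cl_K[OF z(1)]])
qed

lemma RA_range: "RA v x m \<Longrightarrow> mem v m R"
  unfolding RA_def by blast

lemma RA_isabs:
  assumes v: "w0 \<preceq> v" and x: "mem v x R" and m: "RA v x m"
  shows "ISABS v (cl v x) (cl v m)"
proof -
  interpret o: ofield "K v" "op ad v" "op mu v" "cl v ze" "cl v on" "rel LT v" "rel LE v"
    by (rule ofield_at[OF v])
  obtain y where y: "NG v x y" "mem v m R" "LE v x m" "LE v y m"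
    "\<forall>u. v \<preceq> u \<longrightarrow> (\<forall>b. mem u b R \<longrightarrow> LE u x b \<longrightarrow> LE u y b \<longrightarrow> LE u m b)"
    using m unfolding RA_def by blast
  have yR: "mem v y R" using y(1) unfolding NG_def by blast
  have "\<forall>b\<in>K v. rel LE v (cl v x) b \<longrightarrow> rel LE v (cl v y) b \<longrightarrow> rel LE v (cl v m) b"
  proof (intro ballI impI)
    fix b assume "b \<in> K v" and le: "rel LE v (cl v x) b" "rel LE v (cl v y) b"
    then obtain c where c: "mem v c R" "b = cl v c" by (elim K_E)
    then have "LE v m c" using y(5)[rule_format, OF le_refl c(1)] le le_cl x yR by blast
    then show "rel LE v (cl v m) b" using le_cl c y(2) by blast
  qed
  then show ?thesis
    unfolding o.isabs_def NG_ng[OF v x y(1), symmetric]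
    using cl_K[OF y(2)] le_cl[OF x y(2)] le_cl[OF yR y(2)] y by simp
qed

lemma RA_cong:
  assumes v: "w0 \<preceq> v" and x: "mem v x R" and m: "RA v x m" and e: "eq v x x'" "eq v m m'"
  shows "RA v x' m'"
proof -
  obtain y where y: "NG v x y" "mem v m R" "LE v x m" "LE v y m"
    "\<forall>u. v \<preceq> u \<longrightarrow> (\<forall>b. mem u b R \<longrightarrow> LE u x b \<longrightarrow> LE u y b \<longrightarrow> LE u m b)"
    using m unfolding RA_def by blast
  have yy: "mem v y R" "eq v y y" using y(1) mem_D eq_refl unfolding NG_def by blast+
  have 1: "NG v x' y" using y(1) A2_cong[OF _ e(1) yy(2)] A2_D eq_refl unfolding NG_def by metis
  have 2: "mem v m' R" using mem_eq[OF y(2) e(2)] .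
  have 3: "LE v x' m'" "LE v y m'" using LE_cong[OF y(3) e] LE_cong[OF y(4) yy(2) e(2)] by simp_all
  have 4: "LE u m' b" if u: "v \<preceq> u" "mem u b R" "LE u x' b" "LE u y b" for u b
  proof -
    have b: "eq u b b" "eq u x' x" "eq u m m'" using u mem_D eq_refl e eq_mono eq_sym by blast+
    have "LE u m b" using y(5) u LE_cong[OF u(3) b(2,1)] by blast
    then show ?thesis using LE_cong b by blast
  qed
  show ?thesis unfolding RA_def using 1 2 3 4 by blast
qed

lemma RA_unique:
  assumes v: "w0 \<preceq> v" and x: "mem v x R" and m: "RA v x m" "RA v x n"
  shows "eq v m n"
proof -
  interpret o: ofield "K v" "op ad v" "op mu v" "cl v ze" "cl v on" "rel LT v" "rel LE v"
    by (rule ofield_at[OF v])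
  have "cl v m = cl v n"
    by (rule o.isabs_unique[OF RA_isabs[OF v x m(1)] RA_isabs[OF v x m(2)]])
  then show ?thesis using cl_eq mem_D[OF RA_range[OF m(2)]] by blast
qed

lemma RA_nonneg:
  assumes v: "w0 \<preceq> v" and x: "mem v x R" and m: "RA v x m"
  shows "LE v ze m"
  unfolding LE_def
proof (intro allI impI)
  fix u assume u: "v \<preceq> u"
  have w: "w0 \<preceq> u" using v u le_trans by blast
  have xu: "mem u x R" "RA u x m" using x m u mem_mono RA_mono by blast+
  interpret o: ofield "K u" "op ad u" "op mu u" "cl u ze" "cl u on" "rel LT u" "rel LE u"
    by (rule ofield_at[OF w])
  have "\<not> rel LT u (cl u m) (cl u ze)"
    by (rule o.isabs_not_neg[OF cl_K[OF xu(1)] RA_isabs[OF w xu]])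
  then show "\<not> LT u m ze" using lt_cl[OF RA_range[OF xu(2)] zero_one_mem(1)[OF w]] by simp
qed

text \<open>No sign has to be decided: by cotransitivity for \<open>0 < 1\<close>, either
  \<open>x\<close> is positive and bounds its negative, or the negative is positive and bounds
  \<open>x\<close>, or both are below 1.\<close>

lemma upper_bound_ex:
  assumes v: "w0 \<preceq> v" and x: "mem v x R" and y: "NG v x y"
  shows "\<exists>b. mem v b R \<and> LE v x b \<and> LE v y b"
proof -
  interpret o: ofield "K v" "op ad v" "op mu v" "cl v ze" "cl v on" "rel LT v" "rel LE v"
    by (rule ofield_at[OF v])
  note zo = zero_one_mem[OF v]
  have yR: "mem v y R" using y unfolding NG_def by blast
  have ng: "cl v y = o.ng (cl v x)" by (rule NG_ng[OF v x y])
  have "LT v ze on" using o.zero_lt_one lt_cl zo by blast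
  then have c: "LT v ze x \<or> LT v x on" "LT v ze y \<or> LT v y on"
    using order_facts(2)[OF v zo] x yR by blast+
  have r: "LE v x x" "LE v y y"
    using o.le_refl[OF cl_K[OF x]] o.le_refl[OF cl_K[OF yR]] le_cl x yR by blast+
  have 1: "LE v y x" if "LT v ze x"
  proof -
    have *: "rel LT v (cl v ze) (cl v x)" using that lt_cl zo x by blast
    have "rel LE v (cl v ze) (cl v x)" by (rule o.lt_le[OF cl_K[OF zo(1)] cl_K[OF x] *])
    moreover have "rel LE v (cl v y) (cl v ze)"
      unfolding ng by (rule o.le_ng[OF cl_K[OF x] calculation])
    ultimately have "rel LE v (cl v y) (cl v x)"
      using o.le_trans[OF cl_K[OF yR] cl_K[OF zo(1)] cl_K[OF x]] by blast
    then show ?thesis using le_cl yR x by blast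
  qed
  have 2: "LE v x y" if "LT v ze y"
  proof -
    have *: "rel LT v (cl v ze) (cl v y)" using that lt_cl zo yR by blast
    have a: "rel LE v (cl v ze) (cl v y)" by (rule o.lt_le[OF cl_K[OF zo(1)] cl_K[OF yR] *])
    have "rel LE v (o.ng (cl v y)) (cl v ze)" by (rule o.le_ng[OF cl_K[OF yR] a])
    then have "rel LE v (cl v x) (cl v ze)" using ng o.ng_ng[OF cl_K[OF x]] by simp
    then have "rel LE v (cl v x) (cl v y)"
      using o.le_trans[OF cl_K[OF x] cl_K[OF zo(1)] cl_K[OF yR] _ a] by blast
    then show ?thesis using le_cl yR x by blast
  qed
  show ?thesis
    using c 1 2 r x yR zo(2) LT_LE[OF v x zo(2)] LT_LE[OF v yR zo(2)] by blast
qed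

text \<open>The axioms for the reals provide no maximum; the absolute value is the supremum of the
  pair set of \<open>x\<close> and its negative.\<close>

lemma abs_ex:
  assumes v: "w0 \<preceq> v" and x: "mem v x R"
  shows "\<exists>m. RA v x m"
proof -
  obtain y where y: "NG v x y" using NG_ex[OF v x] by blast
  have yR: "mem v y R" using y unfolding NG_def by blast
  obtain b0 where b0: "mem v b0 R" "LE v x b0" "LE v y b0" using upper_bound_ex[OF v x y] by blast
  obtain S where S: "UP v x y S" using pairing mem_D[OF x] mem_D[OF yR] by blast
  have mS: "mem u s S \<longleftrightarrow> eq u s x \<or> eq u s y" if "v \<preceq> u" for u s
    using S that unfolding UP_def by blast
  have xS: "mem u x S" "mem u y S" if "v \<preceq> u" for u
    using mS[OF that] mem_mono[OF that x] mem_mono[OF that yR] mem_D eq_refl by blast+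
  have SD: "S \<in> D v" using S by (simp add: UP_def)
  have le: "LE u s b" if h: "v \<preceq> u" "LE u x b" "LE u y b" "mem u s S" "mem u b R" for u s b
  proof -
    have b: "eq u b b" using mem_D[OF h(5)] eq_refl by blast
    from h(4) have "eq u x s \<or> eq u y s" using mS[OF h(1)] eq_sym by blast
    then show ?thesis using LE_cong[OF h(2) _ b] LE_cong[OF h(3) _ b] by blast
  qed
  have "\<exists>b. mem v b R \<and> (\<forall>t. v \<preceq> t \<longrightarrow> (\<forall>s. mem t s S \<longrightarrow> LE t s b)) \<and>
      (\<forall>t. v \<preceq> t \<longrightarrow> (\<forall>x. mem t x R \<longrightarrow> (\<forall>r. t \<preceq> r \<longrightarrow> LT r x b \<longrightarrow> (\<exists>s. mem r s S \<and> LT r x s))))"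
  proof (rule lub[unfolded LUBP_def, rule_format, OF v SD le_refl], intro conjI allI impI)
    fix t s assume "v \<preceq> t" "mem t s S"
    then show "mem t s R" using mS mem_eq mem_mono x yR eq_sym by meson
  next
    show "\<exists>s\<in>D v. mem v s S" using xS[OF le_refl] mem_D by blast
    show "\<exists>b. mem v b R \<and> (\<forall>t. v \<preceq> t \<longrightarrow> (\<forall>s. mem t s S \<longrightarrow> LE t s b))"
      using b0 le LE_mono mem_mono by meson
    \<comment> \<open>The constructive condition on the set: for \<open>p < q\<close>,
      cotransitivity puts each of \<open>x\<close> and \<open>y\<close> above \<open>p\<close> or
      below \<open>q\<close>.\<close>
    fix t p r q k assume *: "v \<preceq> t" "mem t p R" "t \<preceq> r" "mem r q R" "r \<preceq> k" "LT k p q"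
    have vk: "v \<preceq> k" "w0 \<preceq> k" using * v le_trans by meson+
    have R: "mem k p R" "mem k q R" "mem k x R" "mem k y R"
      using * x yR vk mem_mono le_trans by meson+
    have "LT k p x \<or> LT k x q" "LT k p y \<or> LT k y q"
      using order_facts(2)[OF vk(2) R(1,2) *(6)] R(3,4) by blast+
    moreover have "\<forall>q'. k \<preceq> q' \<longrightarrow> (\<forall>s. mem q' s S \<longrightarrow> LE q' s q)" if "LT k x q" "LT k y q"
    proof (intro allI impI)
      fix q' s assume q': "k \<preceq> q'" "mem q' s S"
      have "LE k x q" "LE k y q" using LT_LE[OF vk(2)] R that by blast+
      then have "LE q' x q" "LE q' y q" using LE_mono q'(1) by blast+
      then show "LE q' s q" using le q' vk(1) le_trans R(2) mem_mono by meson
    qed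
    ultimately show "(\<forall>q'. k \<preceq> q' \<longrightarrow> (\<forall>s. mem q' s S \<longrightarrow> LE q' s q)) \<or> (\<exists>s. mem k s S \<and> LT k p s)"
      using xS[OF vk(1)] by blast
  qed
  then obtain m where m0: "mem v m R" "\<forall>t. v \<preceq> t \<longrightarrow> (\<forall>s. mem t s S \<longrightarrow> LE t s m)"
    "\<forall>t. v \<preceq> t \<longrightarrow> (\<forall>x. mem t x R \<longrightarrow> (\<forall>r. t \<preceq> r \<longrightarrow> LT r x m \<longrightarrow> (\<exists>s. mem r s S \<and> LT r x s)))"
    by (elim exE conjE)
  note m = m0(1) m0(2,3)[rule_format]
  have "LE u m b" if u: "v \<preceq> u" "mem u b R" "LE u x b" "LE u y b" for u b
    unfolding LE_def
  proof (intro allI impI notI)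
    fix t assume t: "u \<preceq> t" "LT t b m"
    then obtain s where s: "mem t s S" "LT t b s" using m(3)[OF u(1,2) t] by blast
    have "LE t s b" using le[of t b s] LE_mono t(1) u s(1) le_trans mem_mono by meson
    then show False using s(2) unfolding LE_def by blast
  qed
  then have "RA v x m" unfolding RA_def using y m(1) m(2)[OF le_refl] xS[OF le_refl] by blast
  then show ?thesis by blast
qed

text \<open>Tightness of apartness: if neither strict inequality ever holds later, equality is
  already forced at \<open>v\<close>.\<close>

lemma trichotomy_later:
  assumes v: "w0 \<preceq> v" and x: "mem v x R"
  shows "\<exists>u. v \<preceq> u \<and> (LT u x ze \<or> eq u x ze \<or> LT u ze x)"
proof (rule ccontr)
  assume n: "\<not> ?thesis"
  then have "eq v x ze" by (intro order_facts(3)[OF v x zero_one_mem(1)[OF v]]) blast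
  then show False using n le_refl by blast
qed

text \<open>
  Equality of real numbers is stable under double negation, so that the signs of the factors may be
  assumed to be decided: they are decided at some later world.
\<close>

lemma RA_mult:
  assumes v: "w0 \<preceq> v" and R: "mem v x R" "mem v y R"
    and A: "RA v x a" "RA v y b" "A2 v mu x y z" "RA v z c" "A2 v mu a b d"
  shows "eq v c d"
proof (rule order_facts(3)[OF v])
  have zR: "mem v z R" by (rule mu_range[OF v R A(3)])
  show cR: "mem v c R" by (rule RA_range[OF A(4)])
  show dR: "mem v d R" by (rule mu_range[OF v RA_range[OF A(1)] RA_range[OF A(2)] A(5)])
  fix u assume u: "v \<preceq> u"
  have wu: "w0 \<preceq> u" using v u le_trans by blast
  obtain t1 where t1: "u \<preceq> t1" "LT t1 x ze \<or> eq t1 x ze \<or> LT t1 ze x"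
    using trichotomy_later[OF wu mem_mono[OF u R(1)]] by blast
  have wt1: "w0 \<preceq> t1" "v \<preceq> t1" using wu t1 u le_trans by blast+
  obtain t where t: "t1 \<preceq> t" "LT t y ze \<or> eq t y ze \<or> LT t ze y"
    using trichotomy_later[OF wt1(1) mem_mono[OF wt1(2) R(2)]] by blast
  have vt: "v \<preceq> t" "w0 \<preceq> t" "u \<preceq> t" using wt1 t t1 le_trans by blast+
  have x3: "LT t x ze \<or> eq t x ze \<or> LT t ze x" using t1(2) t(1) LT_mono eq_mono by blast
  interpret o: ofield "K t" "op ad t" "op mu t" "cl t ze" "cl t on" "rel LT t" "rel LE t"
    by (rule ofield_at[OF vt(2)])
  note mm = mem_mono[OF vt(1)]
  have Rt: "mem t x R" "mem t y R" "mem t z R" "mem t c R" "mem t d R" "mem t ze R"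
    using mm R zR cR dR zero_one_mem(1)[OF v] by blast+
  have At: "RA t x a" "RA t y b" "A2 t mu x y z" "RA t z c" "A2 t mu a b d"
    using A RA_mono A2_mono vt(1) by blast+
  have isz: "ISABS t (op mu t (cl t x) (cl t y)) (cl t c)"
    unfolding ti_cl[OF vt(2) Rt(1,2) At(3)] by (rule RA_isabs[OF vt(2) Rt(3) At(4)])
  have "cl t c = op mu t (cl t a) (cl t b)"
  proof (rule o.isabs_mult[OF cl_K[OF Rt(1)] cl_K[OF Rt(2)] RA_isabs[OF vt(2) Rt(1) At(1)]
      RA_isabs[OF vt(2) Rt(2) At(2)] isz])
    show "rel LT t (cl t x) (cl t ze) \<or> cl t x = cl t ze \<or> rel LT t (cl t ze) (cl t x)"
      using x3 lt_cl[OF Rt(1,6)] lt_cl[OF Rt(6,1)] cl_eqI by blast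
    show "rel LT t (cl t y) (cl t ze) \<or> cl t y = cl t ze \<or> rel LT t (cl t ze) (cl t y)"
      using t(2) lt_cl[OF Rt(2,6)] lt_cl[OF Rt(6,2)] cl_eqI by blast
  qed
  then have "cl t c = cl t d"
    using ti_cl[OF vt(2) RA_range[OF At(1)] RA_range[OF At(2)] At(5)] by simp
  then have "\<not> LT t c d" "\<not> LT t d c"
    using o.lt_irrefl[OF cl_K[OF Rt(4)]] lt_cl[OF Rt(4,5)] lt_cl[OF Rt(5,4)] by simp_all
  then show "\<not> LT u c d \<and> \<not> LT u d c" using LT_mono vt(3) by blast
qed

lemma RA_triangle:
  assumes v: "w0 \<preceq> v" and R: "mem v x R" "mem v y R"
    and A: "RA v x a" "RA v y b" "A2 v ad x y z" "RA v z c" "A2 v ad a b d"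
  shows "LE v c d"
proof -
  interpret o: ofield "K v" "op ad v" "op mu v" "cl v ze" "cl v on" "rel LT v" "rel LE v"
    by (rule ofield_at[OF v])
  have zR: "mem v z R" by (rule ad_range[OF v R A(3)])
  have isz: "ISABS v (op ad v (cl v x) (cl v y)) (cl v c)"
    unfolding pl_cl[OF v R A(3)] by (rule RA_isabs[OF v zR A(4)])
  have "rel LE v (cl v c) (op ad v (cl v a) (cl v b))"
    by (rule o.isabs_triangle[OF cl_K[OF R(1)] cl_K[OF R(2)] RA_isabs[OF v R(1) A(1)]
      RA_isabs[OF v R(2) A(2)] isz])
  then show ?thesis
    using pl_cl[OF v RA_range[OF A(1)] RA_range[OF A(2)] A(5)] le_cl[OF RA_range[OF A(4)]]
      ad_range[OF v RA_range[OF A(1)] RA_range[OF A(2)] A(5)] by simp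
qed

lemma RA_zero:
  assumes v: "w0 \<preceq> v" and x: "mem v x R" and m: "RA v x m" "eq v m ze"
  shows "eq v x ze"
proof -
  interpret o: ofield "K v" "op ad v" "op mu v" "cl v ze" "cl v on" "rel LT v" "rel LE v"
    by (rule ofield_at[OF v])
  have "ISABS v (cl v x) (cl v ze)" using RA_isabs[OF v x m(1)] cl_eqI[OF m(2)] by simp
  then have "cl v x = cl v ze" by (rule o.isabs_zero[OF cl_K[OF x]])
  then show ?thesis using cl_eq mem_D[OF zero_one_mem(1)[OF v]] by blast
qed

lemma RA_self:
  assumes v: "w0 \<preceq> v" and x: "mem v x R" and nn: "LE v ze x"
  shows "RA v x x"
proof -
  interpret o: ofield "K v" "op ad v" "op mu v" "cl v ze" "cl v on" "rel LT v" "rel LE v"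
    by (rule ofield_at[OF v])
  obtain m where m: "RA v x m" using abs_ex[OF v x] by blast
  have "rel LE v (cl v ze) (cl v x)" using le_cl[OF zero_one_mem(1)[OF v] x] nn by simp
  then have "ISABS v (cl v x) (cl v x)" by (rule o.isabs_nonneg[OF cl_K[OF x]])
  then have "cl v m = cl v x" by (rule o.isabs_unique[OF RA_isabs[OF v x m]])
  then have "eq v m x" using cl_eq mem_D[OF x] by blast
  then show ?thesis by (rule RA_cong[OF v x m eq_refl[OF mem_D[OF x, THEN conjunct1]]])
qed

end

section \<open>The q-normed space\<close>

context realctx
begin

lemma TF_vars:
  assumes "{(0, R), (1, ad), (2, mu), (3, ls), (4, ze), (5, on)} \<subseteq> \<Gamma>"
  shows "TF p \<Gamma> (Reals (var 0) (var 1) (var 2) (var 3) (var 4) (var 5))"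
  using assms unfolding TF_def by (auto intro!: TR_var)

end

context reals_model
begin

text \<open>Parameters of axiom instances must lie in the domain. For the operations and the order
  this is read off from one instance each: \<open>0 + 0\<close>, \<open>0 * 0\<close> and
  \<open>0 < 1\<close>.\<close>

lemma ops_D: "R \<in> D w0" "ad \<in> D w0" "mu \<in> D w0" "ls \<in> D w0" "ze \<in> D w0" "on \<in> D w0"
proof -
  interpret o: ofield "K w0" "op ad w0" "op mu w0" "cl w0 ze" "cl w0 on" "rel LT w0" "rel LE w0"
    by (rule ofield_at[OF le_refl])
  note zo = zero_one_mem[OF le_refl]
  obtain z1 z2 where "A2 w0 ad ze ze z1" "A2 w0 mu ze ze z2"
    using ad_ex[OF le_refl zo(1,1)] mu_ex[OF le_refl zo(1,1)] by (elim exE conjE)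
  then show "ad \<in> D w0" "mu \<in> D w0" using AP_D unfolding A2_def by metis+
  have "LT w0 ze on" using o.zero_lt_one lt_cl[OF zo] by simp
  then show "ls \<in> D w0" unfolding LT_def using mem_D by metis
  show "R \<in> D w0" "ze \<in> D w0" "on \<in> D w0" using zo mem_D by simp_all
qed

text \<open>\<open>function_ex\<close> applied to pairs: the relation recovers \<open>i\<close> and
  \<open>x\<close> from the pair, and \<open>abs_ex\<close> makes it total without any knowledge of
  which indices there are.\<close>

lemma norm_ex:
  assumes I: "I \<in> D w0" "\<And>v i. w0 \<preceq> v \<Longrightarrow> mem v i I \<Longrightarrow> mem v i R"
  obtains N c where "N \<in> D w0" "TM w0 I R c" "FN w0 N c R"
    "\<And>v i x y r. w0 \<preceq> v \<Longrightarrow> mem v i I \<Longrightarrow> mem v x R \<Longrightarrow> A2 v mu i x y \<Longrightarrow> RA v y r \<Longrightarrow> A2 v N i x r"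
proof -
  obtain c where c: "TM w0 I R c" using times_ex[OF I(1) ops_D(1)] by blast
  let ?F = "Reals (var 0) (var 1) (var 2) (var 3) (var 4) (var 5)"
  let ?cs = "[R, ad, mu, ls, ze, on]"
  let ?\<Phi> = "\<lambda>q r. \<^bold>\<exists>i x. q \<^bold>= pair i x \<^bold>\<and> r \<^bold>= rabs ?F (i *\<^bsub>?F\<^esub> x)"
  let ?\<phi> = "\<lambda>q r v. \<exists>i\<in>D v. \<exists>x\<in>D v. PR v i x q \<and> (\<exists>m. (\<exists>y. A2 v mu i x y \<and> RA v y m) \<and> eq v r m)"
  have F: "TF p (params ?cs) ?F" for p
    by (rule TF_vars) (simp add: upt_rec eval_nat_numeral)
  have FR: "FR p (insert (l, q) (insert (m, r) (params ?cs))) (?\<Phi> (var l) (var m)) (?\<phi> q r)" for p l m q r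
    by (rule FR_cong, (rule TR_pair R_rules | rule F | rule TF_insert TR_insert)+)
      (simp add: PR_eq_simp)
  \<comment> \<open>The formula lets \<open>i\<close> and \<open>x\<close> range over the whole
    domain; injectivity of pairs places them in \<open>I\<close> and \<open>R\<close>.\<close>
  have el: "\<exists>i x y m. mem v i I \<and> mem v x R \<and> PR v i x q \<and> A2 v mu i x y \<and> RA v y m \<and> eq v r m \<and>
      mem v y R"
    if h: "w0 \<preceq> v" "mem v q c" "?\<phi> q r v" for v q r
  proof -
    obtain i x y m where 1: "i \<in> D v" "x \<in> D v" "PR v i x q" "A2 v mu i x y" "RA v y m" "eq v r m"
      using h(3) by blast
    obtain i' x' where 2: "mem v i' I" "mem v x' R" "PR v i' x' q"
      using c h(1,2) unfolding TM_def by blast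
    have "eq v i' i \<and> eq v x' x" using PR_inj[OF 2(3) 1(3)] 1(1,2) mem_D[OF 2(1)] mem_D[OF 2(2)] by blast
    then have 3: "mem v i I" "mem v x R" using mem_eq 2 by blast+
    then have "mem v y R" using mu_range[OF h(1) I(2)[OF h(1)] _ 1(4)] by blast
    then show ?thesis using 1 3 by blast
  qed
  have cD: "c \<in> D w0" using c unfolding TM_def by blast
  have "\<exists>N\<in>D w0. FN w0 N c R \<and> (\<forall>v q r. w0 \<preceq> v \<longrightarrow> mem v q c \<longrightarrow> ?\<phi> q r v \<longrightarrow> AP v N q r)"
  proof (rule function_ex[where w = w0 and a = c and b = R, OF FR cD])
    show "set ?cs \<subseteq> D w0" using ops_D by simp
    show "?cs \<noteq> []" by simp
    fix v q
    assume v: "w0 \<preceq> v" "mem v q c"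
    show "mem v r R" if "?\<phi> q r v" for r
      using el[OF v that] RA_range mem_eq eq_sym by meson
    obtain i x where ix: "mem v i I" "mem v x R" "PR v i x q" using c v unfolding TM_def by blast
    obtain y where y: "A2 v mu i x y" "mem v y R" using mu_ex[OF v(1) I(2)[OF v(1) ix(1)] ix(2)] by blast
    obtain m where m: "RA v y m" using abs_ex[OF v(1) y(2)] by blast
    show "\<exists>r. ?\<phi> q r v"
      using ix y m mem_D[OF RA_range[OF m]] mem_D eq_refl by blast
    show "?\<phi> q r u" if "v \<preceq> u" "?\<phi> q r v" for u r
      using that D_mono PR_mono A2_mono RA_mono eq_mono by meson
    fix q' r r' assume q': "mem v q' c" "eq v q q'" and r: "?\<phi> q r v" "?\<phi> q' r' v"
    obtain i x y m where 1: "mem v i I" "mem v x R" "PR v i x q" "A2 v mu i x y" "RA v y m" "eq v r m" "mem v y R"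
      using el[OF v r(1)] by blast
    obtain i' x' y' m' where 2: "mem v i' I" "mem v x' R" "PR v i' x' q'" "A2 v mu i' x' y'" "RA v y' m'"
        "eq v r' m'" "mem v y' R"
      using el[OF v(1) q'(1) r(2)] by blast
    have "PR v i' x' q" using PR_cong_pair[OF 2(3) q'(2)] .
    then have e: "eq v i i'" "eq v x x'" using PR_inj[OF 1(3)] mem_D 1(1,2) 2(1,2) by blast+
    have "A2 v mu i' x' y" using A2_cong[OF 1(4) e] eq_refl mem_D[OF 1(7)] by blast
    then have "eq v y y'" using mu_unique[OF v(1) I(2)[OF v(1) 2(1)] 2(2) _ 2(4)] by blast
    then have "RA v y' m" using RA_cong[OF v(1) 1(7,5)] eq_refl mem_D[OF RA_range[OF 1(5)]] by blast
    then have "eq v m m'" using RA_unique[OF v(1) 2(7) _ 2(5)] by blast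
    then show "eq v r r'" using 1(6) 2(6) eq_trans eq_sym by meson
  qed
  then obtain N where N: "N \<in> D w0" "FN w0 N c R"
    "\<forall>v q r. w0 \<preceq> v \<longrightarrow> mem v q c \<longrightarrow> ?\<phi> q r v \<longrightarrow> AP v N q r"
    by (elim bexE conjE)
  show thesis
  proof (rule that[OF N(1) c N(2)])
    fix v i x y r assume h: "w0 \<preceq> v" "mem v i I" "mem v x R" "A2 v mu i x y" "RA v y r"
    have D: "i \<in> D v" "x \<in> D v" using h(2,3) mem_D by blast+
    obtain q where q: "PR v i x q" using PR_ex[OF D] by blast
    have "mem v q c" using TM_mem[OF c h(1) q h(2,3)] .
    moreover have "?\<phi> q r v" using D q h eq_refl mem_D[OF RA_range[OF h(5)]] by blast
    ultimately have "AP v N q r" by (rule N(3)[rule_format, OF h(1)])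
    then show "A2 v N i x r" using q unfolding A2_def by blast
  qed
qed

text \<open>\<open>Y\<close> will be the range of the binary sequence, so that the undecided
  condition is atomic and bounded separation applies. Index 1 of the formula is the real number 1,
  index 2 is 3, and indices 3 and 4 are \<open>uu\<close> and \<open>Y\<close>.\<close>

lemma index_set_ex:
  assumes "th \<in> D w0" "uu \<in> D w0" "Y \<in> D w0"
  obtains I where "I \<in> D w0"
    "\<And>v i. w0 \<preceq> v \<Longrightarrow> mem v i I \<longleftrightarrow> mem v i R \<and> (eq v i on \<or> eq v i th \<and> mem v uu Y)"
proof -
  let ?A = "Or (Eq 0 1) (And (Eq 0 2) (Mem 3 4))"
  let ?p = "case_nat on (case_nat th (case_nat uu (\<lambda>_. Y)))"
  have b: "bounded_fm ?A" by (intro bounded_fm.intros)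
  have RD: "R \<in> D w0" "on \<in> D w0" using zero_one_mem[OF le_refl] mem_D by blast+
  then have p: "?p i \<in> D w0" for i using assms by (auto split: nat.split)
  obtain I where I: "I \<in> D w0"
    "\<forall>v x. w0 \<preceq> v \<longrightarrow> mem v x I \<longleftrightarrow> mem v x R \<and> frc ?A v (case_nat x ?p)"
    using separation[where p = ?p, OF b RD(1) p] by (elim bexE)
  show thesis
    by (rule that[OF I(1)]) (simp add: I(2) eval_nat_numeral)
qed

end

text \<open>
  The index set is \<open>I = {1} \<union> {3 | C}\<close>, and the q-norm is \<open>N (i, x) = \<bar>i x\<bar>\<close>. The numerals \<open>0\<close> and \<open>1\<close> of
  \<open>\<omega>\<close> are \<open>em\<close> and \<open>uu\<close>.
\<close>

locale counterexample = reals_model le D mem eq R ad mu ls ze on w0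
  for le :: "'w \<Rightarrow> 'w \<Rightarrow> bool" (infix "\<preceq>" 50) and D :: "'w \<Rightarrow> 'a set"
    and mem eq :: "'w \<Rightarrow> 'a \<Rightarrow> 'a \<Rightarrow> bool" and R ad mu ls ze on :: 'a and w0 :: 'w +
  fixes I N th om em uu :: 'a and C :: "'w \<Rightarrow> bool" and c0 :: 'a
  assumes th_R: "mem w0 th R" and th_cl: "\<And>v. w0 \<preceq> v \<Longrightarrow> cl v th = ofield.th (op ad v) (cl v on)"
    and I_mem: "\<And>v i. w0 \<preceq> v \<Longrightarrow> mem v i I \<longleftrightarrow> mem v i R \<and> (eq v i on \<or> eq v i th \<and> C v)"
    and N_fun: "TM w0 I R c0" "FN w0 N c0 R"
    and N_val: "\<And>v i x y r. w0 \<preceq> v \<Longrightarrow> mem v i I \<Longrightarrow> mem v x R \<Longrightarrow> A2 v mu i x y \<Longrightarrow> RA v y r \<Longrightarrow> A2 v N i x r"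
    and om: "OM w0 om" and em: "EM w0 em" and uu: "SC w0 em uu"
begin

sublocale normctx le D mem eq R ad mu ls ze on I N
  by unfold_locales

section \<open>The q-norm axioms for the real line with the index set \<open>I\<close>\<close>

lemma I_R: "w0 \<preceq> v \<Longrightarrow> mem v i I \<Longrightarrow> mem v i R"
  using I_mem by blast

lemma on_I: "w0 \<preceq> v \<Longrightarrow> mem v on I"
  using I_mem zero_one_mem(2) mem_D eq_refl by blast

lemma N_ex:
  assumes v: "w0 \<preceq> v" "mem v i I" "mem v x R"
  obtains y r where "A2 v mu i x y" "mem v y R" "RA v y r" "A2 v N i x r" "mem v r R"
proof -
  obtain y where y: "A2 v mu i x y" "mem v y R" using mu_ex[OF v(1) I_R[OF v(1,2)] v(3)] by blast
  obtain r where r: "RA v y r" using abs_ex[OF v(1) y(2)] by blast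
  show thesis by (rule that[OF y r N_val[OF v y(1) r] RA_range[OF r]])
qed

text \<open>Complements \<open>N_val\<close>: values of the function \<open>N\<close> are unique up
  to \<open>eq\<close>, so every value is an absolute value.\<close>

lemma N_E:
  assumes v: "w0 \<preceq> v" "mem v i I" "mem v x R" and N: "A2 v N i x r"
  obtains y where "A2 v mu i x y" "mem v y R" "RA v y r"
proof -
  obtain y s where y: "A2 v mu i x y" "mem v y R" "RA v y s" "A2 v N i x s" by (rule N_ex[OF v])
  have "eq v s r" using A2_unique[OF N_fun v y(4) N] .
  then have "RA v y r" using RA_cong[OF v(1) y(2,3)] eq_refl mem_D[OF y(2)] by blast
  then show thesis using that y by blast
qed

lemma LE_ze_ze: "w0 \<preceq> v \<Longrightarrow> LE v ze ze"
  unfolding LE_def using order_facts(1) zero_one_mem(1) le_trans by blast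

lemma VM_ex:
  assumes v: "w0 \<preceq> v" "mem v x R" "mem v y R"
  shows "\<exists>z. VM v x y z"
proof -
  interpret o: ofield "K v" "op ad v" "op mu v" "cl v ze" "cl v on" "rel LT v" "rel LE v"
    by (rule ofield_at[OF v(1)])
  obtain y' where y': "NG v y y'" using NG_ex[OF v(1,3)] by blast
  then have yR: "mem v y' R" unfolding NG_def by blast
  obtain z where z: "A2 v ad x y' z" "mem v z R" using ad_ex[OF v(1,2) yR] by blast
  obtain t where t: "A2 v ad z y t" "mem v t R" using ad_ex[OF v(1) z(2) v(3)] by blast
  note k = cl_K[OF v(2)] cl_K[OF v(3)]
  have "cl v t = op ad v (op ad v (cl v x) (o.ng (cl v y))) (cl v y)"
    using pl_cl[OF v(1) z(2) v(3) t(1)] pl_cl[OF v(1,2) yR z(1)] NG_ng[OF v(1,3) y'] by simp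
  also have "\<dots> = cl v x"
    using k o.ng[OF k(2)] by (simp add: o.add_assoc o.add_comm[of "o.ng (cl v y)" "cl v y"])
  finally have "eq v t x" using cl_eq mem_D[OF v(2)] by blast
  then show ?thesis unfolding VM_def using z(2) t(1) by blast
qed

lemma VM_cl:
  assumes v: "w0 \<preceq> v" "mem v x R" "mem v y R" and z: "VM v x y z"
  shows "mem v z R" "op ad v (cl v z) (cl v y) = cl v x"
proof -
  obtain t where t: "mem v z R" "A2 v ad z y t" "eq v t x" using z unfolding VM_def by blast
  show "mem v z R" by (rule t(1))
  show "op ad v (cl v z) (cl v y) = cl v x" using pl_cl[OF v(1) t(1) v(3) t(2)] cl_eqI[OF t(3)] by simp
qed

lemma LIN_holds: "LIN w0"
  unfolding LIN_def
proof (intro conjI)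
  show "\<exists>a. TM w0 R R a \<and> FN w0 ad a R" by (rule heyt'[THEN conjunct1])
  show "\<exists>a. TM w0 R R a \<and> FN w0 mu a R" by (rule heyt'[THEN conjunct2, THEN conjunct1])
  show "mem w0 ze R" by (rule zero_one_mem(1)[OF le_refl])
next
  show "\<forall>v. w0 \<preceq> v \<longrightarrow> (\<forall>x. mem v x R \<longrightarrow> (\<forall>u. v \<preceq> u \<longrightarrow> (\<forall>y. mem u y R \<longrightarrow> (\<forall>t. u \<preceq> t \<longrightarrow> (\<forall>z. mem t z R \<longrightarrow>
      (\<exists>a. A2 t ad x y a \<and> (\<exists>b. A2 t ad y x b \<and> eq t a b)) \<and>
      (\<exists>a. (\<exists>s. A2 t ad x y s \<and> A2 t ad s z a) \<and> (\<exists>b. (\<exists>s. A2 t ad y z s \<and> A2 t ad x s b) \<and> eq t a b)))))))"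
  proof (intro allI impI)
    fix v x u y t z
    assume h: "w0 \<preceq> v" "mem v x R" "v \<preceq> u" "mem u y R" "u \<preceq> t" "mem t z R"
    have t: "w0 \<preceq> t" "v \<preceq> t" using h le_trans by meson+
    show "(\<exists>a. A2 t ad x y a \<and> (\<exists>b. A2 t ad y x b \<and> eq t a b)) \<and>
      (\<exists>a. (\<exists>s. A2 t ad x y s \<and> A2 t ad s z a) \<and> (\<exists>b. (\<exists>s. A2 t ad y z s \<and> A2 t ad x s b) \<and> eq t a b))"
      using ring_facts(1,2)[OF t(1) mem_mono[OF t(2) h(2)] mem_mono[OF h(5,4)] h(6)] by (rule conjI)
  qed
next
  show "\<forall>v. w0 \<preceq> v \<longrightarrow> (\<forall>x. mem v x R \<longrightarrow> (\<exists>a. A2 v ad x ze a \<and> eq v a x))"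
    using unit_facts(1) by (intro allI impI)
  show "\<forall>v. w0 \<preceq> v \<longrightarrow> (\<forall>x. mem v x R \<longrightarrow> (\<exists>y. mem v y R \<and> (\<exists>a. A2 v ad x y a \<and> eq v a ze)))"
    using unit_facts(3) by (intro allI impI)
next
  show "\<forall>v. w0 \<preceq> v \<longrightarrow> (\<forall>x. mem v x R \<longrightarrow> (\<forall>u. v \<preceq> u \<longrightarrow> (\<forall>y. mem u y R \<longrightarrow> (\<forall>t. u \<preceq> t \<longrightarrow> (\<forall>z. mem t z R \<longrightarrow>
      (\<forall>s. t \<preceq> s \<longrightarrow> (\<forall>r. mem s r R \<longrightarrow>
      (\<exists>a. (\<exists>c. A2 s ad z r c \<and> A2 s mu x c a) \<and>
        (\<exists>b. (\<exists>c. A2 s mu x z c \<and> (\<exists>d. A2 s mu x r d \<and> A2 s ad c d b)) \<and> eq s a b)) \<and>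
      (\<exists>a. (\<exists>c. A2 s ad x y c \<and> A2 s mu c z a) \<and>
        (\<exists>b. (\<exists>c. A2 s mu x z c \<and> (\<exists>d. A2 s mu y z d \<and> A2 s ad c d b)) \<and> eq s a b)) \<and>
      (\<exists>a. (\<exists>c. A2 s mu x y c \<and> A2 s mu c z a) \<and>
        (\<exists>b. (\<exists>c. A2 s mu y z c \<and> A2 s mu x c b) \<and> eq s a b)))))))))"
  proof (intro allI impI)
    fix v x u y t z s r
    assume h: "w0 \<preceq> v" "mem v x R" "v \<preceq> u" "mem u y R" "u \<preceq> t" "mem t z R" "t \<preceq> s" "mem s r R"
    have s: "w0 \<preceq> s" "v \<preceq> s" "u \<preceq> s" using h le_trans by meson+
    note R = mem_mono[OF s(2) h(2)] mem_mono[OF s(3) h(4)] mem_mono[OF h(7,6)]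
    interpret o: ofield "K s" "op ad s" "op mu s" "cl s ze" "cl s on" "rel LT s" "rel LE s"
      by (rule ofield_at[OF s(1)])
    obtain c where c: "A2 s ad x y c" "mem s c R" using ad_ex[OF s(1) R(1,2)] by blast
    obtain a where a: "A2 s mu c z a" "mem s a R" using mu_ex[OF s(1) c(2) R(3)] by blast
    obtain c' where c': "A2 s mu x z c'" "mem s c' R" using mu_ex[OF s(1) R(1,3)] by blast
    obtain d where d: "A2 s mu y z d" "mem s d R" using mu_ex[OF s(1) R(2,3)] by blast
    obtain b where b: "A2 s ad c' d b" "mem s b R" using ad_ex[OF s(1) c'(2) d(2)] by blast
    \<comment> \<open>Of the three laws in this block, distributivity over the sum of scalars is the
      one that is not literally a field axiom.\<close>
    have "cl s a = cl s b"
      using o.distrib_right[OF cl_K[OF R(3)] cl_K[OF R(1)] cl_K[OF R(2)]]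
      by (simp add: pl_cl[OF s(1) R(1,2) c(1)] ti_cl[OF s(1) c(2) R(3) a(1)] ti_cl[OF s(1) R(1,3) c'(1)]
          ti_cl[OF s(1) R(2,3) d(1)] pl_cl[OF s(1) c'(2) d(2) b(1)])
    then have "eq s a b" using cl_eq mem_D[OF b(2)] by blast
    then have "\<exists>a. (\<exists>c. A2 s ad x y c \<and> A2 s mu c z a) \<and>
        (\<exists>b. (\<exists>c. A2 s mu x z c \<and> (\<exists>d. A2 s mu y z d \<and> A2 s ad c d b)) \<and> eq s a b)"
      using a b c c' d by blast
    then show "(\<exists>a. (\<exists>c. A2 s ad z r c \<and> A2 s mu x c a) \<and>
        (\<exists>b. (\<exists>c. A2 s mu x z c \<and> (\<exists>d. A2 s mu x r d \<and> A2 s ad c d b)) \<and> eq s a b)) \<and>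
      (\<exists>a. (\<exists>c. A2 s ad x y c \<and> A2 s mu c z a) \<and>
        (\<exists>b. (\<exists>c. A2 s mu x z c \<and> (\<exists>d. A2 s mu y z d \<and> A2 s ad c d b)) \<and> eq s a b)) \<and>
      (\<exists>a. (\<exists>c. A2 s mu x y c \<and> A2 s mu c z a) \<and>
        (\<exists>b. (\<exists>c. A2 s mu y z c \<and> A2 s mu x c b) \<and> eq s a b))"
      using ring_facts(5)[OF s(1) R(1,3) h(8)] ring_facts(4)[OF s(1) R] by (intro conjI)
  qed
next
  show "\<forall>v. w0 \<preceq> v \<longrightarrow> (\<forall>x. mem v x R \<longrightarrow> (\<exists>a. A2 v mu on x a \<and> eq v a x))"
  proof (intro allI impI)
    fix v x assume v: "w0 \<preceq> v" "mem v x R"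
    interpret o: ofield "K v" "op ad v" "op mu v" "cl v ze" "cl v on" "rel LT v" "rel LE v"
      by (rule ofield_at[OF v(1)])
    obtain a where a: "A2 v mu on x a" "mem v a R" using mu_ex[OF v(1) zero_one_mem(2)[OF v(1)] v(2)] by blast
    have "cl v a = cl v x"
      using ti_cl[OF v(1) zero_one_mem(2)[OF v(1)] v(2) a(1)] cl_K[OF v(2)] by simp
    then show "\<exists>a. A2 v mu on x a \<and> eq v a x" using a cl_eq mem_D[OF v(2)] by blast
  qed
qed

lemma mu_on:
  assumes "w0 \<preceq> v" "mem v x R"
  shows "A2 v mu on x x" "A2 v mu x on x" "A2 v ad ze x x" "A2 v ad x ze x"
proof -
  interpret o: ofield "K v" "op ad v" "op mu v" "cl v ze" "cl v on" "rel LT v" "rel LE v"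
    by (rule ofield_at[OF assms(1)])
  note zo = zero_one_mem[OF assms(1)]
  have xx: "eq v x x" "eq v on on" "eq v ze ze" using assms zo mem_D eq_refl by blast+
  show "A2 v mu x on x" using unit_facts(2)[OF assms] A2_cong[OF _ xx(1,2)] by blast
  show "A2 v ad x ze x" using unit_facts(1)[OF assms] A2_cong[OF _ xx(1,3)] by blast
  obtain a where a: "A2 v mu on x a" "mem v a R" using mu_ex[OF assms(1) zo(2) assms(2)] by blast
  have "cl v a = cl v x" using ti_cl[OF assms(1) zo(2) assms(2) a(1)] cl_K[OF assms(2)] by simp
  then have "eq v a x" using cl_eq mem_D[OF assms(2)] by blast
  then show "A2 v mu on x x" using A2_cong[OF a(1) xx(2,1)] by blast
  obtain b where b: "A2 v ad ze x b" "mem v b R" using ad_ex[OF assms(1) zo(1) assms(2)] by blast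
  have "cl v b = cl v x" using pl_cl[OF assms(1) zo(1) assms(2) b(1)] cl_K[OF assms(2)] by simp
  then have "eq v b x" using cl_eq mem_D[OF assms(2)] by blast
  then show "A2 v ad ze x x" using A2_cong[OF b(1) xx(3,1)] by blast
qed

text \<open>Each clause reduces to the absolute value of \<open>i x\<close>; homogeneity uses
  \<open>i (a x) = a (i x)\<close> and then \<open>RA_mult\<close>.\<close>

lemma SEMI_holds:
  assumes v: "w0 \<preceq> v" and i: "mem v i I"
  shows "SEMI v i"
  unfolding SEMI_def
proof (intro conjI allI impI)
  fix t x u y assume h: "v \<preceq> t" "mem t x R" "t \<preceq> u" "A2 u N i x y"
  have u: "v \<preceq> u" "w0 \<preceq> u" using h v le_trans by meson+
  obtain z where z: "mem u z R" "RA u z y"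
    by (rule N_E[OF u(2) mem_mono[OF u(1) i] mem_mono[OF h(3,2)] h(4)])
  show "\<not> LT u y ze" using RA_nonneg[OF u(2) z] le_refl unfolding LE_def by blast
next
  fix t a u x assume h: "v \<preceq> t" "mem t a R" "t \<preceq> u" "mem u x R"
  have u: "v \<preceq> u" "w0 \<preceq> u" using h v le_trans by meson+
  interpret o: ofield "K u" "op ad u" "op mu u" "cl u ze" "cl u on" "rel LT u" "rel LE u"
    by (rule ofield_at[OF u(2)])
  note iu = mem_mono[OF u(1) i] and aR = mem_mono[OF h(3,2)]
  have iR: "mem u i R" using I_R u(2) iu by blast
  obtain y1 where y1: "A2 u mu a x y1" "mem u y1 R" using mu_ex[OF u(2) aR h(4)] by blast
  obtain z b where z: "A2 u mu i y1 z" "mem u z R" "RA u z b" "A2 u N i y1 b" by (rule N_ex[OF u(2) iu y1(2)])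
  obtain d where d: "RA u a d" using abs_ex[OF u(2) aR] by blast
  obtain z2 y where z2: "A2 u mu i x z2" "mem u z2 R" "RA u z2 y" "A2 u N i x y" "mem u y R"
    by (rule N_ex[OF u(2) iu h(4)])
  obtain c where c: "A2 u mu d y c" using mu_ex[OF u(2) RA_range[OF d] z2(5)] by blast
  obtain z' where z': "A2 u mu a z2 z'" "mem u z' R" using mu_ex[OF u(2) aR z2(2)] by blast
  have "cl u z = op mu u (cl u i) (op mu u (cl u a) (cl u x))"
    by (simp only: ti_cl[OF u(2) iR y1(2) z(1)] ti_cl[OF u(2) aR h(4) y1(1)])
  also have "\<dots> = op mu u (cl u a) (op mu u (cl u i) (cl u x))"
    using o.mult_assoc[OF cl_K[OF iR] cl_K[OF aR] cl_K[OF h(4)]]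
      o.mult_assoc[OF cl_K[OF aR] cl_K[OF iR] cl_K[OF h(4)]] o.mult_comm[OF cl_K[OF iR] cl_K[OF aR]] by simp
  also have "\<dots> = cl u z'"
    by (simp only: ti_cl[OF u(2) iR h(4) z2(1)] ti_cl[OF u(2) aR z2(2) z'(1)])
  finally have "eq u z z'" using cl_eq mem_D[OF z'(2)] by blast
  then have "RA u z' b" using RA_cong[OF u(2) z(2,3)] eq_refl mem_D[OF RA_range[OF z(3)]] by blast
  then have "eq u b c" by (rule RA_mult[OF u(2) aR z2(2) d z2(3) z'(1) _ c])
  then show "\<exists>b. (\<exists>y. A2 u mu a x y \<and> A2 u N i y b) \<and>
      (\<exists>c. (\<exists>d. RA u a d \<and> (\<exists>y. A2 u N i x y \<and> A2 u mu d y c)) \<and> eq u b c)"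
    using y1(1) z(4) d z2(4) c by blast
next
  fix p x q y t c d
  assume h: "v \<preceq> p" "mem p x R" "p \<preceq> q" "mem q y R" "q \<preceq> t"
    and 1: "\<exists>s. A2 t ad x y s \<and> A2 t N i s c"
    and 2: "\<exists>a. A2 t N i x a \<and> (\<exists>b. A2 t N i y b \<and> A2 t ad a b d)"
  have t: "v \<preceq> t" "w0 \<preceq> t" "p \<preceq> t" using h v le_trans by meson+
  interpret o: ofield "K t" "op ad t" "op mu t" "cl t ze" "cl t on" "rel LT t" "rel LE t"
    by (rule ofield_at[OF t(2)])
  note it = mem_mono[OF t(1) i] and xR = mem_mono[OF t(3) h(2)] and yR = mem_mono[OF h(5,4)]
  have iR: "mem t i R" using I_R t(2) it by blast
  obtain s where s: "A2 t ad x y s" "A2 t N i s c" using 1 by blast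
  obtain a b where ab: "A2 t N i x a" "A2 t N i y b" "A2 t ad a b d" using 2 by blast
  have sR: "mem t s R" by (rule ad_range[OF t(2) xR yR s(1)])
  obtain z where z: "A2 t mu i s z" "mem t z R" "RA t z c" by (rule N_E[OF t(2) it sR s(2)])
  obtain zx where zx: "A2 t mu i x zx" "mem t zx R" "RA t zx a" by (rule N_E[OF t(2) it xR ab(1)])
  obtain zy where zy: "A2 t mu i y zy" "mem t zy R" "RA t zy b" by (rule N_E[OF t(2) it yR ab(2)])
  obtain r where r: "A2 t ad zx zy r" "mem t r R" using ad_ex[OF t(2) zx(2) zy(2)] by blast
  have "cl t r = op ad t (op mu t (cl t i) (cl t x)) (op mu t (cl t i) (cl t y))"
    by (simp only: ti_cl[OF t(2) iR xR zx(1)] ti_cl[OF t(2) iR yR zy(1)] pl_cl[OF t(2) zx(2) zy(2) r(1)])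
  also have "\<dots> = op mu t (cl t i) (op ad t (cl t x) (cl t y))"
    by (rule o.distrib[symmetric]) (intro cl_K iR xR yR)+
  also have "\<dots> = cl t z"
    by (simp only: pl_cl[OF t(2) xR yR s(1)] ti_cl[OF t(2) iR sR z(1)])
  finally have "eq t r z" using cl_eq mem_D[OF z(2)] by blast
  then have "A2 t ad zx zy z" using A2_cong[OF r(1)] eq_refl mem_D zx(2) zy(2) by blast
  then have "LE t c d" by (rule RA_triangle[OF t(2) zx(2) zy(2) zx(3) zy(3) _ z(3) ab(3)])
  then show "\<not> LT t d c" using le_refl unfolding LE_def by blast
qed

lemma LE_sum:
  assumes v: "w0 \<preceq> v" and R: "mem v a R" "mem v b R" and nn: "LE v ze a" "LE v ze b" and m: "A2 v ad a b m"
  shows "LE v a m" "LE v b m"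
proof -
  interpret o: ofield "K v" "op ad v" "op mu v" "cl v ze" "cl v on" "rel LT v" "rel LE v"
    by (rule ofield_at[OF v])
  note zo = zero_one_mem[OF v]
  have mR: "mem v m R" by (rule ad_range[OF v R m])
  have k: "cl v a \<in> K v" "cl v b \<in> K v" "cl v ze \<in> K v" using cl_K R zo by blast+
  have n: "rel LE v (cl v ze) (cl v a)" "rel LE v (cl v ze) (cl v b)" using nn le_cl zo R by blast+
  have "rel LE v (op ad v (cl v a) (cl v ze)) (op ad v (cl v a) (cl v b))"
    by (rule o.le_add2[OF k(1,1,3,2) o.le_refl[OF k(1)] n(2)])
  then show "LE v a m" using pl_cl[OF v R m] k le_cl[OF R(1) mR] by simp
  have "rel LE v (op ad v (cl v ze) (cl v b)) (op ad v (cl v a) (cl v b))"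
    by (rule o.le_add2[OF k(3,1,2,2) n(1) o.le_refl[OF k(2)]])
  then show "LE v b m" using pl_cl[OF v R m] k le_cl[OF R(2) mR] by simp
qed

lemma QN_holds: "QN w0"
  unfolding QN_def
proof (intro conjI)
  show "LIN w0" by (rule LIN_holds)
  show "\<exists>a. TM w0 I R a \<and> FN w0 N a R" using N_fun by blast
  show "\<forall>v. w0 \<preceq> v \<longrightarrow> (\<forall>i. mem v i I \<longrightarrow> SEMI v i)" using SEMI_holds by (intro allI impI)
next
  show "\<forall>v. w0 \<preceq> v \<longrightarrow> (\<forall>x. mem v x R \<longrightarrow> (\<exists>m. mem v m R \<and> (\<forall>u. v \<preceq> u \<longrightarrow> (\<forall>i. mem u i I \<longrightarrow>
      (\<forall>t. u \<preceq> t \<longrightarrow> (\<forall>c. (\<exists>y. A2 t N i x y \<and> RA t y c) \<longrightarrow> \<not> LT t m c))))))"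
  proof (intro allI impI)
    fix v x assume v: "w0 \<preceq> v" "mem v x R"
    have thR: "mem v th R" by (rule mem_mono[OF v(1) th_R])
    obtain a where a: "RA v x a" using abs_ex[OF v] by blast
    obtain z where z: "A2 v mu th x z" "mem v z R" using mu_ex[OF v(1) thR v(2)] by blast
    obtain b where b: "RA v z b" using abs_ex[OF v(1) z(2)] by blast
    \<comment> \<open>The bound is \<bar>x\<bar> + \<bar>3 x\<bar>, which serves whether or not 3 is
      an index.\<close>
    obtain m where m: "A2 v ad a b m" "mem v m R" using ad_ex[OF v(1) RA_range[OF a] RA_range[OF b]] by blast
    have le: "LE v a m" "LE v b m"
      using LE_sum[OF v(1) RA_range[OF a] RA_range[OF b] RA_nonneg[OF v a] RA_nonneg[OF v(1) z(2) b] m(1)] by simp_all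
    show "\<exists>m. mem v m R \<and> (\<forall>u. v \<preceq> u \<longrightarrow> (\<forall>i. mem u i I \<longrightarrow>
      (\<forall>t. u \<preceq> t \<longrightarrow> (\<forall>c. (\<exists>y. A2 t N i x y \<and> RA t y c) \<longrightarrow> \<not> LT t m c))))"
    proof (intro exI[of _ m] conjI m(2) allI impI)
      fix u i t c assume h: "v \<preceq> u" "mem u i I" "u \<preceq> t" "\<exists>y. A2 t N i x y \<and> RA t y c"
      have t: "v \<preceq> t" "w0 \<preceq> t" using h v le_trans by meson+
      obtain y where y: "A2 t N i x y" "RA t y c" using h(4) by blast
      note xt = mem_mono[OF t(1) v(2)] and it = mem_mono[OF h(3,2)]
      have xx: "eq t x x" using xt mem_D eq_refl by blast
      obtain z' where z': "A2 t mu i x z'" "mem t z' R" "RA t z' y" by (rule N_E[OF t(2) it xt y(1)])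
      have yR: "mem t y R" by (rule RA_range[OF z'(3)])
      have yy: "eq t y y" "eq t z' z'" using yR z'(2) mem_D eq_refl by blast+
      \<comment> \<open>Boundedness is stated with the absolute value of the norm, which is the norm
        itself as it is nonnegative.\<close>
      have "eq t c y" using RA_unique[OF t(2) yR y(2) RA_self[OF t(2) yR RA_nonneg[OF t(2) z'(2,3)]]] .
      moreover have "eq t y a \<or> eq t y b"
      proof -
        consider "eq t i on" | "eq t i th" using I_mem[OF t(2)] it by blast
        then show ?thesis
        proof cases
          case 1
          have "A2 t mu on x z'" using A2_cong[OF z'(1) 1 xx yy(2)] .
          then have "eq t z' x" using mu_unique[OF t(2) zero_one_mem(2)[OF t(2)] xt _ mu_on(1)[OF t(2) xt]] by blast
          then have "RA t x y" using RA_cong[OF t(2) z'(2,3) _ yy(1)] by blast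
          then show ?thesis using RA_unique[OF t(2) xt _ RA_mono[OF a t(1)]] by blast
        next
          case 2
          have "A2 t mu th x z'" using A2_cong[OF z'(1) 2 xx yy(2)] .
          then have "eq t z' z"
            using mu_unique[OF t(2) mem_mono[OF t(1) thR] xt _ A2_mono[OF z(1) t(1)]] by blast
          then have "RA t z y" using RA_cong[OF t(2) z'(2,3) _ yy(1)] by blast
          then show ?thesis using RA_unique[OF t(2) mem_mono[OF t(1) z(2)] _ RA_mono[OF b t(1)]] by blast
        qed
      qed
      ultimately have "eq t c a \<or> eq t c b" using eq_trans by blast
      moreover have "eq t m m" using m(2) mem_mono[OF t(1)] mem_D eq_refl by blast
      moreover have "\<not> LT t m a" "\<not> LT t m b" using le t(1) unfolding LE_def by blast+
      ultimately show "\<not> LT t m c" using LT_cong by blast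
    qed
  qed
next
  show "\<forall>v. w0 \<preceq> v \<longrightarrow> (\<forall>x. mem v x R \<longrightarrow> (\<forall>u. v \<preceq> u \<longrightarrow> (\<forall>y. mem u y R \<longrightarrow> (\<forall>t. u \<preceq> t \<longrightarrow>
      eq t x y = (\<forall>s. t \<preceq> s \<longrightarrow> (\<forall>i. mem s i I \<longrightarrow>
        (\<exists>c. (\<exists>z. VM s x y z \<and> A2 s N i z c) \<and> eq s c ze)))))))"
  proof (intro allI impI iffI)
    fix v x u y t s i
    assume h: "w0 \<preceq> v" "mem v x R" "v \<preceq> u" "mem u y R" "u \<preceq> t" "eq t x y" "t \<preceq> s" "mem s i I"
    have s: "w0 \<preceq> s" "v \<preceq> s" "u \<preceq> s" using h le_trans by meson+
    interpret o: ofield "K s" "op ad s" "op mu s" "cl s ze" "cl s on" "rel LT s" "rel LE s"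
      by (rule ofield_at[OF s(1)])
    note R = mem_mono[OF s(2) h(2)] mem_mono[OF s(3) h(4)] and zo = zero_one_mem[OF s(1)]
    obtain z where z: "VM s x y z" using VM_ex[OF s(1) R] by blast
    note zR = VM_cl(1)[OF s(1) R z]
    have "op ad s (cl s z) (cl s y) = op ad s (cl s ze) (cl s y)"
      using VM_cl(2)[OF s(1) R z] cl_eqI[OF eq_mono[OF h(7,6)]] cl_K[OF R(2)] by simp
    then have z0: "cl s z = cl s ze"
      by (rule o.add_cancel[OF cl_K[OF zR] cl_K[OF zo(1)] cl_K[OF R(2)]])
    obtain p r where p: "A2 s mu i z p" "mem s p R" "RA s p r" "A2 s N i z r" by (rule N_ex[OF s(1) h(8) zR])
    have "cl s p = cl s ze"
      using ti_cl[OF s(1) I_R[OF s(1) h(8)] zR p(1)] z0 cl_K[OF I_R[OF s(1) h(8)]] by simp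
    then have "eq s p ze" using cl_eq mem_D[OF zo(1)] by blast
    then have "RA s ze r" using RA_cong[OF s(1) p(2,3)] eq_refl mem_D[OF RA_range[OF p(3)]] by blast
    then have "eq s r ze" using RA_unique[OF s(1) zo(1) _ RA_self[OF s(1) zo(1) LE_ze_ze[OF s(1)]]] by blast
    then show "\<exists>c. (\<exists>z. VM s x y z \<and> A2 s N i z c) \<and> eq s c ze" using z p(4) by blast
  next
    fix v x u y t
    assume h: "w0 \<preceq> v" "mem v x R" "v \<preceq> u" "mem u y R" "u \<preceq> t"
      and n: "\<forall>s. t \<preceq> s \<longrightarrow> (\<forall>i. mem s i I \<longrightarrow> (\<exists>c. (\<exists>z. VM s x y z \<and> A2 s N i z c) \<and> eq s c ze))"
    have t: "w0 \<preceq> t" "v \<preceq> t" using h le_trans by meson+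
    interpret o: ofield "K t" "op ad t" "op mu t" "cl t ze" "cl t on" "rel LT t" "rel LE t"
      by (rule ofield_at[OF t(1)])
    note R = mem_mono[OF t(2) h(2)] mem_mono[OF h(5,4)] and zo = zero_one_mem[OF t(1)]
    \<comment> \<open>The index 1 always belongs to \<open>I\<close>, so the q-norm separates points
      without a decision about \<open>C\<close>.\<close>
    obtain c z where c: "VM t x y z" "A2 t N on z c" "eq t c ze"
      using n[rule_format, OF le_refl on_I[OF t(1)]] by blast
    note zR = VM_cl(1)[OF t(1) R c(1)]
    obtain p where p: "A2 t mu on z p" "mem t p R" "RA t p c" by (rule N_E[OF t(1) on_I[OF t(1)] zR c(2)])
    have "eq t p ze" by (rule RA_zero[OF t(1) p(2,3) c(3)])
    moreover have "cl t p = cl t z" using ti_cl[OF t(1) zo(2) zR p(1)] cl_K[OF zR] by simp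
    ultimately have "cl t z = cl t ze" using cl_eqI by simp
    then have "cl t x = cl t y" using VM_cl(2)[OF t(1) R c(1)] cl_K[OF R(2)] by simp
    then show "eq t x y" using cl_eq mem_D[OF R(2)] by blast
  qed
qed

end

section \<open>One-dimensionality of the space\<close>

context counterexample
begin

lemma mem_uu: "w0 \<preceq> v \<Longrightarrow> mem v k uu \<longleftrightarrow> eq v k em"
  using uu em unfolding SC_def EM_def by simp

lemma em_D: "w0 \<preceq> v \<Longrightarrow> em \<in> D v" and uu_D: "w0 \<preceq> v \<Longrightarrow> uu \<in> D v"
  using uu em D_mono unfolding SC_def EM_def by metis+

lemma em_uu: "w0 \<preceq> v \<Longrightarrow> mem v em uu"
  using mem_uu em_D eq_refl by blast

lemma em_not_uu: "w0 \<preceq> v \<Longrightarrow> \<not> eq v em uu"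
proof
  assume v: "w0 \<preceq> v" "eq v em uu"
  have "mem v em em" using mem_cong[OF em_uu[OF v(1)] _ eq_sym[OF v(2)]] em_D[OF v(1)] eq_refl by blast
  then show False using em v(1) unfolding EM_def by blast
qed

lemma const_fun:
  assumes v: "w0 \<preceq> v" and x: "mem v x R"
  shows "\<exists>f\<in>D v. FN v f uu R \<and> (\<forall>w k. v \<preceq> w \<longrightarrow> mem w k uu \<longrightarrow> AP w f k x)"
proof -
  have "\<exists>f\<in>D v. FN v f uu R \<and> (\<forall>w k y. v \<preceq> w \<longrightarrow> mem w k uu \<longrightarrow> eq w y x \<longrightarrow> AP w f k y)"
  proof (rule function_ex[where \<Phi> = "\<lambda>k y. y \<^bold>= var 0" and cs = "[x]"])
    show "FR p (insert (l, k) (insert (m, y) (params [x]))) (var m \<^bold>= var 0) (\<lambda>w. eq w y x)" for p l m k y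
      unfolding params1 by (rule FR_cong, (rule FR_rules)+) simp
    show "uu \<in> D v" "set [x] \<subseteq> D v" "[x] \<noteq> []" using uu_D[OF v] mem_D[OF x] by auto
    fix w k assume w: "v \<preceq> w"
    show "mem w y R" if "eq w y x" for y using mem_eq[OF mem_mono[OF w x] eq_sym[OF that]] .
    show "\<exists>y. eq w y x" using mem_D[OF mem_mono[OF w x]] eq_refl by blast
    show "eq w y y'" if "eq w y x" "eq w y' x" for y y' using that eq_trans eq_sym by blast
    show "eq u y x" if "w \<preceq> u" "eq w y x" for u y using that eq_mono by blast
  qed
  then show ?thesis using mem_D mem_mono[OF _ x] eq_refl by meson
qed

lemma params4: "params [a, b, c, d] = {(0, a), (1, b), (2, c), (3, d)}"
  by (simp add: upt_rec eval_nat_numeral)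

text \<open>The function of partial sums for a sum with the single term \<open>r\<close>; its domain
  is the numeral 2.\<close>

lemma two_fun:
  assumes v: "w0 \<preceq> v" and r: "mem v r R"
  obtains m g where "SC v uu m" "g \<in> D v" "FN v g m R" "\<And>w. v \<preceq> w \<Longrightarrow> AP w g em ze" "\<And>w. v \<preceq> w \<Longrightarrow> AP w g uu r"
proof -
  obtain m where m: "SC v uu m" using succ_ex[OF uu_D[OF v]] by blast
  have mm: "mem w k m \<longleftrightarrow> eq w k em \<or> eq w k uu" if w: "v \<preceq> w" for w k
    using m w mem_uu[OF le_trans[OF v w]] unfolding SC_def by simp
  let ?\<phi> = "\<lambda>k y w. eq w k em \<and> eq w y ze \<or> eq w k uu \<and> eq w y r"
  have "\<exists>g\<in>D v. FN v g m R \<and> (\<forall>w k y. v \<preceq> w \<longrightarrow> mem w k m \<longrightarrow> ?\<phi> k y w \<longrightarrow> AP w g k y)"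
  proof (rule function_ex[where cs = "[em, uu, ze, r]" and
        \<Phi> = "\<lambda>k y. (k \<^bold>= var 0 \<^bold>\<and> y \<^bold>= var 2) \<^bold>\<or> (k \<^bold>= var 1 \<^bold>\<and> y \<^bold>= var 3)"])
    show "FR p (insert (l, k) (insert (m, y) (params [em, uu, ze, r])))
        ((var l \<^bold>= var 0 \<^bold>\<and> var m \<^bold>= var 2) \<^bold>\<or> (var l \<^bold>= var 1 \<^bold>\<and> var m \<^bold>= var 3)) (?\<phi> k y)" for p l m k y
      unfolding params4 by (rule FR_cong, (rule FR_rules)+) simp
    show "m \<in> D v" using m unfolding SC_def by blast
    show "set [em, uu, ze, r] \<subseteq> D v" using em_D[OF v] uu_D[OF v] mem_D[OF r] mem_D[OF zero_one_mem(1)[OF v]] by simp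
    show "[em, uu, ze, r] \<noteq> []" by simp
    fix w k assume w: "v \<preceq> w" "mem w k m"
    have w0w: "w0 \<preceq> w" using le_trans[OF v w(1)] .
    note R = zero_one_mem(1)[OF w0w] mem_mono[OF w(1) r]
    show "mem w y R" if "?\<phi> k y w" for y using that mem_eq R eq_sym by blast
    show "\<exists>y. ?\<phi> k y w" using mm[OF w(1)] w(2) R mem_D eq_refl by blast
    show "?\<phi> k y u" if "w \<preceq> u" "?\<phi> k y w" for u y using that eq_mono by blast
    fix k' y y' assume h: "mem w k' m" "eq w k k'" "?\<phi> k y w" "?\<phi> k' y' w"
    \<comment> \<open>Functionality of the two-case definition rests on the numerals 0 and 1 being
      different.\<close>
    have "\<not> (eq w k em \<and> eq w k' uu)" "\<not> (eq w k uu \<and> eq w k' em)"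
      using h(2) em_not_uu[OF w0w] eq_trans eq_sym by blast+
    then show "eq w y y'" using h(3,4) eq_trans eq_sym by blast
  qed
  then obtain g where g: "g \<in> D v" "FN v g m R"
      "\<forall>w k y. v \<preceq> w \<longrightarrow> mem w k m \<longrightarrow> ?\<phi> k y w \<longrightarrow> AP w g k y"
    by (elim bexE conjE)
  show thesis
  proof (rule that[OF m g(1,2)])
    fix w assume w: "v \<preceq> w"
    have w0w: "w0 \<preceq> w" using le_trans[OF v w] .
    have e: "eq w em em" "eq w uu uu" "eq w ze ze" "eq w r r"
      using em_D[OF w0w] uu_D[OF w0w] zero_one_mem(1)[OF w0w] mem_mono[OF w r] mem_D eq_refl by blast+
    show "AP w g em ze" by (rule g(3)[rule_format, OF w]) (simp_all add: mm[OF w] e)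
    show "AP w g uu r" by (rule g(3)[rule_format, OF w]) (simp_all add: mm[OF w] e)
  qed
qed

lemma FSUM_I:
  assumes v: "w0 \<preceq> v" and r: "mem v r R" and T: "\<And>w k. v \<preceq> w \<Longrightarrow> mem w k uu \<Longrightarrow> T k w r"
  shows "FSUM v R ad ze uu T r"
proof -
  obtain m g where g: "SC v uu m" "g \<in> D v" "FN v g m R" "\<And>w. v \<preceq> w \<Longrightarrow> AP w g em ze" "\<And>w. v \<preceq> w \<Longrightarrow> AP w g uu r"
    using two_fun[OF v r] by metis
  show ?thesis
    unfolding FSUM_def
  proof (intro conjI bexI[OF _ g(2)])
    show "r \<in> D v" using mem_D[OF r] by blast
    show "\<exists>m. SC v uu m \<and> FN v g m R" using g(1,3) by blast
    have "eq v ze ze" "eq v r r" using zero_one_mem(1)[OF v] r mem_D eq_refl by blast+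
    then show "\<exists>y. (\<exists>e. EM v e \<and> AP v g e y) \<and> eq v y ze" "\<exists>y. AP v g uu y \<and> eq v y r"
      using EM_mono[OF em v] g(4,5)[OF le_refl] by blast+
    show "\<forall>w. v \<preceq> w \<longrightarrow> (\<forall>k. mem w k uu \<longrightarrow> (\<exists>y. (\<exists>m. SC w k m \<and> AP w g m y) \<and>
        (\<exists>u. (\<exists>a. AP w g k a \<and> (\<exists>b. T k w b \<and> A2 w ad a b u)) \<and> eq w y u)))"
    proof (intro allI impI)
      fix w k assume w: "v \<preceq> w" "mem w k uu"
      have w0w: "w0 \<preceq> w" using le_trans[OF v w(1)] .
      have k: "eq w k em" using mem_uu[OF w0w] w(2) by blast
      have S: "SC w k uu"
        unfolding SC_def
      proof (intro conjI allI impI)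
        show "uu \<in> D w" by (rule uu_D[OF w0w])
        fix t z assume t: "w \<preceq> t"
        have w0t: "w0 \<preceq> t" using le_trans[OF w0w t] .
        have "\<not> mem t z k" using EM_cong[OF EM_mono[OF em w0t] eq_sym[OF eq_mono[OF t k]]] unfolding EM_def by blast
        moreover have "eq t z em \<longleftrightarrow> eq t z k" using eq_mono[OF t k] eq_trans eq_sym by blast
        ultimately show "mem t z uu \<longleftrightarrow> mem t z k \<or> eq t z k" using mem_uu[OF w0t] by blast
      qed
      have R: "mem w r R" "mem w ze R" using mem_mono[OF w(1) r] zero_one_mem(1)[OF w0w] by simp_all
      have e: "eq w r r" "eq w ze ze" using R mem_D eq_refl by blast+
      have "AP w g k ze" using AP_cong[OF g(4)[OF w(1)] eq_sym[OF k] e(2)] .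
      then show "\<exists>y. (\<exists>m. SC w k m \<and> AP w g m y) \<and>
          (\<exists>u. (\<exists>a. AP w g k a \<and> (\<exists>b. T k w b \<and> A2 w ad a b u)) \<and> eq w y u)"
        using S e(1) g(5)[OF w(1)] T[OF w] mu_on(3)[OF w0w R(1)] by blast
    qed
  qed
qed

text \<open>The partial sums at 0 and 1 are determined up to \<open>eq\<close>, and the recursion at
  0 reads \<open>s = 0 + b\<close>. Membership of \<open>b\<close> in \<open>R\<close> is left to
  the caller, since it depends on \<open>T\<close>.\<close>

lemma FSUM_E:
  assumes v: "w0 \<preceq> v" and S: "FSUM v R ad ze uu T s"
  shows "\<exists>b. T em v b \<and> (mem v b R \<longrightarrow> eq v s b)"
proof -
  obtain g where g: "\<exists>m. SC v uu m \<and> FN v g m R" "\<exists>y. (\<exists>e. EM v e \<and> AP v g e y) \<and> eq v y ze"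
    "\<forall>w. v \<preceq> w \<longrightarrow> (\<forall>k. mem w k uu \<longrightarrow> (\<exists>y. (\<exists>m. SC w k m \<and> AP w g m y) \<and>
        (\<exists>u. (\<exists>a. AP w g k a \<and> (\<exists>b. T k w b \<and> A2 w ad a b u)) \<and> eq w y u)))"
    "\<exists>y. AP v g uu y \<and> eq v y s"
    using S unfolding FSUM_def by (elim bexE conjE)
  obtain m where m: "SC v uu m" "FN v g m R" using g(1) by blast
  have mm: "mem v em m" "mem v uu m"
    using m(1) em_uu[OF v] uu_D[OF v] eq_refl unfolding SC_def by blast+
  obtain y0 e where y0: "EM v e" "AP v g e y0" "eq v y0 ze" using g(2) by blast
  obtain y1 where y1: "AP v g uu y1" "eq v y1 s" using g(4) by blast
  obtain y m' u a b where y: "SC v em m'" "AP v g m' y" "AP v g em a" "T em v b" "A2 v ad a b u" "eq v y u"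
    using g(3)[rule_format, OF le_refl em_uu[OF v]] by (elim exE conjE)
  have D: "eq v y0 y0" "eq v y y" using AP_D[OF y0(2)] AP_D[OF y(2)] eq_refl by blast+
  have "AP v g em y0" by (rule AP_cong[OF y0(2) EM_unique[OF y0(1) EM_mono[OF em v]] D(1)])
  then have a: "eq v a ze" using FN_unique[OF m(2) le_refl mm(1) y(3)] y0(3) eq_trans by blast
  have "AP v g uu y" by (rule AP_cong[OF y(2) SC_unique[OF y(1) SC_mono[OF uu v]] D(2)])
  then have "eq v y y1" using FN_unique[OF m(2) le_refl mm(2) _ y1(1)] by blast
  then have us: "eq v u s" using y(6) y1(2) eq_sym eq_trans by meson
  show ?thesis
  proof (intro exI[of _ b] conjI impI y(4))
    assume b: "mem v b R"
    have "A2 v ad ze b u" using A2_cong[OF y(5) a] b A2_D[OF y(5)] mem_D eq_refl by blast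
    then have "eq v u b" using ad_unique[OF v zero_one_mem(1)[OF v] b _ mu_on(3)[OF v b]] by blast
    then show "eq v s b" using us eq_sym eq_trans by blast
  qed
qed

text \<open>The basis is the single vector 1, so the dimension is the numeral \<open>uu\<close> and
  \<open>b\<close> is the constant function 1.\<close>

lemma FINDIM_holds: "FINDIM w0"
proof -
  have onR: "mem w0 on R" by (rule zero_one_mem(2)[OF le_refl])
  obtain b where b: "b \<in> D w0" "FN w0 b uu R" "\<forall>w k. w0 \<preceq> w \<longrightarrow> mem w k uu \<longrightarrow> AP w b k on"
    using const_fun[OF le_refl onR] by (elim bexE conjE)
  have uo: "mem w0 uu om" by (rule OM_succ[OF om le_refl OM_empty[OF om em] uu])
  have sum: "FSUM v R ad ze uu (\<lambda>k w z. \<exists>x. AP w l k x \<and> (\<exists>y. AP w b k y \<and> A2 w mu x y z)) x"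
    if h: "w0 \<preceq> v" "mem v x R" "\<And>w k. v \<preceq> w \<Longrightarrow> mem w k uu \<Longrightarrow> AP w l k x" for v l x
  proof (rule FSUM_I[OF h(1,2)])
    fix w k assume w: "v \<preceq> w" "mem w k uu"
    have w0w: "w0 \<preceq> w" using le_trans[OF h(1) w(1)] .
    show "\<exists>y. AP w l k y \<and> (\<exists>z. AP w b k z \<and> A2 w mu y z x)"
      using h(3)[OF w] b(3)[rule_format, OF w0w w(2)] mu_on(2)[OF w0w mem_mono[OF w(1) h(2)]] by blast
  qed
  show ?thesis
    unfolding FINDIM_def
  proof (rule exI[of _ uu], intro conjI bexI[OF _ b(1)])
    show "\<exists>om. OM w0 om \<and> mem w0 uu om" using om uo by blast
    show "FN w0 b uu R" by (rule b(2))
  next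
    show "\<forall>v. w0 \<preceq> v \<longrightarrow> (\<forall>x. mem v x R \<longrightarrow> (\<exists>l\<in>D v. FN v l uu R \<and>
      (\<exists>s. FSUM v R ad ze uu (\<lambda>k w z. \<exists>x. AP w l k x \<and> (\<exists>y. AP w b k y \<and> A2 w mu x y z)) s \<and> eq v x s)))"
    proof (intro allI impI)
      fix v x assume v: "w0 \<preceq> v" "mem v x R"
      obtain l where l: "l \<in> D v" "FN v l uu R" "\<forall>w k. v \<preceq> w \<longrightarrow> mem w k uu \<longrightarrow> AP w l k x"
        using const_fun[OF v] by (elim bexE conjE)
      have "eq v x x" using mem_D[OF v(2)] eq_refl by blast
      then show "\<exists>l\<in>D v. FN v l uu R \<and>
        (\<exists>s. FSUM v R ad ze uu (\<lambda>k w z. \<exists>x. AP w l k x \<and> (\<exists>y. AP w b k y \<and> A2 w mu x y z)) s \<and> eq v x s)"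
        using l(1,2) sum[OF v, of l] l(3) by blast
    qed
  next
    show "\<forall>v. w0 \<preceq> v \<longrightarrow> (\<forall>l\<in>D v. \<forall>u. v \<preceq> u \<longrightarrow> FN u l uu R \<longrightarrow> (\<forall>t. u \<preceq> t \<longrightarrow>
      (\<exists>s. FSUM t R ad ze uu (\<lambda>k w y. \<exists>x. AP w l k x \<and> RA w x y) s \<and> LT t ze s) \<longrightarrow>
      (\<exists>i. mem t i I \<and> (\<exists>c. (\<exists>z. (\<exists>s. FSUM t R ad ze uu
        (\<lambda>k w z. \<exists>x. AP w l k x \<and> (\<exists>y. AP w b k y \<and> A2 w mu x y z)) s \<and> VM t s ze z) \<and> A2 t N i z c) \<and>
        LT t ze c))))"
    proof (intro ballI allI impI)
      fix v l u t assume v: "w0 \<preceq> v" and h: "l \<in> D v" "v \<preceq> u" "FN u l uu R" "u \<preceq> t"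
        and "\<exists>s. FSUM t R ad ze uu (\<lambda>k w y. \<exists>x. AP w l k x \<and> RA w x y) s \<and> LT t ze s"
      then obtain s where s: "FSUM t R ad ze uu (\<lambda>k w y. \<exists>x. AP w l k x \<and> RA w x y) s" "LT t ze s" by blast
      have t: "w0 \<preceq> t" using v h(2,4) le_trans by meson
      \<comment> \<open>The sum of absolute values equals \<open>c\<close>, the absolute value of
        the only coefficient \<open>x\<close>, and this is also the norm of \<open>x\<close> for the
        index 1.\<close>
      obtain c x where c: "mem t c R \<longrightarrow> eq t s c" and x: "AP t l em x" "RA t x c"
        using FSUM_E[OF t s(1)] by (elim exE conjE)
      have zo: "mem t ze R" by (rule zero_one_mem(1)[OF t])
      have xR: "mem t x R" using FN_range[OF h(3,4) em_D[OF t] x(1)] by blast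
      have xx: "eq t x x" "eq t ze ze" using xR zo mem_D eq_refl by blast+
      have lt: "LT t ze c" using LT_cong[OF s(2) xx(2) c[rule_format, OF RA_range[OF x(2)]]] .
      have "AP w l k x" if w: "t \<preceq> w" "mem w k uu" for w k
        using AP_cong[OF AP_mono[OF x(1) w(1)]] eq_sym mem_uu[OF le_trans[OF t w(1)]] w(2)
          eq_mono[OF w(1) xx(1)] by blast
      then have "FSUM t R ad ze uu (\<lambda>k w z. \<exists>x. AP w l k x \<and> (\<exists>y. AP w b k y \<and> A2 w mu x y z)) x"
        by (rule sum[OF t xR])
      moreover have "VM t x ze x" unfolding VM_def using xR mu_on(4)[OF t xR] xx(1) by blast
      moreover have "A2 t N on x c" by (rule N_val[OF t on_I[OF t] xR mu_on(1)[OF t xR] x(2)])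
      ultimately show "\<exists>i. mem t i I \<and> (\<exists>c. (\<exists>z. (\<exists>s. FSUM t R ad ze uu
        (\<lambda>k w z. \<exists>x. AP w l k x \<and> (\<exists>y. AP w b k y \<and> A2 w mu x y z)) s \<and> VM t s ze z) \<and> A2 t N i z c) \<and>
        LT t ze c)" using lt on_I[OF t] by blast
    qed
  qed
qed

section \<open>From a finite approximation to the decision\<close>

lemma params11: "params [a0, a1, a2, a3, a4, a5, a6, a7, a8, a9, a10] =
  {(0, a0), (1, a1), (2, a2), (3, a3), (4, a4), (5, a5), (6, a6), (7, a7), (8, a8), (9, a9), (10, a10)}"
  by (simp add: upt_rec eval_nat_numeral)

text \<open>For the \<open>k\<close>-th point \<open>x\<close> of the approximation: \<open>1 < \<bar>3 x\<bar>\<close> and \<open>\<bar>3 x\<bar> < 2\<close>, respectively.\<close>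

definition big :: "'a \<Rightarrow> 'w \<Rightarrow> 'a \<Rightarrow> bool" where
  "big f v k \<longleftrightarrow> (\<exists>c. (\<exists>p. (\<exists>x. AP v f k x \<and> A2 v mu th x p) \<and> RA v p c) \<and> LT v on c)"

definition small :: "'a \<Rightarrow> 'a \<Rightarrow> 'w \<Rightarrow> 'a \<Rightarrow> bool" where
  "small two f v k \<longleftrightarrow> (\<exists>c. (\<exists>p. (\<exists>x. AP v f k x \<and> A2 v mu th x p) \<and> RA v p c) \<and> LT v c two)"

lemma small_mono: "small two f v k \<Longrightarrow> v \<preceq> w \<Longrightarrow> small two f w k"
  unfolding small_def by (meson AP_mono A2_mono RA_mono LT_mono)

lemma small_cong: "small two f v k \<Longrightarrow> eq v k k' \<Longrightarrow> small two f v k'"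
  unfolding small_def using AP_cong AP_D eq_refl by meson

text \<open>Cotransitivity for \<open>1 < 2\<close>. This is the only decision made about a single
  point; both alternatives may hold at once.\<close>

lemma big_or_small:
  assumes two: "A2 w0 ad on on two" and f: "f \<in> D w0" "FN w0 f n A" and A: "\<forall>v x. w0 \<preceq> v \<longrightarrow> mem v x A \<longrightarrow> mem v x R"
    and v: "w0 \<preceq> v" and k: "mem v k n"
  shows "big f v k \<or> small two f v k"
proof -
  interpret o: ofield "K v" "op ad v" "op mu v" "cl v ze" "cl v on" "rel LT v" "rel LE v"
    by (rule ofield_at[OF v])
  note onR = zero_one_mem(2)[OF v]
  have tw: "A2 v ad on on two" using A2_mono[OF two v] .
  have twR: "mem v two R" by (rule ad_range[OF v onR onR tw])
  obtain x where x: "AP v f k x" "mem v x A" using FN_ex[OF f(2) v k] by blast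
  obtain p where p: "A2 v mu th x p" "mem v p R" using mu_ex[OF v mem_mono[OF v th_R] A[rule_format, OF v x(2)]] by blast
  obtain c where c: "RA v p c" using abs_ex[OF v p(2)] by blast
  have "rel LT v (cl v on) (cl v two)" using o.one_lt_two pl_cl[OF v onR onR tw] by simp
  then have "LT v on c \<or> LT v c two"
    using order_facts(2)[OF v onR twR _ RA_range[OF c]] lt_cl[OF onR twR] by blast
  then show ?thesis unfolding big_def small_def using x(1) p(1) c by blast
qed

text \<open>\<open>n\<close> is a number of the model, so HOL induction does not reach it. Nor does
  a classical case distinction at \<open>w0\<close> help: if no \<open>k\<close> is
  \<open>big\<close> at \<open>w0\<close>, some \<open>k\<close> could still become
  \<open>big\<close> at a later world without being \<open>small\<close> there. Induction inside the
  model yields a disjunction one side of which is forced.\<close>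

lemma finite_choice:
  assumes two: "A2 w0 ad on on two" and f: "f \<in> D w0" "FN w0 f n A" and A: "\<forall>v x. w0 \<preceq> v \<longrightarrow> mem v x A \<longrightarrow> mem v x R"
    and n: "mem w0 n om" and D0: "set [R, ad, mu, ls, ze, on, th, two, f, n] \<subseteq> D w0"
  shows "(\<exists>k. mem w0 k n \<and> big f w0 k) \<or> (\<forall>v. w0 \<preceq> v \<longrightarrow> (\<forall>k. mem v k n \<longrightarrow> small two f v k))"
proof -
  let ?F = "Reals (var 1) (var 2) (var 3) (var 4) (var 5) (var 6)"
  \<comment> \<open>The prefix says that \<open>m\<close> is a subset of \<open>n\<close>, the
    domain of \<open>f\<close>. Level 0 holds \<open>omega\<close>, levels 1 to 6 the reals, and 7
    to 10 \<open>th\<close>, \<open>two\<close>, \<open>f\<close> and \<open>n\<close>.\<close>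
  let ?\<Phi> = "\<lambda>m. (\<^bold>\<forall>k\<^bold>\<in>m. k \<^bold>\<in> var 10) \<^bold>\<longrightarrow>
    (\<^bold>\<exists>k\<^bold>\<in>m. var 6 <\<^bsub>?F\<^esub> rabs ?F (var 7 *\<^bsub>?F\<^esub> app (var 9) k)) \<^bold>\<or>
    (\<^bold>\<forall>k\<^bold>\<in>m. rabs ?F (var 7 *\<^bsub>?F\<^esub> app (var 9) k) <\<^bsub>?F\<^esub> var 8)"
  let ?\<phi> = "\<lambda>m v. \<forall>u. v \<preceq> u \<longrightarrow> (\<forall>t. u \<preceq> t \<longrightarrow> (\<forall>k. mem t k m \<longrightarrow> mem t k n)) \<longrightarrow>
    (\<exists>k. mem u k m \<and> big f u k) \<or> (\<forall>t. u \<preceq> t \<longrightarrow> (\<forall>k. mem t k m \<longrightarrow> small two f t k))"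
  let ?cs = "[R, ad, mu, ls, ze, on, th, two, f, n]"
  have F: "TF p (params (om # ?cs)) ?F" for p
    unfolding params11 TF_def by (auto intro!: TR_var)
  have "?\<phi> n w0"
  proof (rule omega_induct[where \<phi> = ?\<phi> and \<Phi> = ?\<Phi>, OF _ om D0 _ _ le_refl n])
    show "FR p (insert (l, m) (params (om # ?cs))) (?\<Phi> (var l)) (?\<phi> m)" for p l m
      unfolding params11
      by (rule FR_cong, (rule TR_app R_rules | rule F[unfolded params11] | rule TF_insert)+)
        (simp add: big_def small_def)
  next
    fix v e assume "w0 \<preceq> v" "EM v e"
    then show "?\<phi> e v" unfolding EM_def using le_trans by meson
  next
    fix v k s assume v: "w0 \<preceq> v" "mem v k om" "?\<phi> k v" "SC v k s"
    have s: "mem u z s \<longleftrightarrow> mem u z k \<or> eq u z k" if "v \<preceq> u" for u z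
      using v(4) that unfolding SC_def by simp
    show "?\<phi> s v"
    proof (intro allI impI)
      fix u assume u: "v \<preceq> u" and sub: "\<forall>t. u \<preceq> t \<longrightarrow> (\<forall>k. mem t k s \<longrightarrow> mem t k n)"
      have w0u: "w0 \<preceq> u" using le_trans[OF v(1) u] .
      have "\<forall>t. u \<preceq> t \<longrightarrow> (\<forall>j. mem t j k \<longrightarrow> mem t j n)" using sub s le_trans[OF u] by blast
      then have IH: "(\<exists>j. mem u j k \<and> big f u j) \<or> (\<forall>t. u \<preceq> t \<longrightarrow> (\<forall>j. mem t j k \<longrightarrow> small two f t j))"
        using v(3)[rule_format, OF u] by blast
      have "eq u k k" using mem_mono[OF u v(2)] mem_D eq_refl by blast
      then have ks: "mem u k s" using s[OF u] by blast
      then have "mem u k n" using sub le_refl by blast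
      then have "big f u k \<or> small two f u k" using big_or_small[OF two f A w0u] by blast
      moreover have "small two f t j" if "small two f u k" "\<forall>t. u \<preceq> t \<longrightarrow> (\<forall>j. mem t j k \<longrightarrow> small two f t j)"
        "u \<preceq> t" "mem t j s" for t j
        using that s[OF le_trans[OF u that(3)]] small_mono[OF that(1,3)] small_cong eq_sym by blast
      ultimately show "(\<exists>k. mem u k s \<and> big f u k) \<or> (\<forall>t. u \<preceq> t \<longrightarrow> (\<forall>k. mem t k s \<longrightarrow> small two f t k))"
        using IH ks s[OF u] by blast
    qed
  qed
  then show ?thesis using le_refl by blast
qed

text \<open>The alternatives say that the negation of \<open>C\<close> is forced, or its double
  negation. Which of them holds is settled at \<open>w0\<close> by
  \<open>finite_choice\<close>.\<close>

lemma dichotomy: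
  assumes tb: "TBD w0"
  shows "(\<forall>v. w0 \<preceq> v \<longrightarrow> \<not> C v) \<or> (\<forall>v. w0 \<preceq> v \<longrightarrow> (\<exists>u. v \<preceq> u \<and> C u))"
proof -
  interpret o0: ofield "K w0" "op ad w0" "op mu w0" "cl w0 ze" "cl w0 on" "rel LT w0" "rel LE w0"
    by (rule ofield_at[OF le_refl])
  note zo = zero_one_mem[OF le_refl]
  obtain two where two: "A2 w0 ad on on two" "mem w0 two R" using ad_ex[OF le_refl zo(2,2)] by blast
  \<comment> \<open>\<open>E\<close> is the class of 1/3, whose representative \<open>e\<close>
    becomes the tolerance.\<close>
  obtain E where E: "E \<in> K w0" "rel LT w0 (cl w0 ze) E" "op mu w0 o0.th E = cl w0 on"
    using o0.third_ex by (elim bexE conjE)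
  obtain e where e: "mem w0 e R" "E = cl w0 e" using E(1) by (elim K_E)
  have lte: "LT w0 ze e" using E(2) e lt_cl[OF zo(1) e(1)] by simp
  obtain q where q: "A2 w0 mu th e q" "mem w0 q R" using mu_ex[OF le_refl th_R e(1)] by blast
  have "cl w0 q = cl w0 on"
    using ti_cl[OF le_refl th_R e(1) q(1)] th_cl[OF le_refl] E(3) e(2) by simp
  then have q1: "eq w0 q on" using cl_eq mem_D[OF zo(2)] by blast
  obtain A n f om' where A: "A \<in> D w0" "f \<in> D w0" "FN w0 f n A" and om': "OM w0 om'" "mem w0 n om'"
    and enum: "\<forall>t. w0 \<preceq> t \<longrightarrow> (\<forall>y. mem t y A \<longrightarrow> (\<exists>k. mem t k n \<and> (\<exists>z. AP t f k z \<and> eq t z y)))"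
    and sub: "\<forall>t. w0 \<preceq> t \<longrightarrow> (\<forall>x. mem t x A \<longrightarrow> mem t x R \<and> (\<forall>s. t \<preceq> s \<longrightarrow> (\<forall>i. mem s i I \<longrightarrow>
      (\<forall>r. s \<preceq> r \<longrightarrow> (\<forall>c. A2 r N i x c \<longrightarrow> \<not> LT r on c)))))"
    and cover: "\<forall>t. w0 \<preceq> t \<longrightarrow> (\<forall>x\<in>D t. \<forall>s. t \<preceq> s \<longrightarrow> mem s x R \<and> (\<forall>r. s \<preceq> r \<longrightarrow> (\<forall>i. mem r i I \<longrightarrow>
      (\<forall>q. r \<preceq> q \<longrightarrow> (\<forall>c. A2 q N i x c \<longrightarrow> \<not> LT q on c)))) \<longrightarrow>
      (\<exists>y. mem s y A \<and> (\<forall>r. s \<preceq> r \<longrightarrow> (\<forall>i. mem r i I \<longrightarrow>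
        (\<exists>c. (\<exists>z. VM r x y z \<and> A2 r N i z c) \<and> LT r c e)))))"
    using tb[unfolded TBD_def, rule_format, OF le_refl e(1) le_refl lte] by (elim bexE exE conjE)
  have AR': "\<forall>v x. w0 \<preceq> v \<longrightarrow> mem v x A \<longrightarrow> mem v x R" using sub by blast
  note AR = AR'[rule_format]
  \<comment> \<open>Finite enumerability comes with its own value \<open>om'\<close> of
    \<open>omega\<close>; minimality moves \<open>n\<close> into \<open>om\<close>.\<close>
  have "SCC w0 om" "om \<in> D w0" using om unfolding OM_def by simp_all
  then have n: "mem w0 n om" using om' le_refl unfolding OM_def by blast
  have "set [R, ad, mu, ls, ze, on, th, two, f, n] \<subseteq> D w0"
    using ops_D th_R two(2) A(2) n mem_D by simp
  note choice = finite_choice[OF two(1) A(2,3) AR' n this]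
  show ?thesis
    using choice
  proof (elim disjE)
    assume "\<exists>k. mem w0 k n \<and> big f w0 k"
    then obtain k x p c where k: "mem w0 k n" "AP w0 f k x" "A2 w0 mu th x p" "RA w0 p c" "LT w0 on c"
      unfolding big_def by blast
    have xA: "mem w0 x A" using FN_range[OF A(3) le_refl _ k(2)] mem_D[OF k(1)] by blast
    \<comment> \<open>If \<open>C\<close> held at \<open>v\<close>, 3 would be an index there, and
      \<open>c > 1\<close> the corresponding norm of a point of the unit ball.\<close>
    have "\<not> C v" if v: "w0 \<preceq> v" for v
    proof
      assume "C v"
      have thR: "mem v th R" by (rule mem_mono[OF v th_R])
      then have thI: "mem v th I" using I_mem[OF v] \<open>C v\<close> mem_D eq_refl by blast
      have "A2 v N th x c"
        by (rule N_val[OF v thI mem_mono[OF v AR[OF le_refl xA]] A2_mono[OF k(3) v] RA_mono[OF k(4) v]])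
      then have "\<not> LT v on c" using sub[rule_format, OF le_refl xA] v thI le_refl by blast
      then show False using LT_mono[OF k(5) v] by blast
    qed
    then show ?thesis by blast
  next
    assume sm: "\<forall>v. w0 \<preceq> v \<longrightarrow> (\<forall>k. mem v k n \<longrightarrow> small two f v k)"
    have "\<exists>u. v \<preceq> u \<and> C u" if v: "w0 \<preceq> v" for v
    proof (rule ccontr)
      \<comment> \<open>If \<open>C\<close> fails from \<open>v\<close> on, 1 is the only index
        there, so the number 1 lies in the unit ball and has to be approximated.\<close>
      assume nC: "\<not> (\<exists>u. v \<preceq> u \<and> C u)"
      interpret o: ofield "K v" "op ad v" "op mu v" "cl v ze" "cl v on" "rel LT v" "rel LE v"
        by (rule ofield_at[OF v])
      have onR: "mem v on R" by (rule zero_one_mem(2)[OF v])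
      have ball: "\<not> LT s on c" if h: "v \<preceq> r" "mem r i I" "r \<preceq> s" "A2 s N i on c" for r i s c
      proof -
        have s: "v \<preceq> s" "w0 \<preceq> s" "w0 \<preceq> r" using h v le_trans by meson+
        interpret os: ofield "K s" "op ad s" "op mu s" "cl s ze" "cl s on" "rel LT s" "rel LE s"
          by (rule ofield_at[OF s(2)])
        note so = zero_one_mem[OF s(2)]
        have oo: "eq s on on" using mem_D[OF so(2)] eq_refl by blast
        have "eq r i on" using I_mem[OF s(3)] h(1,2) nC by blast
        then have i: "eq s i on" using eq_mono h(3) by blast
        obtain y where y: "A2 s mu i on y" "mem s y R" "RA s y c"
          by (rule N_E[OF s(2) mem_mono[OF h(3,2)] so(2) h(4)])
        have "A2 s mu on on y" using A2_cong[OF y(1) i oo] mem_D[OF y(2)] eq_refl by blast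
        then have "eq s y on" using mu_unique[OF s(2) so(2,2) _ mu_on(1)[OF s(2) so(2)]] by blast
        then have "RA s on c" using RA_cong[OF s(2) y(2,3)] mem_D[OF RA_range[OF y(3)]] eq_refl by blast
        moreover have "LE s ze on"
          using os.lt_le[OF _ _ os.zero_lt_one] le_cl[OF so] by simp
        ultimately have "eq s c on" using RA_unique[OF s(2) so(2) _ RA_self[OF s(2) so(2)]] by blast
        then have "LT s on on" if "LT s on c" using LT_cong[OF that oo] by blast
        then show ?thesis using os.lt_irrefl[of "cl s on"] lt_cl[OF so(2,2)] by auto
      qed
      have "\<exists>y. mem v y A \<and> (\<forall>r. v \<preceq> r \<longrightarrow> (\<forall>i. mem r i I \<longrightarrow>
          (\<exists>c. (\<exists>z. VM r on y z \<and> A2 r N i z c) \<and> LT r c e)))"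
        by (rule cover[rule_format, OF v _ le_refl]) (use onR ball mem_D in blast)+
      then obtain y where y: "mem v y A" "\<exists>c. (\<exists>z. VM v on y z \<and> A2 v N on z c) \<and> LT v c e"
        using on_I[OF v] le_refl by blast
      obtain z d where z: "VM v on y z" "A2 v N on z d" "LT v d e" using y(2) by blast
      have yR: "mem v y R" by (rule AR[OF v y(1)])
      have zR: "mem v z R" by (rule VM_cl(1)[OF v onR yR z(1)])
      obtain z1 where z1: "A2 v mu on z z1" "mem v z1 R" "RA v z1 d"
        by (rule N_E[OF v on_I[OF v] zR z(2)])
      have "eq v z1 z" using mu_unique[OF v onR zR z1(1) mu_on(1)[OF v zR]] .
      then have zd: "RA v z d" using RA_cong[OF v z1(2,3)] mem_D[OF RA_range[OF z1(3)]] eq_refl by blast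
      \<comment> \<open>The point near 1 is the \<open>k\<close>-th one for some \<open>k\<close>,
        to which the estimate below 2 applies.\<close>
      obtain k y' where k: "mem v k n" "AP v f k y'" "eq v y' y" using enum v y(1) by blast
      obtain x p c where x: "AP v f k x" "A2 v mu th x p" "RA v p c" "LT v c two"
        using sm v k(1) unfolding small_def by blast
      have "eq v x y" using FN_unique[OF A(3) v k(1) x(1) k(2)] k(3) eq_trans by blast
      have thR: "mem v th R" by (rule mem_mono[OF v th_R])
      have pt: "A2 v mu th y p" using A2_cong[OF x(2) _ \<open>eq v x y\<close>] mem_D[OF thR] A2_D[OF x(2)] eq_refl by blast
      have pR: "mem v p R" by (rule mu_range[OF v thR yR pt])
      have eR: "mem v e R" and twR: "mem v two R" by (rule mem_mono[OF v e(1)], rule mem_mono[OF v two(2)])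
      note th = th_cl[OF v]
      show False
      proof (rule o.approximation_contradiction[OF cl_K[OF yR] cl_K[OF zR] cl_K[OF eR]])
        show "op ad v (cl v z) (cl v y) = cl v on" by (rule VM_cl(2)[OF v onR yR z(1)])
        show "op mu v o.th (cl v e) = cl v on"
          using ti_cl[OF v thR eR A2_mono[OF q(1) v]] cl_eqI[OF eq_mono[OF v q1]] th by simp
        show "ISABS v (cl v z) (cl v d)" by (rule RA_isabs[OF v zR zd])
        show "rel LT v (cl v d) (cl v e)" using lt_cl[OF RA_range[OF zd] eR] z(3) by simp
        show "ISABS v (op mu v o.th (cl v y)) (cl v c)"
          using RA_isabs[OF v pR x(3)] ti_cl[OF v thR yR pt] th by simp
        show "rel LT v (cl v c) (op ad v (cl v on) (cl v on))"
          using lt_cl[OF RA_range[OF x(3)] twR] x(4) pl_cl[OF v onR onR A2_mono[OF two(1) v]] by simp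
      qed
    qed
    then show ?thesis by blast
  qed
qed

end

section \<open>Assembling the sentence\<close>

context kripke
begin

text \<open>The outer quantifiers are handled singly and not by the \<open>FR\<close> rules:
  \<open>TF\<close> and \<open>TV\<close> require the components to have fixed values, and
  \<open>TV\<close> even those of the real line.\<close>

lemma frc_all_I:
  assumes "\<And>v x. w \<preceq> v \<Longrightarrow> x \<in> D v \<Longrightarrow> frc (F (var d) (Suc d)) v (lenv (Suc d) (E(d := x)) p)"
  shows "frc (f_all F d) w (lenv d E p)"
  using assms by (simp add: f_all_def lenv_Suc)

lemma frc_all_E:
  assumes "frc (f_all F d) w (lenv d E p)" "x \<in> D w"
  shows "frc (F (var d) (Suc d)) w (lenv (Suc d) (E(d := x)) p)"
  using assms by (simp add: f_all_def lenv_Suc)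

lemma frc_imp_I:
  assumes "\<And>v. w \<preceq> v \<Longrightarrow> frc (A d) v r \<Longrightarrow> frc (B d) v r"
  shows "frc ((A \<^bold>\<longrightarrow> B) d) w r"
  using assms by (simp add: f_imp_def)

lemma frc_imp_E: "frc ((A \<^bold>\<longrightarrow> B) d) w r \<Longrightarrow> frc (A d) w r \<Longrightarrow> frc (B d) w r"
  by (simp add: f_imp_def)

lemma frc_and: "frc ((A \<^bold>\<and> B) d) w r \<longleftrightarrow> frc (A d) w r \<and> frc (B d) w r"
  by (simp add: f_and_def)

end

context reals_model
begin

text \<open>The hypothesis on unit balls is instantiated with the space built from \<open>s\<close>,
  where \<open>C\<close> is the condition that the numeral 1 is in the range of
  \<open>s\<close>.\<close>

lemma WL_holds:
  assumes F: "TF p \<Gamma> F" "ok d E \<Gamma>"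
    and H: "frc ((\<^bold>\<forall>X vad vzer smu I nrm.
         let V = QSpace X vad vzer smu I nrm in
         q_normed_space F V \<^bold>\<and> finite_dimensional F V \<^bold>\<longrightarrow>
           totally_bounded F V (unit_ball F V)) d) w0 (lenv d E p)"
    and s: "BSEQ w0 s" "s \<in> D w0"
  shows "WL w0 s"
proof -
  note zo = zero_one_mem[OF le_refl]
  obtain om em uu b where om: "OM w0 om" and em: "EM w0 em" and uu: "SC w0 em uu" and b: "SC w0 uu b"
    and fn: "FN w0 s om b"
    using s(1) unfolding BSEQ_def by (elim exE conjE)
  obtain two where two: "A2 w0 ad on on two" "mem w0 two R" using ad_ex[OF le_refl zo(2,2)] by (elim exE conjE)
  obtain th where th: "A2 w0 ad two on th" "mem w0 th R" using ad_ex[OF le_refl two(2) zo(2)] by (elim exE conjE)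
  have th_cl: "cl v th = ofield.th (op ad v) (cl v on)" if v: "w0 \<preceq> v" for v
  proof -
    interpret o: ofield "K v" "op ad v" "op mu v" "cl v ze" "cl v on" "rel LT v" "rel LE v"
      by (rule ofield_at[OF v])
    note onR = zero_one_mem(2)[OF v]
    show ?thesis
      unfolding o.th_def pl_cl[OF v onR onR A2_mono[OF two(1) v]]
        pl_cl[OF v mem_mono[OF v two(2)] onR A2_mono[OF th(1) v]] ..
  qed
  have omD: "om \<in> D w0" using om unfolding OM_def by blast
  \<comment> \<open>This relation collects the range \<open>Y\<close> of the sequence, so that
    \<open>uu \<in> Y\<close> expresses that some term is 1.\<close>
  have "FR q (insert (l, n) (insert (m, y) (params [s]))) (pair (var l) (var m) \<^bold>\<in> var 0)
      (\<lambda>v. \<exists>p. PR v n y p \<and> mem v p s)" for q l m n y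
    unfolding params1 by (rule FR_cong, (rule TR_pair FR_rules)+) simp
  then obtain Y where Y: "Y \<in> D w0"
    "\<And>v n. w0 \<preceq> v \<Longrightarrow> mem v n om \<Longrightarrow> \<exists>y. mem v y Y \<and> (\<exists>p. PR v n y p \<and> mem v p s)"
    "\<And>v y. w0 \<preceq> v \<Longrightarrow> mem v y Y \<Longrightarrow> \<exists>n. mem v n om \<and> (\<exists>p. PR v n y p \<and> mem v p s)"
  proof (rule strong_collection[where w = w0 and a = om])
    fix v n assume v: "w0 \<preceq> v" "mem v n om"
    obtain y where "AP v s n y" using FN_ex[OF fn v] by blast
    then show "\<exists>y\<in>D v. \<exists>p. PR v n y p \<and> mem v p s" unfolding AP_def by blast
  qed (use s omD in simp_all)
  have Y2: "\<exists>y. mem v y Y \<and> AP v s n y" if "w0 \<preceq> v" "mem v n om" for v n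
    using Y(2)[OF that] mem_D unfolding AP_def by blast
  have Y3: "\<exists>n. mem v n om \<and> AP v s n y" if "w0 \<preceq> v" "mem v y Y" for v y
    using Y(3)[OF that] mem_D[OF that(2)] unfolding AP_def by blast
  have uuD: "uu \<in> D w0" and thD: "th \<in> D w0" using uu mem_D[OF th(2)] unfolding SC_def by simp_all
  obtain I where I: "I \<in> D w0"
    "\<And>v i. w0 \<preceq> v \<Longrightarrow> mem v i I \<longleftrightarrow> mem v i R \<and> (eq v i on \<or> eq v i th \<and> mem v uu Y)"
    using index_set_ex[OF thD uuD Y(1)] by metis
  have IR: "mem v i R" if "w0 \<preceq> v" "mem v i I" for v i using I(2) that by blast
  obtain N c where N: "N \<in> D w0" "TM w0 I R c" "FN w0 N c R"
    "\<And>v i x y r. w0 \<preceq> v \<Longrightarrow> mem v i I \<Longrightarrow> mem v x R \<Longrightarrow> A2 v mu i x y \<Longrightarrow> RA v y r \<Longrightarrow> A2 v N i x r"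
    using norm_ex[OF I(1) IR] by metis
  interpret counterexample le D mem eq R ad mu ls ze on w0 I N th om em uu "\<lambda>v. mem v uu Y" c
    by unfold_locales (fact th(2) th_cl I(2) N(2-4) om em uu)+
  let ?V = "QSpace (var d) (var (Suc d)) (var (Suc (Suc d))) (var (Suc (Suc (Suc d))))
    (var (Suc (Suc (Suc (Suc d))))) (var (Suc (Suc (Suc (Suc (Suc d))))))"
  \<comment> \<open>The levels follow the order of the components in \<open>QSpace\<close>, with
    zero before multiplication, unlike in \<open>Reals\<close>.\<close>
  let ?E = "E(d := R, Suc d := ad, Suc (Suc d) := ze, Suc (Suc (Suc d)) := mu,
    Suc (Suc (Suc (Suc d))) := I, Suc (Suc (Suc (Suc (Suc d)))) := N)"
  let ?d = "Suc (Suc (Suc (Suc (Suc (Suc d)))))"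
  let ?\<Gamma> = "insert (d, R) (insert (Suc d, ad) (insert (Suc (Suc d), ze) (insert (Suc (Suc (Suc d)), mu)
    (insert (Suc (Suc (Suc (Suc d))), I) (insert (Suc (Suc (Suc (Suc (Suc d)))), N) \<Gamma>)))))"
  have TF': "TF p ?\<Gamma> F" by (intro TF_insert F(1))
  have TV': "TV p ?\<Gamma> ?V" unfolding TV_def by (auto intro!: TR_var)
  have ok': "\<forall>(l, x)\<in>?\<Gamma>. l < ?d \<and> ?E l = x"
    using F(2) unfolding ok_def by fastforce
  have "frc ((q_normed_space F ?V \<^bold>\<and> finite_dimensional F ?V \<^bold>\<longrightarrow>
      totally_bounded F ?V (unit_ball F ?V)) ?d) w0 (lenv ?d ?E p)"
    using frc_all_E[OF frc_all_E[OF frc_all_E[OF frc_all_E[OF frc_all_E[OF frc_all_E[OF H[unfolded Let_def]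
      ops_D(1)] ops_D(2)] ops_D(5)] ops_D(3)] I(1)] N(1)] .
  moreover have "frc ((q_normed_space F ?V \<^bold>\<and> finite_dimensional F ?V) ?d) w0 (lenv ?d ?E p)"
    unfolding frc_and FR_D[OF FR_q_normed[OF TF' TV'] ok'] FR_D[OF FR_finite_dimensional[OF TF' TV'] ok']
    using QN_holds FINDIM_holds by simp
  ultimately have "frc (totally_bounded F ?V (unit_ball F ?V) ?d) w0 (lenv ?d ?E p)"
    by (rule frc_imp_E)
  then have "TBD w0" unfolding FR_D[OF FR_totally_bounded[OF TF' TV'] ok'] .
  then have "(\<forall>v. w0 \<preceq> v \<longrightarrow> \<not> mem v uu Y) \<or> (\<forall>v. w0 \<preceq> v \<longrightarrow> (\<exists>u. v \<preceq> u \<and> mem u uu Y))"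
    by (rule dichotomy)
  then show ?thesis
  proof (elim disjE)
    \<comment> \<open>The terms lie in \<open>{0, 1}\<close>, and a term equal to 1 would put
      \<open>uu\<close> into \<open>Y\<close>; so all terms are 0.\<close>
    assume nY: "\<forall>v. w0 \<preceq> v \<longrightarrow> \<not> mem v uu Y"
    show ?thesis
      unfolding WL_def
    proof (intro disjI1 allI impI)
      fix v n assume v: "w0 \<preceq> v" "\<exists>om. OM v om \<and> mem v n om"
      then obtain om' where om': "OM v om'" "mem v n om'" by blast
      have "SCC v om" "om \<in> D v" using OM_mono[OF om v(1)] unfolding OM_def by simp_all
      then have n: "mem v n om" using om' le_refl unfolding OM_def by blast
      obtain x where x: "AP v s n x" "mem v x b" using FN_ex[OF fn v(1) n] by blast
      have "mem v x uu \<or> eq v x uu" using b v(1) x(2) unfolding SC_def by blast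
      moreover have "\<not> eq v x uu"
      proof
        assume xu: "eq v x uu"
        obtain y where y: "mem v y Y" "AP v s n y" using Y2[OF v(1) n] by blast
        have "eq v y uu" using FN_unique[OF fn v(1) n y(2) x(1)] xu eq_trans by blast
        then have "mem v uu Y" using mem_cong[OF y(1)] mem_D[OF y(1)] eq_refl by blast
        then show False using nY v(1) by blast
      qed
      ultimately have "eq v x em" using mem_uu[OF v(1)] by blast
      then show "\<exists>x. AP v s n x \<and> (\<exists>e. EM v e \<and> eq v x e)" using x(1) EM_mono[OF em v(1)] by blast
    qed
  next
    \<comment> \<open>Wherever \<open>uu\<close> is in \<open>Y\<close>, some term is 1 there and
      hence not 0; such worlds exist above every later world.\<close>
    assume nn: "\<forall>v. w0 \<preceq> v \<longrightarrow> (\<exists>u. v \<preceq> u \<and> mem u uu Y)"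
    show ?thesis
      unfolding WL_def
    proof (intro disjI2 allI impI)
      fix v assume v: "w0 \<preceq> v"
      then obtain u where u: "v \<preceq> u" "mem u uu Y" using nn by blast
      have w: "w0 \<preceq> u" using le_trans[OF v u(1)] .
      obtain n where n: "mem u n om" "AP u s n uu" using Y3[OF w u(2)] by blast
      have "\<not> eq u x e" if "AP u s n x" "EM u e" for x e
      proof
        assume xe: "eq u x e"
        have "eq u e uu" using FN_unique[OF fn w n(1) that(1) n(2)] xe eq_sym eq_trans by meson
        then have "EM u uu" using EM_cong[OF that(2)] by blast
        then show False using em_uu[OF w] le_refl unfolding EM_def by blast
      qed
      then show "\<exists>u. v \<preceq> u \<and> (\<exists>n. (\<exists>om. OM u om \<and> mem u n om) \<and>
          (\<forall>x. AP u s n x \<longrightarrow> (\<forall>e. EM u e \<longrightarrow> \<not> eq u x e)))"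
        using u(1) n(1) OM_mono[OF om w] by blast
    qed
  qed
qed

end

text \<open>If the sentence were not derivable, completeness would give a Kripke model of CZF + DC
  with a world at which it is not forced; the construction above forces it at every world of such a
  model.\<close>

theorem mainTheorem10:
  shows "BISH \<turnstile> (\<^bold>\<forall>R add mul less zero one.
    let F = Reals R add mul less zero one in
    real_numbers F \<^bold>\<longrightarrow>
      (\<^bold>\<forall>X vad vzer smu I nrm.
         let V = QSpace X vad vzer smu I nrm in
         q_normed_space F V \<^bold>\<and> finite_dimensional F V \<^bold>\<longrightarrow>
           totally_bounded F V (unit_ball F V)) \<^bold>\<longrightarrow>
      WLPO)"
  unfolding BISH_proves_def
proof (rule ccontr)
  let ?S = "\<^bold>\<forall>R add mul less zero one.
    let F = Reals R add mul less zero one in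
    real_numbers F \<^bold>\<longrightarrow>
      (\<^bold>\<forall>X vad vzer smu I nrm.
         let V = QSpace X vad vzer smu I nrm in
         q_normed_space F V \<^bold>\<and> finite_dimensional F V \<^bold>\<longrightarrow>
           totally_bounded F V (unit_ball F V)) \<^bold>\<longrightarrow>
      WLPO"
  assume nd: "\<not> deriv (CZF \<union> DC) {} (closed ?S)"
  obtain le D mem eq and w :: "nat \<times> fm set" and e :: "nat \<Rightarrow> nat" where
    k: "kripke le D mem eq"
    and ax: "\<forall>B\<in>CZF \<union> DC. \<forall>v f. (\<forall>i. f i \<in> D v) \<longrightarrow> kripke.frc le D mem eq B v f"
    and n: "\<not> kripke.frc le D mem eq (closed ?S) w e"
    using kripke_completeness[OF nd] by (elim exE conjE) (rule that)
  interpret kripke le D mem eq by (rule k)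
  interpret czf le D mem eq by unfold_locales (use ax in blast)
  have "frc (?S 0) w (lenv 0 E e)" for E
  proof (rule frc_all_I)+
    fix v1 x1 v2 x2 v3 x3 v4 x4 v5 x5 v6 x6
    let ?F = "Reals (var 0) (var (Suc 0)) (var (Suc (Suc 0))) (var (Suc (Suc (Suc 0))))
      (var (Suc (Suc (Suc (Suc 0))))) (var (Suc (Suc (Suc (Suc (Suc 0))))))"
    let ?d = "Suc (Suc (Suc (Suc (Suc (Suc 0)))))"
    let ?E = "E(0 := x1, Suc 0 := x2, Suc (Suc 0) := x3, Suc (Suc (Suc 0)) := x4,
      Suc (Suc (Suc (Suc 0))) := x5, Suc (Suc (Suc (Suc (Suc 0)))) := x6)"
    let ?\<Gamma> = "{(0, x1), (Suc 0, x2), (Suc (Suc 0), x3), (Suc (Suc (Suc 0)), x4),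
      (Suc (Suc (Suc (Suc 0))), x5), (Suc (Suc (Suc (Suc (Suc 0)))), x6)}"
    interpret realctx le D mem eq x1 x2 x3 x4 x5 x6 by unfold_locales
    have F: "TF e ?\<Gamma> ?F" unfolding TF_def by (auto intro!: TR_var)
    have o: "ok ?d ?E ?\<Gamma>" by (auto simp: ok_def)
    show "frc ((let F = ?F in real_numbers F \<^bold>\<longrightarrow>
      (\<^bold>\<forall>X vad vzer smu I nrm.
         let V = QSpace X vad vzer smu I nrm in
         q_normed_space F V \<^bold>\<and> finite_dimensional F V \<^bold>\<longrightarrow>
           totally_bounded F V (unit_ball F V)) \<^bold>\<longrightarrow>
      WLPO) ?d) v6 (lenv ?d ?E e)"
      unfolding Let_def[of ?F]
    proof (rule frc_imp_I, rule frc_imp_I, rule FR_I[OF _ FR_WLPO])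
      fix v v'
      assume v: "frc (real_numbers ?F ?d) v (lenv ?d ?E e)" "le v v'"
        and H: "frc ((\<^bold>\<forall>X vad vzer smu I nrm.
          let V = QSpace X vad vzer smu I nrm in
          q_normed_space ?F V \<^bold>\<and> finite_dimensional ?F V \<^bold>\<longrightarrow>
            totally_bounded ?F V (unit_ball ?F V)) ?d) v' (lenv ?d ?E e)"
      show "ok ?d ?E {}" by (simp add: ok_def)
      show "\<forall>u. le v' u \<longrightarrow> (\<forall>s\<in>D u. \<forall>t. le u t \<longrightarrow> BSEQ t s \<longrightarrow> WL t s)"
      proof (intro allI impI ballI)
        fix u s t assume u: "le v' u" "s \<in> D u" "le u t" "BSEQ t s"
        have t: "le v' t" "le v t" using u v(2) le_trans by meson+
        \<comment> \<open>The sequence may exist only at the later world \<open>t\<close>. The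
          axioms for the reals and the hypothesis on unit balls persist to \<open>t\<close>, so the
          space is built there.\<close>
        have "frc (real_numbers ?F ?d) t (lenv ?d ?E e)" by (rule frc_mono[OF v(1) t(2)])
        then have "HEYT t" "ORD t" "LUBP t"
          unfolding real_numbers_def frc_and FR_D[OF FR_heyting[OF F] o[unfolded ok_def]]
            FR_D[OF FR_order[OF F] o[unfolded ok_def]] FR_D[OF FR_lub[OF F] o[unfolded ok_def]]
          by simp_all
        then interpret reals_model le D mem eq x1 x2 x3 x4 x5 x6 t by unfold_locales
        show "WL t s"
          by (rule WL_holds[OF F o frc_mono[OF H t(1)] u(4) D_mono[OF u(3,2)]])
      qed
    qed
  qed
  \<comment> \<open>At depth 0 no level is bound, so the environment consists of the parameters
    \<open>e\<close> alone, whatever \<open>E\<close> is.\<close>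
  moreover have "e = lenv 0 E e" for E by (rule ext) (simp add: lenv_def)
  ultimately show False using n unfolding closed_def by metis
qed

end
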